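(* Let $X$ be a normal projective complex variety of dimension $d$ and let $D$ be an ample Cartier divisor on $X$. Let $X_P$ be the normal projective toric variety associated to a full-dimensional rational convex polytope $P\subseteq\mathbb{R}^d$, and let $D_P$ be the torus invariant $\mathbb{Q}$-Weil divisor associated to $P$. Suppose the pair $(X,D)$ admits a toric degeneration to the toric pair $(X_P,D_P)$. Then $D_P$ is a Weil divisor, i.e. all its coefficients are integers.
   Context: All varieties are over $\mathbb{C}$; $\mathbb{N}$ denotes the positive integers. Toric notation. A rational convex polytope is the convex hull of finitely many points of $\mathbb{Q}^d$. For a full-dimensional rational convex polytope $P\subseteq\mathbb{R}^d$ let $\Sigma_P$ be its (outer) normal fan, $\Sigma_P(1)$ the set of rays, $u_\rho\in\mathbb{Z}^d$ the primitive generator of the ray $\rho$, and $b_\rho=\max_{x\in P}\langle x,u_\rho\rangle\in\mathbb{Q}$, so that $P=\{x\in\mathbb{R}^d\mid\langle x,u_\rho\rangle\le b_\rho\ \forall\rho\in\Sigma_P(1)\}$. $X_P$ is the normal projective toric variety of the fan $\Sigma_P$, $D_\rho$ is the torus invariant prime divisor of the ray $\rho$, and $D_P=\sum_\rho b_\rho D_\rho$ (an ample $\mathbb{Q}$-Cartier $\mathbb{Q}$-Weil divisor). For a $\mathbb{Q}$-Weil divisor $E=\sum_\rho a_\rho D_\rho$ put $\lfloor E\rfloor=\sum_\rho\lfloor a_\rho\rfloor D_\rho$. For a Weil divisor $E$ on a normal variety, $\mathcal{O}(E)$ is the associated divisorial (rank one reflexive) sheaf. Toric degeneration. Let $X$ be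 a normal projective variety of dimension $d$, $D$ an ample Cartier divisor on $X$, and $P\subseteq\mathbb{R}^d$ a full-dimensional rational convex polytope. The pair $(X,D)$ admits a toric degeneration to $(X_P,D_P)$ if there are a complex variety $\mathcal{X}$ and a morphism $\pi\colon\mathcal{X}\to\mathbb{A}^1$, with fibers $\mathcal{X}_t$, such that (i) $\pi$ is projective and flat; (ii) $\mathcal{X}_t\simeq X$ for all $t\neq0$ and $\mathcal{X}_0\simeq X_P$; (iii) for every $n\in\mathbb{N}$ there is a divisorial sheaf $\mathcal{F}^{(n)}$ on $\mathcal{X}$ such that, under these isomorphisms, $\mathcal{F}^{(n)}|_{\mathcal{X}_t}\simeq\mathcal{O}_X(nD)$ for all $t\ne0$ and $\mathcal{F}^{(n)}|_{\mathcal{X}_0}\simeq\mathcal{O}_{X_P}(\lfloor nD_P\rfloor)$. *)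

theory Defs
  imports
    "HOL-Analysis.Analysis"
    "HOL-Library.Poly_Mapping"
    "HOL-Computational_Algebra.Polynomial"
    "HOL-Computational_Algebra.Fraction_Field"
begin

text \<open>
  Integral separated schemes of finite type over the complex numbers are represented as
  Chevalley schemes (EGA I, section 8.3). In such a scheme a point is determined by its local
  ring, seen as a subring of the function field; so the scheme is the set of its local rings.
  The generic point is the function field itself, and \<open>R \<subseteq> S\<close> says that the point \<open>S\<close>
  specializes to the point \<open>R\<close>. The type \<open>'k\<close> is only an ambient field: the function field
  is the union of all points.
\<close>

record 'k model =
  scalar :: "complex \<Rightarrow> 'k"
  points :: "'k set set"

definition function_field :: "'k model \<Rightarrow> 'k set" where
  "function_field X = \<Union>(points X)"

subsection \<open>Rings inside a field\<close>

definition subalgebra :: "(complex \<Rightarrow> 'k::field) \<Rightarrow> 'k set \<Rightarrow> bool" where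
  "subalgebra sc A \<longleftrightarrow> range sc \<subseteq> A \<and> (\<forall>a\<in>A. \<forall>b\<in>A. a + b \<in> A \<and> a * b \<in> A)"

definition generated_algebra :: "(complex \<Rightarrow> 'k::field) \<Rightarrow> 'k set \<Rightarrow> 'k set" where
  "generated_algebra sc G = subalgebra sc hull G"

definition is_subring :: "'k::field set \<Rightarrow> bool" where
  "is_subring R \<longleftrightarrow> 1 \<in> R \<and> (\<forall>a\<in>R. \<forall>b\<in>R. a - b \<in> R \<and> a * b \<in> R)"

definition is_ideal :: "'a::comm_ring_1 set \<Rightarrow> 'a set \<Rightarrow> bool" where
  "is_ideal A I \<longleftrightarrow> I \<subseteq> A \<and> 0 \<in> I \<and> (\<forall>x\<in>I. \<forall>y\<in>I. x + y \<in> I) \<and> (\<forall>a\<in>A. \<forall>x\<in>I. a * x \<in> I)"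

definition is_prime_ideal :: "'a::comm_ring_1 set \<Rightarrow> 'a set \<Rightarrow> bool" where
  "is_prime_ideal A I \<longleftrightarrow>
     is_ideal A I \<and> 1 \<notin> I \<and> (\<forall>a\<in>A. \<forall>b\<in>A. a * b \<in> I \<longrightarrow> a \<in> I \<or> b \<in> I)"

definition localization :: "'k::field set \<Rightarrow> 'k set \<Rightarrow> 'k set" where
  "localization A I = {a / s | a s. a \<in> A \<and> s \<in> A - I}"

definition spec_points :: "'k::field set \<Rightarrow> 'k set set" where
  "spec_points A = {localization A I | I. is_prime_ideal A I}"

definition ring_units :: "'k::field set \<Rightarrow> 'k set" where
  "ring_units R = {x \<in> R. x \<noteq> 0 \<and> inverse x \<in> R}"

definition max_ideal :: "'k::field set \<Rightarrow> 'k set" where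
  "max_ideal R = R - ring_units R"

definition local_subring :: "'k::field set \<Rightarrow> bool" where
  "local_subring R \<longleftrightarrow> is_subring R \<and> is_ideal R (max_ideal R)"

definition dominates :: "'k::field set \<Rightarrow> 'k set \<Rightarrow> bool" where
  "dominates T R \<longleftrightarrow> R \<subseteq> T \<and> max_ideal T \<inter> R = max_ideal R"

definition mod_span :: "'k::field set \<Rightarrow> 'k set \<Rightarrow> 'k set" where
  "mod_span R G = {\<Sum>g\<in>H. c g * g | H c. finite H \<and> H \<subseteq> G \<and> (\<forall>g\<in>H. c g \<in> R)}"

definition integrally_closed_in :: "'k::field set \<Rightarrow> 'k set \<Rightarrow> bool" where
  "integrally_closed_in R K \<longleftrightarrow>
     (\<forall>f\<in>K. (\<exists>q :: 'k poly. lead_coeff q = 1 \<and> (\<forall>i. coeff q i \<in> R) \<and> poly q f = 0) \<longrightarrow> f \<in> R)"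

subsection \<open>Varieties\<close>

text \<open>
  The last condition is separatedness: two points that are dominated by a common local ring
  (related points, in the sense of EGA I, 8.1.4) are equal. Since the charts are of finite type
  and have the same fraction field, their pairwise intersections are open in each of them.
\<close>

definition variety :: "'k::field model \<Rightarrow> bool" where
  "variety X \<longleftrightarrow>
     scalar X 1 = 1 \<and>
     (\<forall>a b. scalar X (a + b) = scalar X a + scalar X b \<and>
            scalar X (a * b) = scalar X a * scalar X b) \<and>
     (\<exists>\<A>. finite \<A> \<and> \<A> \<noteq> {} \<and>
        (\<forall>A\<in>\<A>. \<exists>G. finite G \<and> A = generated_algebra (scalar X) G) \<and>
        (\<forall>A\<in>\<A>. localization A {0} = function_field X) \<and>
        points X = (\<Union>A\<in>\<A>. spec_points A)) \<and>
     (\<forall>R\<in>points X. \<forall>S\<in>points X. \<forall>T.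
        local_subring T \<and> dominates T R \<and> dominates T S \<longrightarrow> R = S)"

definition normal_variety :: "'k::field model \<Rightarrow> bool" where
  "normal_variety X \<longleftrightarrow>
     variety X \<and> (\<forall>R\<in>points X. integrally_closed_in R (function_field X))"

text \<open>
  The opens of the affine scheme of a finitely generated algebra are generated by the sets of
  all local rings that contain a given rational function, and by separatedness the same holds
  for the Zariski topology of a variety.
\<close>

definition zariski :: "'k model \<Rightarrow> 'k set topology" where
  "zariski X = topology_generated_by {{R \<in> points X. f \<in> R} | f. f \<in> function_field X}"

text \<open>Chains of irreducible closed sets are chains of their generic points.\<close>

definition variety_dimension :: "'k model \<Rightarrow> enat" where
  "variety_dimension X = (SUP n \<in> {n. \<exists>c. (\<forall>i\<le>n. c i \<in> points X) \<and> (\<forall>i<n. c i \<subset> c (Suc i))}. enat n)"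

text \<open>
  The closed subscheme of a projective space whose homogeneous coordinates restrict to the
  elements of \<open>G\<close> (after trivializing the twisting sheaf at the generic point). The chart where
  \<open>x \<in> G\<close> does not vanish has the coordinate ring generated by all \<open>y / x\<close>. The set \<open>B\<close> consists
  of generators of the coordinate ring of the affine base.
\<close>

definition proj_points :: "(complex \<Rightarrow> 'k::field) \<Rightarrow> 'k set \<Rightarrow> 'k set \<Rightarrow> 'k set set" where
  "proj_points sc B G =
     (\<Union>x \<in> G - {0}. spec_points (generated_algebra sc (B \<union> (\<lambda>y. y / x) ` G)))"

definition projective_variety :: "'k::field model \<Rightarrow> bool" where
  "projective_variety X \<longleftrightarrow>
     variety X \<and> (\<exists>G. finite G \<and> points X = proj_points (scalar X) {} G)"

subsection \<open>Sheaves and divisors\<close>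

text \<open>
  A coherent torsion-free sheaf of rank one is isomorphic to a nonzero coherent subsheaf of the
  constant sheaf of rational functions. It is represented by the family of its stalks, which is
  locally generated by a fixed finite set. Reflexivity is checked on stalks, with the dual of a
  stalk computed inside the function field.
\<close>

definition dual_in :: "'k::field set \<Rightarrow> 'k set \<Rightarrow> 'k set \<Rightarrow> 'k set" where
  "dual_in K R M = {f \<in> K. \<forall>m\<in>M. f * m \<in> R}"

definition divisorial_sheaf :: "'k::field model \<Rightarrow> ('k set \<Rightarrow> 'k set) \<Rightarrow> bool" where
  "divisorial_sheaf X F \<longleftrightarrow>
     (\<forall>R\<in>points X.
        (\<exists>U G. openin (zariski X) U \<and> R \<in> U \<and> finite G \<and> G \<subseteq> function_field X \<and> \<not> G \<subseteq> {0} \<and>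
               (\<forall>S\<in>U. F S = mod_span S G)) \<and>
        dual_in (function_field X) R (dual_in (function_field X) R (F R)) = F R)"

text \<open>A Cartier divisor assigns to each point a local equation that is valid near that point.\<close>

definition cartier_divisor :: "'k::field model \<Rightarrow> ('k set \<Rightarrow> 'k) \<Rightarrow> bool" where
  "cartier_divisor X D \<longleftrightarrow>
     (\<forall>R\<in>points X. D R \<in> function_field X - {0} \<and>
        (\<exists>U. openin (zariski X) U \<and> R \<in> U \<and> (\<forall>S\<in>U. D R / D S \<in> ring_units S)))"

definition cartier_multiple_sheaf :: "('k::field set \<Rightarrow> 'k) \<Rightarrow> nat \<Rightarrow> 'k set \<Rightarrow> 'k set" where
  "cartier_multiple_sheaf D n R = {a / D R ^ n | a. a \<in> R}"

text \<open>
  Some positive multiple is very ample: its sheaf is generated by the homogeneous coordinates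
  of a closed embedding into a projective space, that is, it is the pullback of the twisting
  sheaf. A rescaling of \<open>G\<close> absorbs the isomorphism between the two sheaves.
\<close>

definition ample :: "'k::field model \<Rightarrow> ('k set \<Rightarrow> 'k) \<Rightarrow> bool" where
  "ample X D \<longleftrightarrow>
     (\<exists>m\<ge>1. \<exists>G. finite G \<and> points X = proj_points (scalar X) {} G \<and>
        (\<forall>R\<in>points X. cartier_multiple_sheaf D m R = mod_span R G))"

definition prime_divisors :: "'k model \<Rightarrow> 'k set set" where
  "prime_divisors X =
     {S \<in> points X. S \<noteq> function_field X \<and>
        (\<forall>T\<in>points X. S \<subseteq> T \<longrightarrow> T = S \<or> T = function_field X)}"

text \<open>The valuation of a discrete valuation ring, on nonzero elements.\<close>

definition ord_at :: "'k::field set \<Rightarrow> 'k \<Rightarrow> int" where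
  "ord_at S f =
     (THE n. \<exists>u. max_ideal S = {u * a | a. a \<in> S} \<and> f * u powi (- n) \<in> ring_units S)"

text \<open>
  A divisor is the function of its coefficients at the prime divisors, which is zero at all
  other arguments.
\<close>

definition weil_divisor :: "'k model \<Rightarrow> ('k set \<Rightarrow> real) \<Rightarrow> bool" where
  "weil_divisor X E \<longleftrightarrow>
     finite {S. E S \<noteq> 0} \<and> {S. E S \<noteq> 0} \<subseteq> prime_divisors X \<and> (\<forall>S\<in>prime_divisors X. E S \<in> \<int>)"

definition floor_multiple :: "nat \<Rightarrow> ('k set \<Rightarrow> real) \<Rightarrow> 'k set \<Rightarrow> int" where
  "floor_multiple n E S = \<lfloor>real n * E S\<rfloor>"

definition weil_sheaf :: "'k::field model \<Rightarrow> ('k set \<Rightarrow> int) \<Rightarrow> 'k set \<Rightarrow> 'k set" where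
  "weil_sheaf X E R =
     {f \<in> function_field X.
        f = 0 \<or> (\<forall>S\<in>prime_divisors X. R \<subseteq> S \<longrightarrow> ord_at S f \<ge> - E S)}"

subsection \<open>Flatness\<close>

text \<open>
  \<open>act\<close> is the action of the ring \<open>'a\<close> on a module with carrier \<open>M\<close>. Formal sums of pairs are
  elements of a free abelian group, \<open>tensor_null act I M\<close> is the subgroup of bilinear relations,
  and the quotient is the tensor product of \<open>I\<close> and \<open>M\<close> over \<open>'a\<close>. Flatness is
  defined by ideals: this tensor product maps injectively to \<open>M\<close>, for each ideal \<open>I\<close>. (A
  definition by all injections of modules would have to quantify over types.)
\<close>

inductive_set tensor_null ::
    "('a::comm_ring_1 \<Rightarrow> 'm::ring_1 \<Rightarrow> 'm) \<Rightarrow> 'a set \<Rightarrow> 'm set \<Rightarrow> ('a \<times> 'm \<Rightarrow>\<^sub>0 int) set"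
  for act I M where
  zero: "0 \<in> tensor_null act I M"
| diff: "z \<in> tensor_null act I M \<Longrightarrow> w \<in> tensor_null act I M \<Longrightarrow> z - w \<in> tensor_null act I M"
| add_left: "a \<in> I \<Longrightarrow> b \<in> I \<Longrightarrow> m \<in> M \<Longrightarrow>
    Poly_Mapping.single (a + b, m) 1 - Poly_Mapping.single (a, m) 1
      - Poly_Mapping.single (b, m) 1 \<in> tensor_null act I M"
| add_right: "a \<in> I \<Longrightarrow> m \<in> M \<Longrightarrow> n \<in> M \<Longrightarrow>
    Poly_Mapping.single (a, m + n) 1 - Poly_Mapping.single (a, m) 1
      - Poly_Mapping.single (a, n) 1 \<in> tensor_null act I M"
| scale: "a \<in> I \<Longrightarrow> m \<in> M \<Longrightarrow>
    Poly_Mapping.single (r * a, m) 1 - Poly_Mapping.single (a, act r m) 1 \<in> tensor_null act I M"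

definition flat_module :: "('a::comm_ring_1 \<Rightarrow> 'm::ring_1 \<Rightarrow> 'm) \<Rightarrow> 'm set \<Rightarrow> bool" where
  "flat_module act M \<longleftrightarrow>
     (\<forall>I z. is_ideal UNIV I \<and> Poly_Mapping.keys z \<subseteq> I \<times> M \<and>
        (\<Sum>(a, m) \<in> Poly_Mapping.keys z. of_int (Poly_Mapping.lookup z (a, m)) * act a m) = 0
        \<longrightarrow> z \<in> tensor_null act I M)"

subsection \<open>Families over the affine line\<close>

text \<open>A morphism to the affine line is a regular function \<open>p\<close>, the image of the coordinate.\<close>

definition regular_function :: "'k model \<Rightarrow> 'k \<Rightarrow> bool" where
  "regular_function Y p \<longleftrightarrow> (\<forall>R\<in>points Y. p \<in> R)"

definition coordinate_action :: "'k::field model \<Rightarrow> 'k \<Rightarrow> complex poly \<Rightarrow> 'k \<Rightarrow> 'k" where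
  "coordinate_action Y p q r = poly (map_poly (scalar Y) q) p * r"

definition flat_over_line :: "'k::field model \<Rightarrow> 'k \<Rightarrow> bool" where
  "flat_over_line Y p \<longleftrightarrow> (\<forall>R\<in>points Y. flat_module (coordinate_action Y p) R)"

definition projective_over_line :: "'k::field model \<Rightarrow> 'k \<Rightarrow> bool" where
  "projective_over_line Y p \<longleftrightarrow> (\<exists>G. finite G \<and> points Y = proj_points (scalar Y) {p} G)"

definition fiber_points :: "'k::field model \<Rightarrow> 'k \<Rightarrow> complex \<Rightarrow> 'k set set" where
  "fiber_points Y p t = {R \<in> points Y. p - scalar Y t \<in> max_ideal R}"

text \<open>
  The scheme-theoretic fiber over \<open>t\<close> has the local rings \<open>R / (p - t) R\<close>. It is integral if it
  is isomorphic to a variety \<open>X\<close>, and then the local ring of its generic point is the largest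
  element \<open>L\<close> of \<open>fiber_points Y p t\<close>. An isomorphism with \<open>X\<close> is given by the isomorphism of
  function fields \<open>L / (p - t) L \<rightarrow> function_field X\<close>, here lifted to \<open>\<phi>\<close> on \<open>L\<close>; it has to embed
  each \<open>R / (p - t) R\<close> and to match the local rings of the fiber with those of \<open>X\<close>.
\<close>

definition fiber_iso ::
    "'b::field model \<Rightarrow> 'b \<Rightarrow> complex \<Rightarrow> 'k::field model \<Rightarrow> ('b \<Rightarrow> 'k) \<Rightarrow> bool" where
  "fiber_iso Y p t X \<phi> \<longleftrightarrow>
     (let L = \<Union>(fiber_points Y p t) in
        L \<in> fiber_points Y p t \<and>
        (\<forall>a\<in>L. \<forall>b\<in>L. \<phi> (a + b) = \<phi> a + \<phi> b \<and> \<phi> (a * b) = \<phi> a * \<phi> b) \<and>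
        (\<forall>c. \<phi> (scalar Y c) = scalar X c) \<and>
        \<phi> ` L = function_field X \<and>
        (\<forall>R\<in>fiber_points Y p t. {a \<in> R. \<phi> a = 0} = {(p - scalar Y t) * a | a. a \<in> R}) \<and>
        bij_betw (\<lambda>R. \<phi> ` R) (fiber_points Y p t) (points X))"

text \<open>
  The restriction of \<open>F\<close> to the fiber has the stalks \<open>F R / (p - t) F R\<close>. An isomorphism of it with
  the subsheaf \<open>E\<close> of the rational functions on \<open>X\<close>, along \<open>\<phi>\<close>, is determined by its
  \<open>\<phi>\<close>-semilinear effect \<open>\<psi>\<close> on the stalk at the generic point of the fiber.
\<close>

definition restricts_to ::
    "'b::field model \<Rightarrow> 'b \<Rightarrow> complex \<Rightarrow> ('b \<Rightarrow> 'k::field) \<Rightarrow>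
     ('b set \<Rightarrow> 'b set) \<Rightarrow> ('k set \<Rightarrow> 'k set) \<Rightarrow> bool" where
  "restricts_to Y p t \<phi> F E \<longleftrightarrow>
     (let L = \<Union>(fiber_points Y p t) in
        \<exists>\<psi>. (\<forall>m\<in>F L. \<forall>n\<in>F L. \<psi> (m + n) = \<psi> m + \<psi> n) \<and>
            (\<forall>a\<in>L. \<forall>m\<in>F L. \<psi> (a * m) = \<phi> a * \<psi> m) \<and>
            (\<forall>R\<in>fiber_points Y p t.
               \<psi> ` F R = E (\<phi> ` R) \<and>
               {m \<in> F R. \<psi> m = 0} = {(p - scalar Y t) * m | m. m \<in> F R}))"

subsection \<open>Polytopes and toric varieties\<close>

text \<open>
  The cones of \<open>normal_fan\<close> consist of outer normals, and the chart of a cone \<open>\<sigma>\<close> is the spectrum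
  of the semigroup algebra of the lattice points that are nonnegative on \<open>\<sigma>\<close>.
\<close>

definition rational_polytope :: "(real^'d) set \<Rightarrow> bool" where
  "rational_polytope P \<longleftrightarrow>
     (\<exists>V. finite V \<and> (\<forall>v\<in>V. \<forall>i. v $ i \<in> \<rat>) \<and> P = convex hull V)"

definition lattice_vec :: "int^'d \<Rightarrow> real^'d" where
  "lattice_vec m = (\<chi> i. real_of_int (m $ i))"

definition normal_cone :: "(real^'d) set \<Rightarrow> (real^'d) set \<Rightarrow> (real^'d) set" where
  "normal_cone P F = {u. \<forall>x\<in>F. \<forall>y\<in>P. y \<bullet> u \<le> x \<bullet> u}"

definition normal_fan :: "(real^'d) set \<Rightarrow> (real^'d) set set" where
  "normal_fan P = {normal_cone P F | F. F face_of P \<and> F \<noteq> {}}"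

definition rays :: "(real^'d) set \<Rightarrow> (real^'d) set set" where
  "rays P = {\<rho> \<in> normal_fan P. dim \<rho> = 1}"

definition primitive_generator :: "(real^'d) set \<Rightarrow> int^'d" where
  "primitive_generator \<rho> = (THE u. lattice_vec u \<in> \<rho> \<and> Gcd (range (($) u)) = 1)"

definition support_value :: "(real^'d) set \<Rightarrow> (real^'d) set \<Rightarrow> real" where
  "support_value P \<rho> = (SUP x\<in>P. x \<bullet> lattice_vec (primitive_generator \<rho>))"

text \<open>
  An ambient field for the torus: the rational functions in countably many variables, of which
  those with the numbers \<open>to_nat i\<close> (for \<open>i :: 'd\<close>) serve as coordinates of the torus.
\<close>

type_synonym toric_field = "((nat \<Rightarrow>\<^sub>0 nat) \<Rightarrow>\<^sub>0 complex) fract"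

definition toric_scalar :: "complex \<Rightarrow> toric_field" where
  "toric_scalar c = Fract (Poly_Mapping.single 0 c) 1"

definition torus_coordinate :: "'d::finite \<Rightarrow> toric_field" where
  "torus_coordinate i = Fract (Poly_Mapping.single (Poly_Mapping.single (to_nat i) 1) 1) 1"

definition character :: "int^'d \<Rightarrow> toric_field" where
  "character m = (\<Prod>i\<in>UNIV. torus_coordinate i powi (m $ i))"

definition dual_lattice_points :: "(real^'d) set \<Rightarrow> (int^'d) set" where
  "dual_lattice_points \<sigma> = {m. \<forall>u\<in>\<sigma>. lattice_vec m \<bullet> u \<ge> 0}"

definition toric_algebra :: "(real^'d) set \<Rightarrow> toric_field set" where
  "toric_algebra \<sigma> = generated_algebra toric_scalar (character ` dual_lattice_points \<sigma>)"

definition toric_variety :: "(real^'d) set \<Rightarrow> toric_field model" where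
  "toric_variety P =
     \<lparr>scalar = toric_scalar, points = (\<Union>\<sigma>\<in>normal_fan P. spec_points (toric_algebra \<sigma>))\<rparr>"

text \<open>
  The generic point of the divisor of a ray \<open>\<rho>\<close>: on the chart of \<open>\<rho>\<close> this divisor is the closed
  orbit, whose ideal is generated by the characters that are positive on \<open>\<rho>\<close>.
\<close>

definition ray_divisor :: "(real^'d) set \<Rightarrow> toric_field set" where
  "ray_divisor \<rho> =
     localization (toric_algebra \<rho>)
       (mod_span (toric_algebra \<rho>)
          (character ` {m. lattice_vec m \<bullet> lattice_vec (primitive_generator \<rho>) > 0}))"

definition polytope_divisor :: "(real^'d) set \<Rightarrow> toric_field set \<Rightarrow> real" where
  "polytope_divisor P S = (\<Sum>\<rho>\<in>rays P. if S = ray_divisor \<rho> then support_value P \<rho> else 0)"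

subsection \<open>Toric degenerations\<close>

definition toric_degeneration ::
    "'b::field model \<Rightarrow> 'b \<Rightarrow> 'k::field model \<Rightarrow> ('k set \<Rightarrow> 'k) \<Rightarrow> (real^'d) set \<Rightarrow> bool" where
  "toric_degeneration Y p X D P \<longleftrightarrow>
     variety Y \<and> regular_function Y p \<and>
     projective_over_line Y p \<and> flat_over_line Y p \<and>
     (\<exists>\<phi> \<phi>0.
        (\<forall>t. t \<noteq> 0 \<longrightarrow> fiber_iso Y p t X (\<phi> t)) \<and>
        fiber_iso Y p 0 (toric_variety P) \<phi>0 \<and>
        (\<forall>n\<ge>1. \<exists>F. divisorial_sheaf Y F \<and>
           (\<forall>t. t \<noteq> 0 \<longrightarrow> restricts_to Y p t (\<phi> t) F (cartier_multiple_sheaf D n)) \<and>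
           restricts_to Y p 0 \<phi>0 F
             (weil_sheaf (toric_variety P) (floor_multiple n (polytope_divisor P)))))"

end

theory Submission
  imports Defs "HOL-Computational_Algebra.Fundamental_Theorem_Algebra"
begin

text \<open>
  Let \<open>F\<close> and \<open>F'\<close> be the sheaves on the total space for the multiples \<open>1\<close> and \<open>n\<close>, and let \<open>N\<close> be the sheaf
  of homomorphisms from the \<open>n\<close>-th power of \<open>F\<close> to \<open>F'\<close>. On each fiber over \<open>t \<noteq> 0\<close> it is the trivial line
  bundle. The generators of the fibers lift to affine charts, and the obstruction to gluing the lifts lies in a
  space of countable dimension; as there are uncountably many fibers, a linear combination of the lifts
  glues to a global section of \<open>N\<close> that generates it on all but countably many fibers, hence
  at each point that lies over the generic point of the line. The points over \<open>0\<close> where \<open>N\<close> is invertible include the generic points of the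
  divisors of the toric variety. There the section is a power of the coordinate times a generator, with the same exponent
  everywhere, so it yields a rational function \<open>\<theta>\<close> on the toric variety with divisor
  \<open>n \<lfloor>E\<rfloor> - \<lfloor>n E\<rfloor>\<close>, where \<open>E\<close> is the divisor of the polytope. The inverse of \<open>\<theta>\<close> has no
  poles, so it is constant, and \<open>\<lfloor>n E\<rfloor> = n \<lfloor>E\<rfloor>\<close> for all \<open>n\<close>.
\<close>

subsection \<open>Subrings and prime ideals\<close>

text \<open>The gluing takes the place of direct images. Two lifts of the generator of the fiber
  over \<open>t\<close> differ by a multiple of \<open>p - t\<close>. Divided by
  \<open>p - t\<close>, the differences on all pairs of charts lie in countably spanned spaces, so
  they satisfy a linear relation for finitely many \<open>t\<close>. The same combination of the
  lifts divided by \<open>p - t\<close> agrees on all charts and has simple poles along these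
  fibers; the product of the \<open>p - t\<close> clears them, and on each of the fibers only the
  nonzero residue survives. The total space need not be normal, so the special fiber is examined
  only at points where both restrictions are principal, among them all discrete valuation rings. The
  sign comes from \<open>\<lfloor>n b\<rfloor> \<ge> n \<lfloor>b\<rfloor>\<close>. That a pole-free
  function on the torus is a Laurent polynomial is shown without factorization in several variables:
  inverting all Laurent polynomials that omit one variable leaves a principal ideal domain, and the
  resulting denominators are merged one variable at a time. The exponents are nonnegative on all
  rays, and boundedness of the polytope makes them zero.\<close>

lemma is_subringD:
  assumes "is_subring A"
  shows "1 \<in> A" "\<And>a b. a \<in> A \<Longrightarrow> b \<in> A \<Longrightarrow> a - b \<in> A" "\<And>a b. a \<in> A \<Longrightarrow> b \<in> A \<Longrightarrow> a * b \<in> A"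
    "0 \<in> A" "\<And>a. a \<in> A \<Longrightarrow> - a \<in> A" "\<And>a b. a \<in> A \<Longrightarrow> b \<in> A \<Longrightarrow> a + b \<in> A"
    "\<And>a n. a \<in> A \<Longrightarrow> a ^ n \<in> A"
proof -
  show o: "1 \<in> A" and m: "\<And>a b. a \<in> A \<Longrightarrow> b \<in> A \<Longrightarrow> a - b \<in> A"
    and t: "\<And>a b. a \<in> A \<Longrightarrow> b \<in> A \<Longrightarrow> a * b \<in> A"
    using assms by (auto simp: is_subring_def)
  show z: "0 \<in> A" using m[OF o o] by simp
  show u: "\<And>a. a \<in> A \<Longrightarrow> - a \<in> A" using m[OF z] by simp
  show "\<And>a b. a \<in> A \<Longrightarrow> b \<in> A \<Longrightarrow> a + b \<in> A"
    using m u by (metis diff_minus_eq_add)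
  show "\<And>a n. a \<in> A \<Longrightarrow> a ^ n \<in> A"
    subgoal for a n by (induction n) (auto simp: o t)
    done
qed

lemma is_subring_sum: "is_subring A \<Longrightarrow> (\<And>x. x \<in> F \<Longrightarrow> f x \<in> A) \<Longrightarrow> sum f F \<in> A"
  by (induction F rule: infinite_finite_induct) (auto simp: is_subringD)

lemma is_subring_prod: "is_subring A \<Longrightarrow> (\<And>x. x \<in> F \<Longrightarrow> f x \<in> A) \<Longrightarrow> prod f F \<in> A"
  by (induction F rule: infinite_finite_induct) (auto simp: is_subringD)

lemma is_idealD:
  assumes "is_ideal A I"
  shows "I \<subseteq> A" "0 \<in> I" "\<And>x y. x \<in> I \<Longrightarrow> y \<in> I \<Longrightarrow> x + y \<in> I" "\<And>a x. a \<in> A \<Longrightarrow> x \<in> I \<Longrightarrow> a * x \<in> I"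
  using assms by (auto simp: is_ideal_def)

lemma is_ideal_diff:
  assumes "is_subring A" "is_ideal A I" "x \<in> I" "y \<in> I"
  shows "x - y \<in> I"
proof -
  have "(- 1) * y \<in> I" using assms is_idealD(4) is_subringD(1,5) by metis
  then show ?thesis using is_idealD(3)[OF assms(2,3)] by force
qed

lemma is_ideal_sum: "is_ideal A I \<Longrightarrow> (\<And>x. x \<in> F \<Longrightarrow> f x \<in> I) \<Longrightarrow> sum f F \<in> I"
  by (induction F rule: infinite_finite_induct) (auto simp: is_idealD)

lemma is_prime_idealD:
  assumes "is_prime_ideal A I"
  shows "is_ideal A I" "1 \<notin> I" "I \<subseteq> A" "0 \<in> I"
    "\<And>a b. a \<in> A \<Longrightarrow> b \<in> A \<Longrightarrow> a * b \<in> I \<Longrightarrow> a \<in> I \<or> b \<in> I"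
  using assms by (auto simp: is_prime_ideal_def is_ideal_def)

lemma prime_ideal_prod:
  assumes "is_subring A" "is_prime_ideal A I" "finite F" "\<And>x. x \<in> F \<Longrightarrow> f x \<in> A" "prod f F \<in> I"
  shows "\<exists>x\<in>F. f x \<in> I"
  using assms(3,4,5)
proof (induction F rule: finite_induct)
  case empty
  then show ?case using is_prime_idealD(2)[OF assms(2)] by simp
next
  case (insert x F)
  have "f x * prod f F \<in> I" using insert by simp
  then show ?case
    using is_prime_idealD(5)[OF assms(2)] is_subring_prod[OF assms(1), of F f] insert by blast
qed

lemma prime_ideal_power:
  assumes "is_subring A" "is_prime_ideal A I" "x \<in> A" "x ^ n \<in> I"
  shows "x \<in> I"
  using prime_ideal_prod[OF assms(1,2), of "{..<n}" "\<lambda>_. x"] assms(3,4) by auto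

definition ideal_adjoin :: "'a::comm_ring_1 set \<Rightarrow> 'a set \<Rightarrow> 'a \<Rightarrow> 'a set" where
  "ideal_adjoin A I x = {i + a * x | i a. i \<in> I \<and> a \<in> A}"

lemma is_ideal_adjoin:
  assumes "is_subring A" "is_ideal A I" "x \<in> A"
  shows "is_ideal A (ideal_adjoin A I x)" "I \<subseteq> ideal_adjoin A I x" "x \<in> ideal_adjoin A I x"
proof -
  note A = is_subringD[OF assms(1)] and I = is_idealD[OF assms(2)]
  show "I \<subseteq> ideal_adjoin A I x"
  proof
    fix i assume "i \<in> I"
    then show "i \<in> ideal_adjoin A I x" unfolding ideal_adjoin_def using A(4) by (intro CollectI exI[of _ i] exI[of _ 0]) auto
  qed
  then have z: "0 \<in> ideal_adjoin A I x" using I by blast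
  show "x \<in> ideal_adjoin A I x"
    unfolding ideal_adjoin_def using A(1) I by (intro CollectI exI[of _ 0] exI[of _ 1]) auto
  have s: "ideal_adjoin A I x \<subseteq> A"
    unfolding ideal_adjoin_def using A I assms by auto
  have p: "y + z \<in> ideal_adjoin A I x" if yz: "y \<in> ideal_adjoin A I x" "z \<in> ideal_adjoin A I x" for y z
  proof -
    obtain i a j b where "y = i + a * x" "z = j + b * x" "i \<in> I" "j \<in> I" "a \<in> A" "b \<in> A"
      using yz unfolding ideal_adjoin_def by auto
    then show ?thesis unfolding ideal_adjoin_def using A I
      by (intro CollectI exI[of _ "i + j"] exI[of _ "a + b"]) (auto simp: algebra_simps)
  qed
  have t: "c * y \<in> ideal_adjoin A I x" if cy: "c \<in> A" "y \<in> ideal_adjoin A I x" for c y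
  proof -
    obtain i a where "y = i + a * x" "i \<in> I" "a \<in> A"
      using cy unfolding ideal_adjoin_def by auto
    then show ?thesis unfolding ideal_adjoin_def using A I cy
      by (intro CollectI exI[of _ "c * i"] exI[of _ "c * a"]) (auto simp: algebra_simps)
  qed
  show "is_ideal A (ideal_adjoin A I x)"
    unfolding is_ideal_def using s z p t by blast
qed

text \<open>Zorn's lemma gives an ideal that is maximal among those containing \<open>I\<close> and
  avoiding the multiplicative set \<open>S\<close>. It is prime: if \<open>a\<close> and
  \<open>b\<close> lie outside, both enlarged ideals meet \<open>S\<close>, and the product of the
  two common elements would lie in the ideal if \<open>a * b\<close> did.\<close>

lemma exists_prime_ideal:
  assumes A: "is_subring A" and I: "is_ideal A I"
    and S: "1 \<in> S" "\<And>x y. x \<in> S \<Longrightarrow> y \<in> S \<Longrightarrow> x * y \<in> S" and IS: "I \<inter> S = {}"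
  shows "\<exists>q. is_prime_ideal A q \<and> I \<subseteq> q \<and> q \<inter> S = {}"
proof -
  note Ad = is_subringD[OF A]
  define \<Z> where "\<Z> = {J. is_ideal A J \<and> I \<subseteq> J \<and> J \<inter> S = {}}"
  have "\<exists>q\<in>\<Z>. \<forall>X\<in>\<Z>. q \<subseteq> X \<longrightarrow> X = q"
  proof (rule subset_Zorn_nonempty)
    show "\<Z> \<noteq> {}" using I IS by (auto simp: \<Z>_def)
    fix C assume C: "C \<noteq> {}" "subset.chain \<Z> C"
    have sub: "\<And>J. J \<in> C \<Longrightarrow> J \<in> \<Z>" and lin: "\<And>J K. J \<in> C \<Longrightarrow> K \<in> C \<Longrightarrow> J \<subseteq> K \<or> K \<subseteq> J"
      using C(2) by (auto simp: subset_chain_def)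
    have "x + y \<in> \<Union>C" if xy: "x \<in> \<Union>C" "y \<in> \<Union>C" for x y
    proof -
      obtain J K where "x \<in> J" "y \<in> K" "J \<in> C" "K \<in> C" using xy by auto
      then obtain L where "x \<in> L" "y \<in> L" "L \<in> C" using lin[of J K] by blast
      then have "is_ideal A L" using sub[of L] by (simp add: \<Z>_def)
      then show ?thesis using is_idealD(3) \<open>x \<in> L\<close> \<open>y \<in> L\<close> \<open>L \<in> C\<close> by (metis UnionI)
    qed
    moreover have "a * x \<in> \<Union>C" if ax: "a \<in> A" "x \<in> \<Union>C" for a x
    proof -
      obtain J where "x \<in> J" "J \<in> C" using ax by blast
      then have "is_ideal A J" using sub[of J] by (simp add: \<Z>_def)
      then show ?thesis using is_idealD(4) \<open>x \<in> J\<close> \<open>J \<in> C\<close> ax(1) by (metis UnionI)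
    qed
    moreover have "0 \<in> \<Union>C" "\<Union>C \<subseteq> A"
      using sub C(1) unfolding \<Z>_def is_ideal_def by blast+
    ultimately have "is_ideal A (\<Union>C)"
      unfolding is_ideal_def by blast
    then show "\<Union>C \<in> \<Z>" using sub C(1) by (auto simp: \<Z>_def)
  qed
  then obtain q where qZ: "q \<in> \<Z>" "\<forall>X\<in>\<Z>. q \<subseteq> X \<longrightarrow> X = q" by (rule bexE)
  then have q: "is_ideal A q" "I \<subseteq> q" "q \<inter> S = {}" by (simp_all add: \<Z>_def)
  have mx: "X = q" if "is_ideal A X" "q \<subseteq> X" "X \<inter> S = {}" for X
  proof -
    have "X \<in> \<Z>" using that q(2) by (simp add: \<Z>_def)
    then show ?thesis using bspec[OF qZ(2), of X] that(2) by simp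
  qed
  note qd = is_idealD[OF q(1)]
  have ex: "\<exists>i a. i \<in> q \<and> a \<in> A \<and> i + a * x \<in> S" if x: "x \<in> A" "x \<notin> q" for x
  proof (rule ccontr)
    assume "\<not> ?thesis"
    then have "ideal_adjoin A q x \<inter> S = {}" unfolding ideal_adjoin_def by auto
    then show False using mx is_ideal_adjoin[OF A q(1) x(1)] x(2) by metis
  qed
  have "is_prime_ideal A q"
    unfolding is_prime_ideal_def
  proof (intro conjI ballI impI q(1))
    show "1 \<notin> q" using q(3) S(1) by auto
    fix a b assume ab: "a \<in> A" "b \<in> A" "a * b \<in> q"
    show "a \<in> q \<or> b \<in> q"
    proof (rule ccontr)
      assume "\<not> ?thesis"
      then obtain i c j d where *: "i \<in> q" "c \<in> A" "i + c * a \<in> S" "j \<in> q" "d \<in> A" "j + d * b \<in> S"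
        using ex[OF ab(1)] ex[OF ab(2)] by auto
      have "(i + c * a) * (j + d * b) = (j + d * b) * i + (c * a) * j + (c * d) * (a * b)"
        by (simp add: algebra_simps)
      also have "\<dots> \<in> q"
      proof (intro qd(3))
        show "(j + d * b) * i \<in> q" using * ab Ad(3)[of d b] Ad(6)[of j "d * b"] qd(1) qd(4)[of "j + d * b" i] by blast
        show "c * a * j \<in> q" using * ab Ad(3)[of c a] qd(4)[of "c * a" j] by blast
        show "c * d * (a * b) \<in> q" using * ab Ad(3)[of c d] qd(4)[of "c * d" "a * b"] by blast
      qed
      finally show False using S(2)[OF *(3,6)] q(3) by blast
    qed
  qed
  then show ?thesis using q by blast
qed

text \<open>In geometric terms: if no power of \<open>p\<close> lies in \<open>I\<close>, the zero
  set of \<open>I\<close> meets the open set where \<open>p\<close> is invertible.\<close>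

lemma exists_prime_ideal_avoiding_powers:
  assumes "is_subring A" "is_ideal A I" "\<And>k. p ^ k \<notin> I"
  shows "\<exists>q. is_prime_ideal A q \<and> I \<subseteq> q \<and> p \<notin> q"
proof -
  have one: "1 \<in> range (\<lambda>k. p ^ k)" by (rule range_eqI[of _ _ 0]) simp
  have mult: "x * y \<in> range (\<lambda>k. p ^ k)" if xy: "x \<in> range (\<lambda>k. p ^ k)" "y \<in> range (\<lambda>k. p ^ k)" for x y
  proof -
    obtain m n where "x = p ^ m" "y = p ^ n" using xy by blast
    then show ?thesis by (intro range_eqI[of _ _ "m + n"]) (simp add: power_add)
  qed
  have "I \<inter> range (\<lambda>k. p ^ k) = {}" using assms(3) by auto
  with exists_prime_ideal[OF assms(1,2) one] mult
  have "\<exists>q. is_prime_ideal A q \<and> I \<subseteq> q \<and> q \<inter> range (\<lambda>k. p ^ k) = {}" by simp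
  then obtain q where q: "is_prime_ideal A q" "I \<subseteq> q" "q \<inter> range (\<lambda>k. p ^ k) = {}" by (elim exE conjE)
  have "p \<in> range (\<lambda>k. p ^ k)" by (rule range_eqI[of _ _ 1]) simp
  then show ?thesis using q by (intro exI[of _ q]) auto
qed

lemma is_prime_ideal_contract:
  assumes "is_subring A" "A \<subseteq> R" "is_prime_ideal R Q"
  shows "is_prime_ideal A (Q \<inter> A)"
proof -
  note A = is_subringD[OF assms(1)] and Q = is_prime_idealD[OF assms(3)]
  note I = is_idealD[OF Q(1)]
  show ?thesis
    unfolding is_prime_ideal_def is_ideal_def
  proof (intro conjI ballI impI)
    fix a b assume "a \<in> A" "b \<in> A" "a * b \<in> Q \<inter> A"
    then show "a \<in> Q \<inter> A \<or> b \<in> Q \<inter> A" using Q(5)[of a b] assms(2) by blast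
  next
    fix a x assume "a \<in> A" "x \<in> Q \<inter> A"
    then show "a * x \<in> Q \<inter> A" using A(3)[of a x] I(4)[of a x] assms(2) by blast
  next
    fix x y assume "x \<in> Q \<inter> A" "y \<in> Q \<inter> A"
    then show "x + y \<in> Q \<inter> A" using A(6)[of x y] I(3)[of x y] by blast
  qed (use A(4) I(2) Q(2) in auto)
qed

subsection \<open>Localizations\<close>

lemma in_localizationI: "a \<in> A \<Longrightarrow> s \<in> A \<Longrightarrow> s \<notin> q \<Longrightarrow> a / s \<in> localization A q"
  unfolding localization_def by blast

lemma in_localizationE:
  assumes "x \<in> localization A q"
  obtains a s where "a \<in> A" "s \<in> A" "s \<notin> q" "x = a / s"
  using assms unfolding localization_def by blast

locale prime_localization =
  fixes A q :: "'k::field set"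
  assumes ring: "is_subring A" and prime: "is_prime_ideal A q"
begin

lemmas A = is_subringD[OF ring]
lemmas P = is_prime_idealD[OF prime]

lemma denominators: "1 \<in> A - q" "a \<in> A - q \<Longrightarrow> b \<in> A - q \<Longrightarrow> a * b \<in> A - q" "a \<in> A - q \<Longrightarrow> a \<noteq> 0"
  using A P(2) P(4) P(5)[of a b] by auto

lemma base_subset: "A \<subseteq> localization A q"
proof
  fix a assume "a \<in> A"
  then show "a \<in> localization A q" using in_localizationI[of a A 1 q] denominators(1) by simp
qed

lemma subring: "is_subring (localization A q)"
  unfolding is_subring_def
proof (intro conjI ballI)
  show "1 \<in> localization A q" using base_subset A by auto
  fix x y assume "x \<in> localization A q" "y \<in> localization A q"
  then obtain a s b t where x: "a \<in> A" "s \<in> A" "s \<notin> q" "x = a / s" and y: "b \<in> A" "t \<in> A" "t \<notin> q" "y = b / t"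
    by (metis in_localizationE)
  have st: "s * t \<in> A" "s * t \<notin> q" "s \<noteq> 0" "t \<noteq> 0" using denominators(2,3) x y by auto
  have "x - y = (a * t - b * s) / (s * t)" using x y st by (simp add: field_simps)
  also have "\<dots> \<in> localization A q" using x y st by (intro in_localizationI) (auto intro!: A)
  finally show "x - y \<in> localization A q" .
  have "x * y = (a * b) / (s * t)" using x y by simp
  also have "\<dots> \<in> localization A q" using x y st by (intro in_localizationI) (auto intro!: A)
  finally show "x * y \<in> localization A q" .
qed

lemma units: "ring_units (localization A q) = {a / s | a s. a \<in> A - q \<and> s \<in> A - q}"
proof
  show "ring_units (localization A q) \<subseteq> {a / s | a s. a \<in> A - q \<and> s \<in> A - q}"
  proof
    fix x assume "x \<in> ring_units (localization A q)"
    then obtain a s b t where x: "a \<in> A" "s \<in> A" "s \<notin> q" "x = a / s" and y: "b \<in> A" "t \<in> A" "t \<notin> q" "inverse x = b / t"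
      and "x \<noteq> 0" unfolding ring_units_def by (auto elim!: in_localizationE)
    have st: "s * t \<in> A" "s * t \<notin> q" "s \<noteq> 0" "t \<noteq> 0" using denominators(2,3) x y by auto
    have "a / s * (b / t) = 1" using x y \<open>x \<noteq> 0\<close> by (metis right_inverse)
    then have "b * a = s * t" using st by (simp add: field_simps)
    then have "a \<notin> q" using st P(1) y is_idealD(4) by metis
    then show "x \<in> {a / s | a s. a \<in> A - q \<and> s \<in> A - q}" using x by blast
  qed
  show "{a / s | a s. a \<in> A - q \<and> s \<in> A - q} \<subseteq> ring_units (localization A q)"
    unfolding ring_units_def using denominators(3) in_localizationI
    by (fastforce simp: inverse_eq_divide)
qed

lemma max_ideal_eq: "max_ideal (localization A q) = {a / s | a s. a \<in> q \<and> s \<in> A - q}"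
proof
  show "max_ideal (localization A q) \<subseteq> {a / s | a s. a \<in> q \<and> s \<in> A - q}"
    unfolding max_ideal_def units by (fastforce elim!: in_localizationE)
  show "{a / s | a s. a \<in> q \<and> s \<in> A - q} \<subseteq> max_ideal (localization A q)"
  proof clarify
    fix a s assume as: "a \<in> q" "s \<in> A" "s \<notin> q"
    have "a / s \<noteq> b / t" if bt: "b \<in> A" "b \<notin> q" "t \<in> A" "t \<notin> q" for b t
    proof
      assume "a / s = b / t"
      then have "t * a = b * s" using denominators(3) as bt by (auto simp: field_simps)
      moreover have "t * a \<in> q" using is_idealD(4)[OF P(1)] as bt by auto
      ultimately show False using P(5)[OF bt(1) as(2)] bt as by auto
    qed
    then have "a / s \<notin> ring_units (localization A q)" unfolding units by blast
    moreover have "a / s \<in> localization A q" using as P by (intro in_localizationI) auto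
    ultimately show "a / s \<in> max_ideal (localization A q)" unfolding max_ideal_def by blast
  qed
qed

lemma max_ideal_Int: "max_ideal (localization A q) \<inter> A = q"
proof
  show "max_ideal (localization A q) \<inter> A \<subseteq> q"
  proof
    fix x assume x: "x \<in> max_ideal (localization A q) \<inter> A"
    then obtain a s where as: "x = a / s" "a \<in> q" "s \<in> A - q" unfolding max_ideal_eq by blast
    then have "x * s = a" using denominators(3)[OF as(3)] by simp
    then show "x \<in> q" using P(5)[of x s] x as by auto
  qed
  show "q \<subseteq> max_ideal (localization A q) \<inter> A"
  proof
    fix x assume "x \<in> q"
    then have "x = x / 1 \<and> x \<in> q \<and> 1 \<in> A - q" using denominators(1) by simp
    then show "x \<in> max_ideal (localization A q) \<inter> A"
      unfolding max_ideal_eq using P(3) \<open>x \<in> q\<close> by blast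
  qed
qed

lemma local: "local_subring (localization A q)"
  unfolding local_subring_def
proof
  show "is_subring (localization A q)" by (rule subring)
  note R = is_subringD[OF this]
  show "is_ideal (localization A q) (max_ideal (localization A q))"
    unfolding is_ideal_def
  proof (intro conjI ballI)
    show "max_ideal (localization A q) \<subseteq> localization A q" by (auto simp: max_ideal_def)
    show "0 \<in> max_ideal (localization A q)" using R by (auto simp: max_ideal_def ring_units_def)
    fix x assume "x \<in> max_ideal (localization A q)"
    then obtain a s where as: "x = a / s" "a \<in> q" "s \<in> A - q" unfolding max_ideal_eq by blast
    { fix y assume "y \<in> max_ideal (localization A q)"
      then obtain b t where bt: "y = b / t" "b \<in> q" "t \<in> A - q" unfolding max_ideal_eq by blast
      have "x + y = (t * a + s * b) / (s * t)" using as bt denominators(3) by (auto simp: field_simps)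
      moreover have "t * a + s * b \<in> q" using as bt is_idealD(3,4)[OF P(1)] by auto
      ultimately show "x + y \<in> max_ideal (localization A q)"
        unfolding max_ideal_eq using denominators(2) as bt by blast }
    { fix y assume "y \<in> localization A q"
      then obtain b t where bt: "y = b / t" "b \<in> A" "t \<in> A" "t \<notin> q" by (metis in_localizationE)
      have "y * x = (b * a) / (t * s)" using as bt by simp
      moreover have "b * a \<in> q" using as bt is_idealD(4)[OF P(1)] by auto
      ultimately show "y * x \<in> max_ideal (localization A q)"
        unfolding max_ideal_eq using denominators(2)[of t s] as bt by blast }
  qed
qed

end

lemma spec_pointsE:
  assumes "is_subring A" "R \<in> spec_points A"
  obtains q where "prime_localization A q" "R = localization A q"
  using assms unfolding spec_points_def prime_localization_def by blast

lemma spec_points_properties: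
  assumes "is_subring A" "R \<in> spec_points A"
  shows "local_subring R" "A \<subseteq> R" "is_prime_ideal A (max_ideal R \<inter> A)" "R = localization A (max_ideal R \<inter> A)"
proof -
  obtain q where q: "prime_localization A q" "R = localization A q" using assms spec_pointsE by metis
  interpret prime_localization A q by fact
  show "local_subring R" "A \<subseteq> R" "is_prime_ideal A (max_ideal R \<inter> A)" "R = localization A (max_ideal R \<inter> A)"
    using local base_subset prime max_ideal_Int q(2) by auto
qed

lemma local_subringD:
  assumes "local_subring R"
  shows "is_subring R" "is_ideal R (max_ideal R)" "is_prime_ideal R (max_ideal R)"
proof -
  show *: "is_subring R" "is_ideal R (max_ideal R)" using assms by (auto simp: local_subring_def)
  note R = is_subringD[OF *(1)]
  show "is_prime_ideal R (max_ideal R)"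
    unfolding is_prime_ideal_def
  proof (intro conjI ballI impI *)
    show "1 \<notin> max_ideal R" using R by (auto simp: max_ideal_def ring_units_def)
    fix a b assume "a \<in> R" "b \<in> R" "a * b \<in> max_ideal R"
    then show "a \<in> max_ideal R \<or> b \<in> max_ideal R"
      using R by (auto simp: max_ideal_def ring_units_def)
  qed
qed

lemma ring_units_iff: "is_subring R \<Longrightarrow> u \<in> ring_units R \<longleftrightarrow> u \<noteq> 0 \<and> u \<in> R \<and> inverse u \<in> R"
  by (auto simp: ring_units_def)

lemma ring_units_mult: "is_subring R \<Longrightarrow> u \<in> ring_units R \<Longrightarrow> v \<in> ring_units R \<Longrightarrow> u * v \<in> ring_units R"
  by (auto simp: ring_units_def is_subringD)

lemma ring_units_inverse: "u \<in> ring_units R \<Longrightarrow> inverse u \<in> ring_units R"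
  by (auto simp: ring_units_def)

lemma ring_units_divide: "is_subring R \<Longrightarrow> u \<in> ring_units R \<Longrightarrow> v \<in> ring_units R \<Longrightarrow> u / v \<in> ring_units R"
  by (simp add: divide_inverse ring_units_mult ring_units_inverse)

lemma ring_units_power: "is_subring R \<Longrightarrow> u \<in> ring_units R \<Longrightarrow> u ^ n \<in> ring_units R"
  by (auto simp: ring_units_def is_subringD simp flip: power_inverse)

lemma ring_units_mono: "R \<subseteq> S \<Longrightarrow> ring_units R \<subseteq> ring_units S"
  by (auto simp: ring_units_def)

text \<open>Elements of \<open>A\<close> that are units of \<open>R\<close> cannot lie in the prime
  \<open>Q\<close>, so fractions over \<open>R\<close> can be rewritten as fractions over
  \<open>A\<close>. Hence generizations of a point are points of the same chart.\<close>

lemma localization_localization: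
  assumes "is_subring A" "R \<in> spec_points A" "is_prime_ideal R Q"
  shows "is_prime_ideal A (Q \<inter> A)" "localization R Q = localization A (Q \<inter> A)"
proof -
  obtain q where q: "prime_localization A q" "R = localization A q" using assms spec_pointsE by metis
  interpret prime_localization A q by fact
  note Q = is_prime_idealD[OF assms(3)]
  have AR: "A \<subseteq> R" using base_subset q by simp
  have Rr: "is_subring R" using subring q by simp
  show pr: "is_prime_ideal A (Q \<inter> A)"
    using is_prime_ideal_contract[OF assms(1) AR assms(3)] .
  interpret Q: prime_localization R Q using Rr assms(3) by unfold_locales
  have sq: "s \<notin> Q" if "s \<in> A" "s \<notin> q" for s
  proof
    assume "s \<in> Q"
    have "1 / s \<in> R" using in_localizationI[of 1 A s q] that A(1) q by simp
    then have "1 / s * s \<in> Q" using is_idealD(4)[OF Q(1)] \<open>s \<in> Q\<close> by blast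
    moreover have "s \<noteq> 0" using that denominators(3) by blast
    ultimately show False using Q(2) by simp
  qed
  show "localization R Q = localization A (Q \<inter> A)"
  proof
    show "localization A (Q \<inter> A) \<subseteq> localization R Q"
    proof
      fix x assume "x \<in> localization A (Q \<inter> A)"
      then obtain a s where "a \<in> A" "s \<in> A" "s \<notin> Q \<inter> A" "x = a / s" by (metis in_localizationE)
      then show "x \<in> localization R Q" using AR in_localizationI[of a R s Q] by auto
    qed
    show "localization R Q \<subseteq> localization A (Q \<inter> A)"
    proof
      fix x assume "x \<in> localization R Q"
      then obtain a s where x: "a \<in> R" "s \<in> R" "s \<notin> Q" "x = a / s" by (metis in_localizationE)
      then obtain b t c u where a: "b \<in> A" "t \<in> A" "t \<notin> q" "a = b / t" and s: "c \<in> A" "u \<in> A" "u \<notin> q" "s = c / u"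
        unfolding q by (metis in_localizationE)
      have nz: "t \<noteq> 0" "u \<noteq> 0" using a s denominators(3) by auto
      have "1 / u \<in> R" using in_localizationI[of 1 A u q] A(1) q s by simp
      then have "c \<notin> Q" using is_idealD(4)[OF Q(1), of "1 / u" c] x(3) s by auto
      then have "c * t \<notin> Q" using Q(5)[of c t] sq a s AR by blast
      moreover have "x = (b * u) / (c * t)" using x a s by simp
      ultimately show "x \<in> localization A (Q \<inter> A)"
        using a s A(3) by (auto intro!: in_localizationI)
    qed
  qed
qed

lemma spec_points_localization:
  "is_subring A \<Longrightarrow> R \<in> spec_points A \<Longrightarrow> is_prime_ideal R Q \<Longrightarrow> localization R Q \<in> spec_points A"
  using localization_localization unfolding spec_points_def by blast

text \<open>Adjoining functions that are regular at a point does not change its local ring, since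
  the denominators from \<open>A\<close> are still available and those from \<open>B\<close> are
  units of \<open>R\<close>.\<close>

lemma spec_points_intermediate:
  assumes "is_subring A" "R \<in> spec_points A" "is_subring B" "A \<subseteq> B" "B \<subseteq> R"
  shows "R \<in> spec_points B"
proof -
  obtain q where q: "prime_localization A q" "R = localization A q" using assms spec_pointsE by metis
  interpret prime_localization A q by fact
  have loc: "local_subring R" using local q by simp
  note Rl = local_subringD[OF loc] is_prime_idealD[OF local_subringD(3)[OF loc]]
  have pr: "is_prime_ideal B (max_ideal R \<inter> B)"
    using is_prime_ideal_contract[OF assms(3,5)] local_subringD(3)[OF loc] by blast
  have "R = localization B (max_ideal R \<inter> B)"
  proof
    show "R \<subseteq> localization B (max_ideal R \<inter> B)"
    proof
      fix x assume "x \<in> R"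
      then obtain a s where x: "a \<in> A" "s \<in> A" "s \<notin> q" "x = a / s" unfolding q by (metis in_localizationE)
      then have "s \<notin> max_ideal R" using max_ideal_Int q by auto
      then show "x \<in> localization B (max_ideal R \<inter> B)" using x assms(4) by (auto intro!: in_localizationI)
    qed
    show "localization B (max_ideal R \<inter> B) \<subseteq> R"
    proof
      fix x assume "x \<in> localization B (max_ideal R \<inter> B)"
      then obtain a s where x: "a \<in> B" "s \<in> B" "s \<notin> max_ideal R \<inter> B" "x = a / s" by (metis in_localizationE)
      then have "inverse s \<in> R" using assms(5) by (auto simp: max_ideal_def ring_units_def)
      then show "x \<in> R" using x assms(5) is_subringD(3)[OF Rl(1)] by (auto simp: divide_inverse)
    qed
  qed
  then show ?thesis unfolding spec_points_def using pr by blast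
qed

text \<open>The assumption \<open>frac\<close> says that \<open>B\<close> arises from
  \<open>A\<close> by inverting elements. These are units of \<open>B\<close> and avoid the
  contracted prime, so the spectrum of \<open>B\<close> is part of the spectrum of
  \<open>A\<close>.\<close>

lemma spec_points_mono_inverse:
  assumes "is_subring A" "is_subring B" "A \<subseteq> B" "R \<in> spec_points B"
    and frac: "\<And>b. b \<in> B \<Longrightarrow> \<exists>s\<in>A. inverse s \<in> B \<and> s \<noteq> 0 \<and> s * b \<in> A"
  shows "R \<in> spec_points A"
proof -
  obtain q where q: "prime_localization B q" "R = localization B q" using assms spec_pointsE by metis
  interpret prime_localization B q by fact
  have pr: "is_prime_ideal A (q \<inter> A)"
    using is_prime_ideal_contract[OF assms(1,3) prime] .
  have un: "s \<notin> q" if "s \<in> A" "inverse s \<in> B" "s \<noteq> 0" for s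
    using is_idealD(4)[OF P(1), of "inverse s" s] that P(2) by auto
  have "R = localization A (q \<inter> A)"
  proof
    show "localization A (q \<inter> A) \<subseteq> R"
      unfolding q localization_def using assms(3) by blast
    show "R \<subseteq> localization A (q \<inter> A)"
    proof
      fix x assume "x \<in> R"
      then obtain a s where x: "a \<in> B" "s \<in> B" "s \<notin> q" "x = a / s" unfolding q by (metis in_localizationE)
      obtain c where c: "c \<in> A" "inverse c \<in> B" "c \<noteq> 0" "c * a \<in> A" using frac x by blast
      obtain d where d: "d \<in> A" "inverse d \<in> B" "d \<noteq> 0" "d * s \<in> A" using frac x by blast
      have "x = (d * (c * a)) / (c * (d * s))" using x c d by simp
      moreover have "d * s \<notin> q" using un[of d] P(5)[of d s] c d x assms(3) by blast
      then have "c * (d * s) \<notin> q" using un[of c] P(5)[of c "d * s"] c d assms(3) by blast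
      moreover have "d * (c * a) \<in> A" "c * (d * s) \<in> A" using c d is_subringD(3)[OF assms(1)] by blast+
      ultimately show "x \<in> localization A (q \<inter> A)"
        using in_localizationI[of "d * (c * a)" A "c * (d * s)" "q \<inter> A"] by simp
    qed
  qed
  then show ?thesis unfolding spec_points_def using pr by blast
qed

lemma is_ideal_denominators:
  "is_subring A \<Longrightarrow> is_ideal A {s \<in> A. s * x \<in> A}"
  unfolding is_ideal_def by (auto simp: is_subringD distrib_right mult.assoc)

text \<open>If no power of \<open>p\<close> were a denominator of \<open>x\<close>, the ideal of
  denominators would lie in a prime avoiding \<open>p\<close>; but membership of \<open>x\<close> in
  that localization provides a denominator outside the prime.\<close>

lemma in_all_localizations:
  assumes "is_subring A" "\<And>q. is_prime_ideal A q \<Longrightarrow> p \<notin> q \<Longrightarrow> x \<in> localization A q" "p \<in> A"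
  shows "\<exists>k. p ^ k * x \<in> A"
proof (rule ccontr)
  assume *: "\<not> ?thesis"
  define I where "I = {s \<in> A. s * x \<in> A}"
  have "p ^ k \<notin> I" for k using * by (auto simp: I_def)
  from exists_prime_ideal_avoiding_powers[OF assms(1) is_ideal_denominators[OF assms(1), of x, folded I_def] this]
  obtain q where q: "is_prime_ideal A q" "I \<subseteq> q" "p \<notin> q" by (elim exE conjE)
  then have "x \<in> localization A q" using assms(2) by simp
  then obtain a s where as: "a \<in> A" "s \<in> A" "s \<notin> q" "x = a / s" by (metis in_localizationE)
  then have "s \<noteq> 0" using is_prime_idealD(4)[OF q(1)] by blast
  then have "s \<in> I" using as by (auto simp: I_def)
  then show False using q as by blast
qed

lemma in_base_if_in_all_localizations:
  assumes "is_subring A" "\<And>q. is_prime_ideal A q \<Longrightarrow> x \<in> localization A q"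
  shows "x \<in> A"
  using in_all_localizations[OF assms(1), of 1 x] assms is_subringD(1) by fastforce

subsection \<open>Finitely generated algebras and linear dependence over the scalars\<close>

text \<open>Gaussian elimination by induction on the equations: equation \<open>h\<close> is solved
  for an unknown \<open>s\<close> with nonzero coefficient, and \<open>s\<close> is eliminated from
  the remaining equations.\<close>

lemma homogeneous_system_nontrivial:
  fixes c :: "'t \<Rightarrow> 'h \<Rightarrow> complex"
  assumes "finite H" "finite F" "card H < card F"
  shows "\<exists>l. (\<exists>t\<in>F. l t \<noteq> 0) \<and> (\<forall>h\<in>H. (\<Sum>t\<in>F. l t * c t h) = 0)"
  using assms
proof (induction H arbitrary: F c rule: finite_induct)
  case empty
  then have "F \<noteq> {}" by auto
  then show ?case by (intro exI[of _ "\<lambda>_. 1"]) auto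
next
  case (insert h H)
  show ?case
  proof (cases "\<forall>t\<in>F. c t h = 0")
    case True
    have "card H < card F" using insert by simp
    from insert.IH[OF insert.prems(1) this, of c]
    obtain l where "\<exists>t\<in>F. l t \<noteq> 0" "\<forall>h\<in>H. (\<Sum>t\<in>F. l t * c t h) = 0" by blast
    then show ?thesis using True by (intro exI[of _ l]) auto
  next
    case False
    then obtain s where s: "s \<in> F" "c s h \<noteq> 0" by blast
    define c' where "c' t k = c t k - c t h / c s h * c s k" for t k
    have "card H < card (F - {s})" using insert s by auto
    from insert.IH[OF finite_Diff[OF insert.prems(1)] this, of c']
    obtain l where l: "\<exists>t\<in>F-{s}. l t \<noteq> 0" "\<forall>k\<in>H. (\<Sum>t\<in>F-{s}. l t * c' t k) = 0" by blast
    \<comment> \<open>The value at \<open>s\<close> is the one that equation \<open>h\<close>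
      forces.\<close>
    define m where "m t = (if t = s then - (\<Sum>t\<in>F-{s}. l t * c t h) / c s h else l t)" for t
    have split: "(\<Sum>t\<in>F. m t * c t k) = m s * c s k + (\<Sum>t\<in>F-{s}. l t * c t k)" for k
    proof -
      have "(\<Sum>t\<in>F. m t * c t k) = m s * c s k + (\<Sum>t\<in>F-{s}. m t * c t k)"
        using insert.prems(1) s(1) by (rule sum.remove)
      also have "(\<Sum>t\<in>F-{s}. m t * c t k) = (\<Sum>t\<in>F-{s}. l t * c t k)"
        by (intro sum.cong) (auto simp: m_def)
      finally show ?thesis .
    qed
    have "(\<Sum>t\<in>F. m t * c t k) = 0" if k: "k \<in> insert h H" for k
    proof (cases "k = h")
      case True
      then show ?thesis unfolding split using s by (simp add: m_def)
    next
      case False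
      then have "0 = (\<Sum>t\<in>F-{s}. l t * c' t k)" using l(2) k by simp
      also have "\<dots> = (\<Sum>t\<in>F-{s}. l t * c t k) - (\<Sum>t\<in>F-{s}. l t * c t h * (c s k / c s h))"
        unfolding sum_subtractf[symmetric] by (intro sum.cong) (auto simp: c'_def algebra_simps)
      also have "(\<Sum>t\<in>F-{s}. l t * c t h * (c s k / c s h)) = - m s * c s k"
        unfolding sum_distrib_right[symmetric] using s by (simp add: m_def)
      finally show ?thesis unfolding split by (simp add: add.commute)
    qed
    moreover have "\<exists>t\<in>F. m t \<noteq> 0" using l(1) by (auto simp: m_def)
    ultimately show ?thesis by blast
  qed
qed

locale scalars =
  fixes sc :: "complex \<Rightarrow> 'k::field"
  assumes sc_1: "sc 1 = 1" and sc_add: "sc (a + b) = sc a + sc b" and sc_mult: "sc (a * b) = sc a * sc b"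
begin

lemma sc_0: "sc 0 = 0" by (metis add.right_neutral add_left_cancel sc_add)

lemma sc_minus: "sc (- a) = - sc a" using sc_add[of a "- a"] sc_0 by (simp add: eq_neg_iff_add_eq_0 add.commute)

lemma sc_diff: "sc (a - b) = sc a - sc b" using sc_add[of a "- b"] sc_minus by simp

lemma sc_eq_0_iff: "sc a = 0 \<longleftrightarrow> a = 0"
proof
  assume "sc a = 0"
  then show "a = 0" using sc_mult[of a "inverse a"] sc_1 by (cases "a = 0") auto
qed (simp add: sc_0)

lemma sc_inverse: "sc (inverse a) = inverse (sc a)"
proof (cases "a = 0")
  case False
  then have "sc a * sc (inverse a) = 1" by (simp flip: sc_mult add: sc_1)
  then show ?thesis by (metis inverse_unique)
qed (simp add: sc_0)

lemma sc_sum: "sc (sum f F) = (\<Sum>x\<in>F. sc (f x))"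
  by (induction F rule: infinite_finite_induct) (auto simp: sc_0 sc_add)

lemma subalgebra_is_subring: "subalgebra sc A \<Longrightarrow> is_subring A"
proof -
  assume A: "subalgebra sc A"
  have "a - b \<in> A" if "a \<in> A" "b \<in> A" for a b
  proof -
    have "sc (- 1) * b \<in> A" using A that unfolding subalgebra_def by blast
    then have "a + sc (- 1) * b \<in> A" using A that unfolding subalgebra_def by blast
    then show ?thesis by (simp add: sc_minus sc_1)
  qed
  then show ?thesis using A unfolding is_subring_def subalgebra_def by (metis range_subsetD sc_1)
qed

lemma subalgebra_generated: "subalgebra sc (generated_algebra sc G)"
  unfolding generated_algebra_def hull_def subalgebra_def by auto

lemma is_subring_generated: "is_subring (generated_algebra sc G)"
  using subalgebra_generated subalgebra_is_subring by blast

lemma scalar_in_generated: "sc c \<in> generated_algebra sc G"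
  using subalgebra_generated[of G] unfolding subalgebra_def by blast

lemma generators_subset: "G \<subseteq> generated_algebra sc G"
  unfolding generated_algebra_def by (rule hull_subset)

lemma generated_subset: "subalgebra sc A \<Longrightarrow> G \<subseteq> A \<Longrightarrow> generated_algebra sc G \<subseteq> A"
  unfolding generated_algebra_def by (rule hull_minimal)

lemma generated_mono: "G \<subseteq> H \<Longrightarrow> generated_algebra sc G \<subseteq> generated_algebra sc H"
  by (rule generated_subset[OF subalgebra_generated]) (use generators_subset in blast)

lemma generated_induct [consumes 1, case_names generator scalar add mult]:
  assumes "x \<in> generated_algebra sc G"
    and "\<And>x. x \<in> G \<Longrightarrow> P x" "\<And>c. P (sc c)"
    and "\<And>x y. x \<in> generated_algebra sc G \<Longrightarrow> y \<in> generated_algebra sc G \<Longrightarrow> P x \<Longrightarrow> P y \<Longrightarrow> P (x + y)"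
    and "\<And>x y. x \<in> generated_algebra sc G \<Longrightarrow> y \<in> generated_algebra sc G \<Longrightarrow> P x \<Longrightarrow> P y \<Longrightarrow> P (x * y)"
  shows "P x"
proof -
  note A = is_subringD[OF is_subring_generated[of G]]
  have "subalgebra sc {x \<in> generated_algebra sc G. P x}"
    unfolding subalgebra_def using assms(3-5) A scalar_in_generated by auto
  then have "generated_algebra sc G \<subseteq> {x \<in> generated_algebra sc G. P x}"
    by (rule generated_subset) (use assms(2) generators_subset in auto)
  then show ?thesis using assms(1) by blast
qed

text \<open>The complex numbers act through \<open>sc\<close>, which depends on the model, so the
  vector space structure cannot come from a type class.\<close>

definition lin_span :: "'k set \<Rightarrow> 'k set" where
  "lin_span Z = {\<Sum>z\<in>H. sc (c z) * z | H c. finite H \<and> H \<subseteq> Z}"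

lemma lin_spanI: "finite H \<Longrightarrow> H \<subseteq> Z \<Longrightarrow> (\<Sum>z\<in>H. sc (c z) * z) \<in> lin_span Z"
  unfolding lin_span_def by blast

lemma lin_span_single: "z \<in> Z \<Longrightarrow> sc c * z \<in> lin_span Z"
  using lin_spanI[of "{z}" Z "\<lambda>_. c"] by simp

lemma lin_span_base: "z \<in> Z \<Longrightarrow> z \<in> lin_span Z"
  using lin_span_single[of z Z 1] by (simp add: sc_1)

lemma lin_span_zero: "0 \<in> lin_span Z"
  using lin_spanI[of "{}" Z] by simp

lemma lin_span_add:
  assumes "x \<in> lin_span Z" "y \<in> lin_span Z"
  shows "x + y \<in> lin_span Z"
proof -
  obtain H c K d where x: "x = (\<Sum>z\<in>H. sc (c z) * z)" "finite H" "H \<subseteq> Z"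
    and y: "y = (\<Sum>z\<in>K. sc (d z) * z)" "finite K" "K \<subseteq> Z"
    using assms unfolding lin_span_def by auto
  define e where "e z = (if z \<in> H then c z else 0) + (if z \<in> K then d z else 0)" for z
  have "(\<Sum>z\<in>H \<union> K. sc (e z) * z)
    = (\<Sum>z\<in>H \<union> K. if z \<in> H then sc (c z) * z else 0) + (\<Sum>z\<in>H \<union> K. if z \<in> K then sc (d z) * z else 0)"
    unfolding sum.distrib[symmetric] by (intro sum.cong) (auto simp: e_def sc_add sc_0 distrib_right)
  also have "(\<Sum>z\<in>H \<union> K. if z \<in> H then sc (c z) * z else 0) = x"
    unfolding x(1) using x(2) y(2) by (intro sum.mono_neutral_cong_right) auto
  also have "(\<Sum>z\<in>H \<union> K. if z \<in> K then sc (d z) * z else 0) = y"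
    unfolding y(1) using x(2) y(2) by (intro sum.mono_neutral_cong_right) auto
  finally show ?thesis using lin_spanI[of "H \<union> K" Z e] x y by simp
qed

lemma lin_span_scale: "x \<in> lin_span Z \<Longrightarrow> sc a * x \<in> lin_span Z"
proof -
  assume "x \<in> lin_span Z"
  then obtain H c where x: "x = (\<Sum>z\<in>H. sc (c z) * z)" "finite H" "H \<subseteq> Z" unfolding lin_span_def by auto
  have "sc a * x = (\<Sum>z\<in>H. sc (a * c z) * z)"
    unfolding x(1) sum_distrib_left by (simp add: sc_mult mult.assoc)
  then show ?thesis using lin_spanI[OF x(2,3)] by simp
qed

lemma lin_span_sum: "(\<And>x. x \<in> F \<Longrightarrow> f x \<in> lin_span Z) \<Longrightarrow> sum f F \<in> lin_span Z"
  by (induction F rule: infinite_finite_induct) (auto simp: lin_span_zero lin_span_add)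

lemma lin_span_mult:
  assumes "x \<in> lin_span Z" "y \<in> lin_span W" "\<And>z w. z \<in> Z \<Longrightarrow> w \<in> W \<Longrightarrow> z * w \<in> lin_span V"
  shows "x * y \<in> lin_span V"
proof -
  obtain H c where x: "x = (\<Sum>z\<in>H. sc (c z) * z)" "finite H" "H \<subseteq> Z" using assms(1) unfolding lin_span_def by auto
  obtain K d where y: "y = (\<Sum>z\<in>K. sc (d z) * z)" "finite K" "K \<subseteq> W" using assms(2) unfolding lin_span_def by auto
  have "x * y = (\<Sum>z\<in>H. \<Sum>w\<in>K. sc (c z * d w) * (z * w))"
    unfolding x y sum_product by (simp add: sc_mult mult_ac)
  also have "\<dots> \<in> lin_span V"
    using x y assms(3) by (intro lin_span_sum lin_span_scale) auto
  finally show ?thesis .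
qed

lemma generated_subset_lin_span: "generated_algebra sc G \<subseteq> lin_span (prod_list ` lists G)"
proof (rule generated_subset)
  let ?Z = "prod_list ` lists G"
  have one: "1 \<in> ?Z" by (rule image_eqI[of _ _ "[]"]) auto
  have mult: "z * w \<in> ?Z" if "z \<in> ?Z" "w \<in> ?Z" for z w
  proof -
    from that(1) obtain u where "z = prod_list u" "u \<in> lists G" by auto
    moreover from that(2) obtain v where "w = prod_list v" "v \<in> lists G" by auto
    ultimately show ?thesis by (intro image_eqI[of _ _ "u @ v"]) auto
  qed
  show "G \<subseteq> lin_span ?Z"
  proof
    fix g assume "g \<in> G"
    then have "g \<in> ?Z" by (intro image_eqI[of _ _ "[g]"]) auto
    then show "g \<in> lin_span ?Z" by (rule lin_span_base)
  qed
  have "sc c \<in> lin_span ?Z" for c using lin_span_single[OF one, of c] by simp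
  moreover have "x * y \<in> lin_span ?Z" if "x \<in> lin_span ?Z" "y \<in> lin_span ?Z" for x y
    using that by (rule lin_span_mult) (rule lin_span_base, rule mult)
  ultimately show "subalgebra sc (lin_span ?Z)"
    unfolding subalgebra_def by (auto intro: lin_span_add)
qed

definition countably_spanned :: "'k set \<Rightarrow> bool" where
  "countably_spanned V \<longleftrightarrow> (\<exists>Z. countable Z \<and> V \<subseteq> lin_span Z)"

lemma countably_spanned_generated: "finite G \<Longrightarrow> countably_spanned (generated_algebra sc G)"
  unfolding countably_spanned_def using generated_subset_lin_span[of G]
  by (intro exI[of _ "prod_list ` lists G"]) (auto simp: countable_finite)

lemma countably_spanned_times:
  assumes "countably_spanned V"
  shows "countably_spanned ((*) h ` V)"
proof -
  obtain Z where Z: "countable Z" "V \<subseteq> lin_span Z" using assms unfolding countably_spanned_def by blast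
  have "h * v \<in> lin_span ((*) h ` Z)" if "v \<in> V" for v
  proof -
    have "h \<in> lin_span {h}" by (simp add: lin_span_base)
    moreover have "v \<in> lin_span Z" using Z that by blast
    ultimately show ?thesis by (rule lin_span_mult) (auto intro: lin_span_base)
  qed
  then show ?thesis unfolding countably_spanned_def using Z(1) by (intro exI[of _ "(*) h ` Z"]) auto
qed

text \<open>The substitute for cohomological finiteness: a pigeonhole on the finite supports of the
  expansions yields infinitely many \<open>t\<close> whose vectors, for all \<open>j\<close> at
  once, lie in one fixed finite-dimensional space. The coefficients \<open>l\<close> serve all
  conditions \<open>j\<close> simultaneously.\<close>

lemma uncountable_dependence:
  assumes T: "uncountable T" and J: "finite J" and V: "\<And>j. j \<in> J \<Longrightarrow> countably_spanned (V j)"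
    and f: "\<And>t j. t \<in> T \<Longrightarrow> j \<in> J \<Longrightarrow> f j t \<in> V j"
  shows "\<exists>F l. finite F \<and> F \<noteq> {} \<and> F \<subseteq> T \<and> (\<forall>t\<in>F. l t \<noteq> 0) \<and> (\<forall>j\<in>J. (\<Sum>t\<in>F. sc (l t) * f j t) = 0)"
proof -
  have "\<forall>j\<in>J. \<exists>Z. countable Z \<and> V j \<subseteq> lin_span Z"
    using V unfolding countably_spanned_def by blast
  then obtain Z where Z: "\<And>j. j \<in> J \<Longrightarrow> countable (Z j)" "\<And>j. j \<in> J \<Longrightarrow> V j \<subseteq> lin_span (Z j)"
    by metis
  define Q where "Q t j r \<longleftrightarrow> finite (fst r) \<and> fst r \<subseteq> Z j \<and> f j t = (\<Sum>z\<in>fst r. sc (snd r z) * z)" for t j r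
  define r where "r t j = (SOME r. Q t j r)" for t j
  have r: "Q t j (r t j)" if "t \<in> T" "j \<in> J" for t j
  proof -
    have "f j t \<in> lin_span (Z j)" using f[OF that] Z(2)[OF that(2)] by blast
    then obtain H c where "finite H" "H \<subseteq> Z j" "f j t = (\<Sum>z\<in>H. sc (c z) * z)" unfolding lin_span_def by blast
    then have "Q t j (H, c)" by (simp add: Q_def)
    then show ?thesis unfolding r_def by (rule someI)
  qed
  define H where "H t j = fst (r t j)" for t j
  define c where "c t j = snd (r t j)" for t j
  have H: "finite (H t j)" "H t j \<subseteq> Z j" "f j t = (\<Sum>z\<in>H t j. sc (c t j z) * z)" if "t \<in> T" "j \<in> J" for t j
    using r[OF that] by (auto simp: Q_def H_def c_def)
  \<comment> \<open>The supports of the expansions of all \<open>f j t\<close> for one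
    \<open>t\<close> form a single finite set. Only countably many such sets exist, so infinitely
    many \<open>t\<close> share one of them.\<close>
  define E where "E t = Sigma J (H t)" for t
  have "E ` T \<subseteq> {X. X \<subseteq> Sigma J Z \<and> finite X}"
  proof
    fix X assume "X \<in> E ` T"
    then obtain t where t: "t \<in> T" "X = Sigma J (H t)" by (auto simp: E_def)
    have "X \<subseteq> Sigma J Z" unfolding t(2) by (rule Sigma_mono[OF order_refl]) (rule H(2)[OF t(1)])
    moreover have "finite X" unfolding t(2) by (rule finite_SigmaI[OF J]) (rule H(1)[OF t(1)])
    ultimately show "X \<in> {X. X \<subseteq> Sigma J Z \<and> finite X}" by simp
  qed
  moreover have "countable {X. X \<subseteq> Sigma J Z \<and> finite X}"
  proof -
    have "countable (Sigma J Z)" using J Z(1) by (intro countable_SIGMA) (auto simp: countable_finite)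
    from countable_Collect_finite_subset[OF this] show ?thesis by (simp add: conj_commute)
  qed
  ultimately have cE: "countable (E ` T)" by (metis countable_subset)
  have "\<exists>X\<in>E ` T. infinite {t \<in> T. E t = X}"
  proof (rule ccontr)
    assume "\<not> ?thesis"
    then have "countable (\<Union>X\<in>E ` T. {t \<in> T. E t = X})"
      using cE by (intro countable_UN) (auto simp: countable_finite)
    moreover have "(\<Union>X\<in>E ` T. {t \<in> T. E t = X}) = T" by auto
    ultimately show False using T by simp
  qed
  then obtain t0 where t0: "t0 \<in> T" "infinite {t \<in> T. E t = E t0}" by auto
  have fE: "finite (E t0)" unfolding E_def using J H(1) t0(1) by auto
  \<comment> \<open>One parameter more than there are equations, that is, pairs of an index and a
    spanning vector.\<close>
  obtain F where F: "finite F" "card F = Suc (card (E t0))" "F \<subseteq> {t \<in> T. E t = E t0}"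
    using t0(2) infinite_arbitrarily_large by blast
  obtain l where l: "\<exists>t\<in>F. l t \<noteq> 0" "\<forall>h\<in>E t0. (\<Sum>t\<in>F. l t * c t (fst h) (snd h)) = 0"
    using homogeneous_system_nontrivial[OF fE F(1), of "\<lambda>t h. c t (fst h) (snd h)"] F(2) by auto
  have "(\<Sum>t\<in>F. sc (l t) * f j t) = 0" if j: "j \<in> J" for j
  proof -
    have HE: "H t j = H t0 j" if "t \<in> F" for t
    proof -
      have "E t = E t0" using that F(3) by blast
      then show ?thesis using j unfolding E_def by auto
    qed
    have "(\<Sum>t\<in>F. sc (l t) * f j t) = (\<Sum>t\<in>F. \<Sum>z\<in>H t0 j. sc (l t * c t j z) * z)"
    proof (intro sum.cong refl)
      fix t assume t: "t \<in> F"
      then have "f j t = (\<Sum>z\<in>H t0 j. sc (c t j z) * z)" using H(3)[of t j] F(3) j HE[OF t] by auto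
      then show "sc (l t) * f j t = (\<Sum>z\<in>H t0 j. sc (l t * c t j z) * z)"
        by (simp add: sum_distrib_left sc_mult mult.assoc)
    qed
    also have "\<dots> = (\<Sum>z\<in>H t0 j. sc (\<Sum>t\<in>F. l t * c t j z) * z)"
      by (subst sum.swap) (simp add: sc_sum sum_distrib_right)
    also have "\<dots> = 0"
    proof (intro sum.neutral ballI)
      fix z assume "z \<in> H t0 j"
      then have "(j, z) \<in> E t0" using j by (simp add: E_def)
      then show "sc (\<Sum>t\<in>F. l t * c t j z) * z = 0" using l(2) by (force simp: sc_0)
    qed
    finally show ?thesis .
  qed
  moreover have "(\<Sum>t\<in>{t\<in>F. l t \<noteq> 0}. sc (l t) * f j t) = (\<Sum>t\<in>F. sc (l t) * f j t)" for j
    using F(1) by (intro sum.mono_neutral_left) (auto simp: sc_0)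
  ultimately show ?thesis
    using F l(1) by (intro exI[of _ "{t\<in>F. l t \<noteq> 0}"] exI[of _ l]) auto
qed

section \<open>Polynomials with complex coefficients evaluated at a function\<close>

definition ev :: "'k \<Rightarrow> complex poly \<Rightarrow> 'k" where
  "ev p g = poly (map_poly sc g) p"

lemma ev_pCons: "ev p (pCons a g) = sc a + p * ev p g"
  by (simp add: ev_def map_poly_pCons sc_0)

lemma ev_0: "ev p 0 = 0"
  by (simp add: ev_def)

lemma ev_add: "ev p (f + g) = ev p f + ev p g"
  by (induction f g rule: poly_induct2) (auto simp: ev_0 ev_pCons sc_add algebra_simps)

lemma ev_smult: "ev p (smult a g) = sc a * ev p g"
  by (induction g) (auto simp: ev_0 ev_pCons sc_mult algebra_simps)

lemma ev_mult: "ev p (f * g) = ev p f * ev p g"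
  by (induction f) (auto simp: ev_0 ev_pCons ev_add ev_smult sc_0 algebra_simps)

lemma ev_1: "ev p 1 = 1"
  by (simp add: one_pCons ev_pCons ev_0 sc_1)

lemma ev_sum: "ev p (sum f F) = (\<Sum>x\<in>F. ev p (f x))"
  by (induction F rule: infinite_finite_induct) (auto simp: ev_0 ev_add)

lemma ev_prod: "ev p (prod f F) = (\<Prod>x\<in>F. ev p (f x))"
  by (induction F rule: infinite_finite_induct) (auto simp: ev_1 ev_mult)

lemma ev_linear: "ev p [:- c, 1:] = p - sc c"
  by (simp add: ev_pCons ev_0 sc_minus sc_1)

lemma ev_in_subring: "is_subring A \<Longrightarrow> range sc \<subseteq> A \<Longrightarrow> p \<in> A \<Longrightarrow> ev p g \<in> A"
  by (induction g) (auto simp: ev_0 ev_pCons is_subringD intro!: is_subringD)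

text \<open>The polynomial splits into linear factors and the ideal is prime. Hence a point of the
  total space lies over a closed point of the line or over the generic point.\<close>

lemma ev_in_prime_ideal:
  assumes A: "is_subring A" "range sc \<subseteq> A" "p \<in> A" and q: "is_prime_ideal A q"
    and g: "g \<noteq> 0" "ev p g \<in> q"
  shows "\<exists>c. p - sc c \<in> q"
  using g
proof (induction "degree g" arbitrary: g rule: less_induct)
  case less
  note P = is_prime_idealD[OF q]
  show ?case
  proof (cases "degree g = 0")
    case True
    then obtain a where a: "g = [:a:]" by (metis degree_eq_zeroE)
    then have "sc a \<in> q" "a \<noteq> 0" using less.prems by (auto simp: ev_pCons ev_0)
    moreover have "sc (inverse a) \<in> A" using A by blast
    ultimately have "sc (inverse a) * sc a \<in> q" using is_idealD(4)[OF P(1)] by blast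
    then show ?thesis using \<open>a \<noteq> 0\<close> P(2) by (simp flip: sc_mult add: sc_1)
  next
    case False
    then have "\<not> constant (poly g)" by (simp add: constant_degree)
    then obtain c where "poly g c = 0" using fundamental_theorem_of_algebra by blast
    then obtain h where h: "g = [:- c, 1:] * h" by (metis poly_eq_0_iff_dvd dvdE)
    then have h0: "h \<noteq> 0" using less.prems by auto
    have "degree g = degree [:- c, 1:] + degree h"
      unfolding h using h0 by (intro degree_mult_eq) auto
    then have h1: "degree h < degree g" by simp
    have "(p - sc c) * ev p h \<in> q" using less.prems by (simp only: h ev_mult ev_linear)
    moreover have "p - sc c \<in> A" using A is_subringD(2) by blast
    moreover have "ev p h \<in> A" using A by (rule ev_in_subring)
    ultimately consider "p - sc c \<in> q" | "ev p h \<in> q" using P(5) by blast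
    then show ?thesis using less.hyps[OF h1 h0] by cases auto
  qed
qed

text \<open>The Lagrange-type polynomials below are nonzero since exactly one summand survives at each node.\<close>

definition node_poly :: "complex set \<Rightarrow> (complex \<Rightarrow> complex) \<Rightarrow> complex poly" where
  "node_poly F l = (\<Sum>t\<in>F. smult (l t) (\<Prod>s\<in>F-{t}. [:- s, 1:]))"

lemma node_poly_nonzero:
  assumes "finite F" "F \<noteq> {}" "\<forall>t\<in>F. l t \<noteq> 0"
  shows "node_poly F l \<noteq> 0"
proof -
  obtain t where t: "t \<in> F" using assms by blast
  have "poly (node_poly F l) t = (\<Sum>u\<in>F. l u * (\<Prod>s\<in>F-{u}. t - s))"
    by (simp add: node_poly_def poly_sum poly_prod)
  also have "\<dots> = (\<Sum>u\<in>{t}. l u * (\<Prod>s\<in>F-{u}. t - s))"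
    using t assms(1) by (intro sum.mono_neutral_right) (auto intro!: prod_zero)
  also have "\<dots> \<noteq> 0" using t assms by auto
  finally show ?thesis by auto
qed

lemma ev_node_poly: "ev p (node_poly F l) = (\<Sum>t\<in>F. sc (l t) * (\<Prod>s\<in>F-{t}. p - sc s))"
  by (simp add: node_poly_def ev_sum ev_smult ev_prod ev_linear)

end

subsection \<open>Charts of a variety\<close>

text \<open>A finite affine atlas is fixed here, since the definition of \<open>variety\<close> only
  asserts its existence and the gluing argument has to refer to the individual charts.\<close>

locale charted = scalars "scalar Y" for Y :: "'k::field model" +
  fixes \<A> :: "'k set set"
  assumes finite_charts: "finite \<A>" and charts_nonempty: "\<A> \<noteq> {}"
    and chart_generated: "A \<in> \<A> \<Longrightarrow> \<exists>G. finite G \<and> A = generated_algebra (scalar Y) G"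
    and chart_fractions: "A \<in> \<A> \<Longrightarrow> localization A {0} = function_field Y"
    and points_eq: "points Y = (\<Union>A\<in>\<A>. spec_points A)"
    and separated: "R \<in> points Y \<Longrightarrow> S \<in> points Y \<Longrightarrow> local_subring T \<Longrightarrow> dominates T R \<Longrightarrow> dominates T S \<Longrightarrow> R = S"

lemma variety_charted:
  assumes "variety Y"
  shows "\<exists>\<A>. charted Y \<A>"
proof -
  note v = assms[unfolded variety_def]
  have sc: "scalars (scalar Y)" using v by (simp add: scalars_def)
  have sep: "\<forall>R\<in>points Y. \<forall>S\<in>points Y. \<forall>T. local_subring T \<and> dominates T R \<and> dominates T S \<longrightarrow> R = S"
    using v by (elim conjE) assumption
  from v have "\<exists>\<A>. finite \<A> \<and> \<A> \<noteq> {} \<and>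
    (\<forall>A\<in>\<A>. \<exists>G. finite G \<and> A = generated_algebra (scalar Y) G) \<and>
    (\<forall>A\<in>\<A>. localization A {0} = function_field Y) \<and> points Y = (\<Union>A\<in>\<A>. spec_points A)"
    by (elim conjE) assumption
  then obtain \<A> where A: "finite \<A>" "\<A> \<noteq> {}" "\<forall>A\<in>\<A>. \<exists>G. finite G \<and> A = generated_algebra (scalar Y) G"
    "\<forall>A\<in>\<A>. localization A {0} = function_field Y" "points Y = (\<Union>A\<in>\<A>. spec_points A)"
    by (elim exE conjE)
  have "charted Y \<A>"
  proof (intro charted.intro charted_axioms.intro sc A(1,2,5))
    show "\<exists>G. finite G \<and> A = generated_algebra (scalar Y) G" if "A \<in> \<A>" for A using A(3) that by (rule bspec)
    show "localization A {0} = function_field Y" if "A \<in> \<A>" for A using A(4) that by (rule bspec)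
    show "R = S" if "R \<in> points Y" "S \<in> points Y" "local_subring T" "dominates T R" "dominates T S" for R S T
      using sep that by metis
  qed
  then show ?thesis ..
qed

lemma is_prime_ideal_zero: "is_subring A \<Longrightarrow> is_prime_ideal A {0}"
  unfolding is_prime_ideal_def is_ideal_def by (auto simp: is_subringD)

context charted
begin

lemma chart_subring: "A \<in> \<A> \<Longrightarrow> is_subring A"
  using chart_generated is_subring_generated by metis

lemma scalar_in_chart: "A \<in> \<A> \<Longrightarrow> scalar Y c \<in> A"
  using chart_generated scalar_in_generated by metis

lemma pointE:
  assumes "R \<in> points Y"
  obtains A where "A \<in> \<A>" "R \<in> spec_points A" "A \<subseteq> R"
proof -
  obtain A where A: "A \<in> \<A>" "R \<in> spec_points A" using assms points_eq by auto
  then show ?thesis using that spec_points_properties(2)[OF chart_subring] by blast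
qed

lemma point_local: "R \<in> points Y \<Longrightarrow> local_subring R"
  using pointE spec_points_properties(1) chart_subring by metis

lemma point_subring: "R \<in> points Y \<Longrightarrow> is_subring R"
  using point_local local_subringD(1) by blast

lemma scalar_in_point: "R \<in> points Y \<Longrightarrow> scalar Y c \<in> R"
  using pointE scalar_in_chart by (metis subsetD)

lemma point_localization: "R \<in> points Y \<Longrightarrow> is_prime_ideal R Q \<Longrightarrow> localization R Q \<in> points Y"
proof -
  assume R: "R \<in> points Y" and Q: "is_prime_ideal R Q"
  obtain A where A: "A \<in> \<A>" "R \<in> spec_points A" using R points_eq by auto
  then have "localization R Q \<in> spec_points A" using spec_points_localization[OF chart_subring _ Q] by blast
  then show ?thesis using A points_eq by blast
qed

lemma function_field_point: "function_field Y \<in> points Y"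
proof -
  obtain A where A: "A \<in> \<A>" using charts_nonempty by blast
  then have "localization A {0} \<in> spec_points A"
    using is_prime_ideal_zero[OF chart_subring] unfolding spec_points_def by blast
  then show ?thesis using A chart_fractions points_eq by auto
qed

lemma function_field_subring: "is_subring (function_field Y)"
  using function_field_point point_subring by blast

lemma function_field_inverse: "x \<in> function_field Y \<Longrightarrow> inverse x \<in> function_field Y"
proof -
  assume x: "x \<in> function_field Y"
  obtain A where A: "A \<in> \<A>" using charts_nonempty by blast
  then have "x \<in> localization A {0}" using chart_fractions x by simp
  then obtain a s where as: "a \<in> A" "s \<in> A" "s \<notin> {0}" "x = a / s" by (rule in_localizationE)
  show ?thesis
  proof (cases "a = 0")
    case True
    then show ?thesis using as is_subringD(4)[OF function_field_subring] by simp
  next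
    case False
    then have "inverse x \<in> localization A {0}" using in_localizationI[of s A a "{0}"] as by simp
    then show ?thesis using chart_fractions A by simp
  qed
qed

text \<open>Finite intersections of the generating open sets form a base. From here on a
  neighbourhood of \<open>R\<close> is handled as a finite set \<open>H\<close> of functions regular
  at \<open>R\<close>, and nearby points are those whose local rings contain
  \<open>H\<close>.\<close>

lemma open_basic_neighbourhood:
  assumes "openin (zariski Y) U" "R \<in> U"
  shows "\<exists>H. finite H \<and> H \<subseteq> R \<and> (\<forall>S\<in>points Y. H \<subseteq> S \<longrightarrow> S \<in> U)"
proof -
  have "generate_topology_on {{R \<in> points Y. f \<in> R} | f. f \<in> function_field Y} U"
    using assms(1) unfolding zariski_def by (simp add: openin_topology_generated_by_iff)
  then show ?thesis using assms(2)
  proof (induction U)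
    case Empty
    then show ?case by simp
  next
    case (Int U V)
    obtain H where "finite H" "H \<subseteq> R" "\<forall>S\<in>points Y. H \<subseteq> S \<longrightarrow> S \<in> U" using Int by blast
    moreover obtain K where "finite K" "K \<subseteq> R" "\<forall>S\<in>points Y. K \<subseteq> S \<longrightarrow> S \<in> V" using Int by blast
    ultimately show ?case by (intro exI[of _ "H \<union> K"]) auto
  next
    case (UN \<U>)
    then obtain U where U: "U \<in> \<U>" "R \<in> U" by blast
    from UN.IH[OF U] obtain H where "finite H" "H \<subseteq> R" "\<forall>S\<in>points Y. H \<subseteq> S \<longrightarrow> S \<in> U" by blast
    then show ?case using U by (intro exI[of _ H]) auto
  next
    case (Basis U)
    then obtain f where "U = {R \<in> points Y. f \<in> R}" by blast
    then show ?case using Basis by (intro exI[of _ "{f}"]) auto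
  qed
qed

end

subsection \<open>Modules and Nakayama's lemma\<close>

lemma mod_spanI: "finite H \<Longrightarrow> H \<subseteq> G \<Longrightarrow> (\<And>g. g \<in> H \<Longrightarrow> c g \<in> R) \<Longrightarrow> (\<Sum>g\<in>H. c g * g) \<in> mod_span R G"
  unfolding mod_span_def by blast

lemma mod_spanE:
  assumes "x \<in> mod_span R G"
  obtains H c where "finite H" "H \<subseteq> G" "\<forall>g\<in>H. c g \<in> R" "x = (\<Sum>g\<in>H. c g * g)"
  using assms unfolding mod_span_def by blast

lemma mod_span_mono: "R \<subseteq> S \<Longrightarrow> G \<subseteq> K \<Longrightarrow> mod_span R G \<subseteq> mod_span S K"
  unfolding mod_span_def by blast

lemma mod_span_zero: "0 \<in> mod_span R G"
  using mod_spanI[of "{}" G "\<lambda>_. 0" R] by simp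

lemma mod_span_scale:
  assumes "is_subring R" "r \<in> R" "x \<in> mod_span R G"
  shows "r * x \<in> mod_span R G"
proof -
  obtain H c where x: "finite H" "H \<subseteq> G" "\<forall>g\<in>H. c g \<in> R" "x = (\<Sum>g\<in>H. c g * g)"
    using assms(3) by (rule mod_spanE)
  have "r * x = (\<Sum>g\<in>H. (r * c g) * g)" unfolding x(4) by (simp add: sum_distrib_left mult.assoc)
  also have "\<dots> \<in> mod_span R G" using x assms is_subringD(3) by (intro mod_spanI) blast+
  finally show ?thesis .
qed

lemma mod_span_single: "is_subring R \<Longrightarrow> r \<in> R \<Longrightarrow> g \<in> G \<Longrightarrow> r * g \<in> mod_span R G"
  using mod_spanI[of "{g}" G "\<lambda>_. r" R] by simp

lemma mod_span_base: "is_subring R \<Longrightarrow> g \<in> G \<Longrightarrow> g \<in> mod_span R G"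
  using mod_span_single[OF _ is_subringD(1), of R g G] by simp

lemma mod_span_add:
  assumes "is_subring R" "x \<in> mod_span R G" "y \<in> mod_span R G"
  shows "x + y \<in> mod_span R G"
proof -
  note Rd = is_subringD[OF assms(1)]
  obtain H c where x: "finite H" "H \<subseteq> G" "\<forall>g\<in>H. c g \<in> R" "x = (\<Sum>g\<in>H. c g * g)"
    using assms(2) by (rule mod_spanE)
  obtain K d where y: "finite K" "K \<subseteq> G" "\<forall>g\<in>K. d g \<in> R" "y = (\<Sum>g\<in>K. d g * g)"
    using assms(3) by (rule mod_spanE)
  define e where "e z = (if z \<in> H then c z else 0) + (if z \<in> K then d z else 0)" for z
  have "(\<Sum>z\<in>H \<union> K. e z * z)
    = (\<Sum>z\<in>H \<union> K. if z \<in> H then c z * z else 0) + (\<Sum>z\<in>H \<union> K. if z \<in> K then d z * z else 0)"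
    unfolding sum.distrib[symmetric] by (intro sum.cong) (auto simp: e_def distrib_right)
  also have "(\<Sum>z\<in>H \<union> K. if z \<in> H then c z * z else 0) = x"
    unfolding x(4) using x(1) y(1) by (intro sum.mono_neutral_cong_right) auto
  also have "(\<Sum>z\<in>H \<union> K. if z \<in> K then d z * z else 0) = y"
    unfolding y(4) using x(1) y(1) by (intro sum.mono_neutral_cong_right) auto
  finally have "x + y = (\<Sum>z\<in>H \<union> K. e z * z)" ..
  also have "\<dots> \<in> mod_span R G"
  proof (rule mod_spanI)
    fix g assume "g \<in> H \<union> K"
    have "(if g \<in> H then c g else 0) \<in> R" "(if g \<in> K then d g else 0) \<in> R" using x(3) y(3) Rd(4) by auto
    then show "e g \<in> R" unfolding e_def by (rule Rd(6))
  qed (use x y in auto)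
  finally show ?thesis .
qed

lemma mod_span_diff:
  assumes "is_subring R" "x \<in> mod_span R G" "y \<in> mod_span R G"
  shows "x - y \<in> mod_span R G"
proof -
  have "(- 1) * y \<in> mod_span R G"
    using assms is_subringD(5)[OF assms(1) is_subringD(1)[OF assms(1)]] by (intro mod_span_scale)
  from mod_span_add[OF assms(1,2) this] show ?thesis by simp
qed

lemma mod_span_insert:
  assumes "is_subring R" "x \<in> mod_span R (insert g G)"
  shows "\<exists>r\<in>R. \<exists>y\<in>mod_span R G. x = r * g + y"
proof -
  obtain H c where x: "finite H" "H \<subseteq> insert g G" "\<forall>g\<in>H. c g \<in> R" "x = (\<Sum>g\<in>H. c g * g)"
    using assms(2) by (rule mod_spanE)
  have rest: "(\<Sum>g\<in>H - {g}. c g * g) \<in> mod_span R G" using x by (intro mod_spanI) auto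
  show ?thesis
  proof (cases "g \<in> H")
    case True
    then have "x = c g * g + (\<Sum>g\<in>H - {g}. c g * g)" unfolding x(4) by (rule sum.remove[OF x(1)])
    then show ?thesis using rest x(3) True by blast
  next
    case False
    then have "x = 0 * g + (\<Sum>g\<in>H - {g}. c g * g)" using x by simp
    then show ?thesis using rest is_subringD(4)[OF assms(1)] by blast
  qed
qed

lemma mod_span_subset:
  assumes "\<And>g. g \<in> G \<Longrightarrow> g \<in> (*) f ` R" "is_subring R"
  shows "mod_span R G \<subseteq> (*) f ` R"
proof
  fix x assume "x \<in> mod_span R G"
  then obtain H c where x: "finite H" "H \<subseteq> G" "\<forall>g\<in>H. c g \<in> R" "x = (\<Sum>g\<in>H. c g * g)"
    by (rule mod_spanE)
  have "\<forall>g\<in>G. \<exists>s\<in>R. g = f * s" using assms(1) by blast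
  then obtain s where s: "\<And>g. g \<in> G \<Longrightarrow> s g \<in> R" "\<And>g. g \<in> G \<Longrightarrow> g = f * s g" by metis
  have "x = (\<Sum>g\<in>H. f * (c g * s g))"
    unfolding x(4)
  proof (intro sum.cong refl)
    fix g assume "g \<in> H"
    then have "g = f * s g" using s(2) x(2) by blast
    then show "c g * g = f * (c g * s g)" by (metis mult.left_commute)
  qed
  then have "x = f * (\<Sum>g\<in>H. c g * s g)" by (simp add: sum_distrib_left)
  moreover have "(\<Sum>g\<in>H. c g * s g) \<in> R"
    using x s assms(2) by (intro is_subring_sum is_subringD(3)) auto
  ultimately show "x \<in> (*) f ` R" by blast
qed

text \<open>The case of a module that is generated by one element \<open>f\<close> modulo a multiple
  \<open>a\<close> in the maximal ideal. The generators in \<open>G\<close> are discarded one after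
  the other, while the module stays the sum of the multiples of \<open>f\<close> and the span of the
  remaining generators.\<close>

lemma nakayama:
  assumes R: "local_subring R" and a: "a \<in> max_ideal R" and G: "finite G"
    and f: "f \<in> mod_span R G"
    and gen: "\<And>m. m \<in> mod_span R G \<Longrightarrow> \<exists>r\<in>R. \<exists>m'\<in>mod_span R G. m = r * f + a * m'"
  shows "mod_span R G = (*) f ` R"
proof -
  note Rr = local_subringD(1)[OF R] and pr = is_prime_idealD[OF local_subringD(3)[OF R]]
  note Rd = is_subringD[OF Rr]
  have aR: "a \<in> R" using a by (simp add: max_ideal_def)
  have "mod_span R G \<subseteq> (*) f ` R" if "finite H" "H \<subseteq> G"
    "\<And>m. m \<in> mod_span R G \<Longrightarrow> \<exists>r\<in>R. \<exists>h\<in>mod_span R H. m = r * f + h" for H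
    using that
  proof (induction H rule: finite_induct)
    case empty
    show ?case
    proof
      fix m assume "m \<in> mod_span R G"
      then obtain r h where "r \<in> R" "h \<in> mod_span R {}" "m = r * f + h" using empty(2) by blast
      then show "m \<in> (*) f ` R" by (auto elim!: mod_spanE)
    qed
  next
    case (insert g H)
    have "\<exists>s\<in>R. \<exists>k\<in>mod_span R H. g = s * f + k"
    proof -
      have "g \<in> mod_span R G" using insert mod_span_base[OF Rr] by blast
      then obtain r m where rm: "r \<in> R" "m \<in> mod_span R G" "g = r * f + a * m" using gen by blast
      then obtain s h where sh: "s \<in> R" "h \<in> mod_span R (insert g H)" "m = s * f + h" using insert(5) by blast
      then obtain u k where uk: "u \<in> R" "k \<in> mod_span R H" "h = u * g + k" using mod_span_insert[OF Rr] by blast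
      \<comment> \<open>The expression of \<open>g\<close> through \<open>f\<close> and
        \<open>a * m\<close> again involves \<open>g\<close>, with the coefficient
        \<open>a * u\<close>; bringing this term to the left requires \<open>1 - a * u\<close> to be
        a unit.\<close>
      have "1 - a * u \<notin> max_ideal R"
      proof
        assume 1: "1 - a * u \<in> max_ideal R"
        have "u * a \<in> max_ideal R" using is_idealD(4)[OF pr(1) uk(1) a] .
        then have "(1 - a * u) + u * a \<in> max_ideal R" using is_idealD(3)[OF pr(1) 1] by blast
        then show False using pr(2) by (simp add: mult.commute)
      qed
      moreover have "1 - a * u \<in> R" using Rd(1,2,3) aR uk(1) by blast
      ultimately have un: "1 - a * u \<noteq> 0" "inverse (1 - a * u) \<in> R" by (auto simp: max_ideal_def ring_units_def)
      have "(1 - a * u) * g = (r + a * s) * f + a * k"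
        using rm(3) sh(3) uk(3) by (simp add: algebra_simps)
      then have "g = inverse (1 - a * u) * ((r + a * s) * f + a * k)"
        using un(1) by (metis left_inverse mult.assoc mult_1)
      then have "g = (inverse (1 - a * u) * (r + a * s)) * f + (inverse (1 - a * u) * a) * k"
        by (metis distrib_left mult.assoc)
      moreover have "inverse (1 - a * u) * (r + a * s) \<in> R"
        using un(2) rm(1) sh(1) aR Rd(3,6) by blast
      moreover have "(inverse (1 - a * u) * a) * k \<in> mod_span R H"
        using un(2) aR Rd(3) uk(2) by (intro mod_span_scale[OF Rr]) blast+
      ultimately show ?thesis by blast
    qed
    then obtain s k where g: "s \<in> R" "k \<in> mod_span R H" "g = s * f + k" by blast
    have "\<exists>r\<in>R. \<exists>h\<in>mod_span R H. m = r * f + h" if m: "m \<in> mod_span R G" for m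
    proof -
      obtain r h where rh: "r \<in> R" "h \<in> mod_span R (insert g H)" "m = r * f + h" using insert(5)[OF m] by blast
      then obtain u k' where uk: "u \<in> R" "k' \<in> mod_span R H" "h = u * g + k'" using mod_span_insert[OF Rr] by blast
      have "m = (r + u * s) * f + (u * k + k')" unfolding rh(3) uk(3) by (subst g(3)) (simp add: algebra_simps)
      moreover have "r + u * s \<in> R" using rh uk g Rd(3,6) by blast
      moreover have "u * k + k' \<in> mod_span R H"
        using uk g by (intro mod_span_add[OF Rr] mod_span_scale[OF Rr])
      ultimately show ?thesis by blast
    qed
    then show ?case using insert.IH insert.prems(1) by blast
  qed
  moreover have "\<exists>r\<in>R. \<exists>h\<in>mod_span R G. m = r * f + h" if "m \<in> mod_span R G" for m
  proof -
    have "m = 0 * f + m" by simp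
    then show ?thesis using that Rd(4) by blast
  qed
  ultimately have "mod_span R G \<subseteq> (*) f ` R" using G by blast
  moreover have "(*) f ` R \<subseteq> mod_span R G"
    using mod_span_scale[OF Rr _ f] by (auto simp: mult.commute)
  ultimately show ?thesis by blast
qed

subsection \<open>Rank one sheaves and their restriction to fibers\<close>

context charted
begin

lemma divisorial_stalk:
  assumes "divisorial_sheaf Y F" "R \<in> points Y"
  obtains H G where "finite H" "H \<subseteq> R" "finite G" "\<forall>S\<in>points Y. H \<subseteq> S \<longrightarrow> F S = mod_span S G"
proof -
  from bspec[OF assms(1)[unfolded divisorial_sheaf_def] assms(2)]
  obtain U G where U: "openin (zariski Y) U" "R \<in> U" "finite G" "\<forall>S\<in>U. F S = mod_span S G"
    by (elim exE conjE)
  from open_basic_neighbourhood[OF U(1,2)] obtain H where "finite H" "H \<subseteq> R" "\<forall>S\<in>points Y. H \<subseteq> S \<longrightarrow> S \<in> U"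
    by (elim exE conjE)
  then show ?thesis using that[of H G] U(3,4) by simp
qed

lemma divisorial_stalk_mono:
  assumes "divisorial_sheaf Y F" "R \<in> points Y" "S \<in> points Y" "R \<subseteq> S"
  shows "F R \<subseteq> F S"
proof -
  obtain H G where H: "finite H" "H \<subseteq> R" "finite G" "\<forall>S\<in>points Y. H \<subseteq> S \<longrightarrow> F S = mod_span S G"
    using assms(1,2) by (rule divisorial_stalk)
  have "F R = mod_span R G" "F S = mod_span S G" using H(2,4) assms(2-4) by auto
  then show ?thesis using mod_span_mono[OF assms(4), of G G] by simp
qed

text \<open>Only finitely many coefficients are needed to express \<open>f\<close> through the
  generators \<open>G\<close> and each element of \<open>G\<close> as a multiple of
  \<open>f\<close>. Where they are all regular, \<open>f\<close> still generates the stalk.\<close>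

lemma divisorial_principal_neighbourhood:
  assumes F: "divisorial_sheaf Y F" and R: "R \<in> points Y" and f: "F R = (*) f ` R"
  shows "\<exists>H. finite H \<and> H \<subseteq> R \<and> (\<forall>S\<in>points Y. H \<subseteq> S \<longrightarrow> F S = (*) f ` S)"
proof -
  obtain H G where H: "finite H" "H \<subseteq> R" "finite G" "\<forall>S\<in>points Y. H \<subseteq> S \<longrightarrow> F S = mod_span S G"
    using F R by (rule divisorial_stalk)
  have FR: "mod_span R G = (*) f ` R" using H(2,4) R f by auto
  have Rr: "is_subring R" using R by (rule point_subring)
  have "f * 1 \<in> mod_span R G" unfolding FR using is_subringD(1)[OF Rr] by blast
  then obtain K c where K: "finite K" "K \<subseteq> G" "\<forall>g\<in>K. c g \<in> R" "f * 1 = (\<Sum>g\<in>K. c g * g)"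
    by (rule mod_spanE)
  have "\<forall>g\<in>G. \<exists>s\<in>R. g = f * s"
    using mod_span_base[OF Rr] FR by blast
  then obtain s where s: "\<forall>g\<in>G. s g \<in> R" "\<forall>g\<in>G. g = f * s g" by metis
  define H' where "H' = H \<union> c ` K \<union> s ` G"
  have "F S = (*) f ` S" if S: "S \<in> points Y" "H' \<subseteq> S" for S
  proof -
    have Sr: "is_subring S" using S(1) by (rule point_subring)
    have FS: "F S = mod_span S G" using H(4) S by (auto simp: H'_def)
    have "g \<in> (*) f ` S" if "g \<in> G" for g
      using s that S(2) unfolding H'_def by blast
    then have "mod_span S G \<subseteq> (*) f ` S" using Sr by (rule mod_span_subset)
    moreover have "f \<in> mod_span S G"
    proof -
      have "(\<Sum>g\<in>K. c g * g) \<in> mod_span S G"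
        using K(1,2) S(2) by (intro mod_spanI) (auto simp: H'_def)
      then show ?thesis using K(4) by simp
    qed
    then have "(*) f ` S \<subseteq> mod_span S G"
      using mod_span_scale[OF Sr] by (auto simp: mult.commute)
    ultimately show ?thesis using FS by blast
  qed
  then show ?thesis using H K(1) s(1) K(3)
    by (intro exI[of _ H']) (auto simp: H'_def)
qed

end

text \<open>\<open>h\<close> generates the stalk at \<open>S\<close> of the sheaf of homomorphisms from the \<open>n\<close>-th power of \<open>F\<close> to \<open>F'\<close>.\<close>

definition ratio_generator :: "('k::field set \<Rightarrow> 'k set) \<Rightarrow> ('k set \<Rightarrow> 'k set) \<Rightarrow> nat \<Rightarrow> 'k set \<Rightarrow> 'k \<Rightarrow> bool" where
  "ratio_generator F F' n S h \<longleftrightarrow>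
     (\<exists>f f'. f \<noteq> 0 \<and> f' \<noteq> 0 \<and> F S = (*) f ` S \<and> F' S = (*) f' ` S \<and> h = f' / f ^ n)"

lemma principal_generators_unit:
  assumes S: "is_subring S" and f: "f \<noteq> 0" "g \<noteq> 0" "(*) f ` S = (*) g ` S"
  shows "f / g \<in> ring_units S"
proof -
  have "f * 1 \<in> (*) f ` S" "g * 1 \<in> (*) g ` S" using is_subringD(1)[OF S] by blast+
  then have "f * 1 \<in> (*) g ` S" "g * 1 \<in> (*) f ` S" using f by auto
  then obtain u v where "f * 1 = g * u" "g * 1 = f * v" "u \<in> S" "v \<in> S" by blast
  then have "f / g = u" "g / f = v" "u \<in> S" "v \<in> S" using f by (auto simp: field_simps)
  then show ?thesis using f by (auto simp: ring_units_def)
qed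

lemma unit_times_image: "is_subring S \<Longrightarrow> u \<in> ring_units S \<Longrightarrow> (*) (f * u) ` S = (*) f ` S"
proof -
  assume S: "is_subring S" and u: "u \<in> ring_units S"
  have u': "u \<noteq> 0" "u \<in> S" "inverse u \<in> S" using u by (auto simp: ring_units_def)
  show ?thesis
  proof
    show "(*) (f * u) ` S \<subseteq> (*) f ` S" using is_subringD(3)[OF S] u' by (auto simp: mult.assoc)
    show "(*) f ` S \<subseteq> (*) (f * u) ` S"
    proof
      fix x assume "x \<in> (*) f ` S"
      then obtain s where s: "s \<in> S" "x = f * s" by blast
      then have "x = f * u * (inverse u * s)" using u' by simp
      then show "x \<in> (*) (f * u) ` S" using is_subringD(3)[OF S u'(3) s(1)] by blast
    qed
  qed
qed

lemma ratio_generator_nonzero: "ratio_generator F F' n S h \<Longrightarrow> h \<noteq> 0"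
  by (auto simp: ratio_generator_def)

lemma ratio_generator_unique:
  assumes S: "is_subring S" and "ratio_generator F F' n S h" "ratio_generator F F' n S k"
  shows "h / k \<in> ring_units S"
proof -
  obtain f f' where f: "f \<noteq> 0" "f' \<noteq> 0" "F S = (*) f ` S" "F' S = (*) f' ` S" "h = f' / f ^ n"
    using assms(2) unfolding ratio_generator_def by blast
  obtain g g' where g: "g \<noteq> 0" "g' \<noteq> 0" "F S = (*) g ` S" "F' S = (*) g' ` S" "k = g' / g ^ n"
    using assms(3) unfolding ratio_generator_def by blast
  have "f' / g' \<in> ring_units S" "g / f \<in> ring_units S"
    using principal_generators_unit[OF S] f g by auto
  then have "(f' / g') * (g / f) ^ n \<in> ring_units S"
    using ring_units_mult[OF S] ring_units_power[OF S] by blast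
  moreover have "(f' / g') * (g / f) ^ n = h / k" using f g by (simp add: power_divide)
  ultimately show ?thesis by simp
qed

lemma ratio_generator_unit:
  assumes S: "is_subring S" and "ratio_generator F F' n S h" "u \<in> ring_units S"
  shows "ratio_generator F F' n S (h * u)"
proof -
  obtain f f' where f: "f \<noteq> 0" "f' \<noteq> 0" "F S = (*) f ` S" "F' S = (*) f' ` S" "h = f' / f ^ n"
    using assms(2) unfolding ratio_generator_def by blast
  have "u \<noteq> 0" using assms(3) by (simp add: ring_units_def)
  then show ?thesis unfolding ratio_generator_def
    using f unit_times_image[OF S assms(3), of f'] by (intro exI[of _ f] exI[of _ "f' * u"]) auto
qed

lemma (in charted) ratio_generator_neighbourhood:
  assumes "divisorial_sheaf Y F" "divisorial_sheaf Y F'" "R \<in> points Y" "ratio_generator F F' n R h"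
  shows "\<exists>H. finite H \<and> H \<subseteq> R \<and> (\<forall>S\<in>points Y. H \<subseteq> S \<longrightarrow> ratio_generator F F' n S h)"
proof -
  obtain f f' where f: "f \<noteq> 0" "f' \<noteq> 0" "F R = (*) f ` R" "F' R = (*) f' ` R" "h = f' / f ^ n"
    using assms(4) unfolding ratio_generator_def by blast
  from divisorial_principal_neighbourhood[OF assms(1,3) f(3)]
  obtain H where H: "finite H" "H \<subseteq> R" "\<forall>S\<in>points Y. H \<subseteq> S \<longrightarrow> F S = (*) f ` S"
    by (elim exE conjE)
  from divisorial_principal_neighbourhood[OF assms(2,3) f(4)]
  obtain K where K: "finite K" "K \<subseteq> R" "\<forall>S\<in>points Y. K \<subseteq> S \<longrightarrow> F' S = (*) f' ` S"
    by (elim exE conjE)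
  have "ratio_generator F F' n S h" if "S \<in> points Y" "H \<union> K \<subseteq> S" for S
  proof -
    have "F S = (*) f ` S" "F' S = (*) f' ` S" using H(3) K(3) that by simp_all
    then show ?thesis unfolding ratio_generator_def using f(1,2,5) by (intro exI[of _ f] exI[of _ f'] conjI)
  qed
  then show ?thesis using H K by (intro exI[of _ "H \<union> K"]) auto
qed

text \<open>The target \<open>W\<close> is either the general fiber or the toric variety. The two
  facts on \<open>W\<close> that the argument requires are assumed directly, so that the toric case
  can be settled from its explicit charts.\<close>

locale fiber = charted Y \<A> for Y :: "'b::field model" and \<A> +
  fixes p :: 'b and t :: complex and W :: "'k::field model" and \<phi> :: "'b \<Rightarrow> 'k"
  assumes iso: "fiber_iso Y p t W \<phi>" and target_1: "scalar W 1 = 1"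
    and target_inverse: "x \<in> function_field W \<Longrightarrow> inverse x \<in> function_field W"
begin

definition L where "L = \<Union>(fiber_points Y p t)"

abbreviation "q \<equiv> p - scalar Y t"

lemma generic: "L \<in> fiber_points Y p t"
  and phi_add: "a \<in> L \<Longrightarrow> b \<in> L \<Longrightarrow> \<phi> (a + b) = \<phi> a + \<phi> b"
  and phi_mult: "a \<in> L \<Longrightarrow> b \<in> L \<Longrightarrow> \<phi> (a * b) = \<phi> a * \<phi> b"
  and phi_scalar: "\<phi> (scalar Y c) = scalar W c"
  and phi_image: "\<phi> ` L = function_field W"
  and phi_kernel: "R \<in> fiber_points Y p t \<Longrightarrow> {a \<in> R. \<phi> a = 0} = {q * a | a. a \<in> R}"
  and phi_bij: "bij_betw (\<lambda>R. \<phi> ` R) (fiber_points Y p t) (points W)"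
  using iso unfolding fiber_iso_def L_def Let_def by auto

lemma fiber_point: "R \<in> fiber_points Y p t \<Longrightarrow> R \<in> points Y"
  and fiber_max: "R \<in> fiber_points Y p t \<Longrightarrow> q \<in> max_ideal R"
  by (auto simp: fiber_points_def)

lemma fiber_subset: "R \<in> fiber_points Y p t \<Longrightarrow> R \<subseteq> L"
  by (auto simp: L_def)

lemmas fiber_subring = point_subring[OF fiber_point]
lemmas fiber_local = point_local[OF fiber_point]

lemma phi_image_point: "R \<in> fiber_points Y p t \<Longrightarrow> \<phi> ` R \<in> points W"
  using phi_bij unfolding bij_betw_def by blast

lemma points_image: "S \<in> points W \<Longrightarrow> \<exists>R\<in>fiber_points Y p t. S = \<phi> ` R"
  using phi_bij unfolding bij_betw_def by blast

lemma phi_1: "\<phi> 1 = 1" using phi_scalar[of 1] by (simp add: sc_1 target_1)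

lemma L_subring: "is_subring L" using generic fiber_subring by blast

lemmas Ld = is_subringD[OF L_subring]

lemma phi_0: "\<phi> 0 = 0"
  by (metis Ld(4) add.right_neutral add_left_cancel phi_add)

lemma phi_diff: "a \<in> L \<Longrightarrow> b \<in> L \<Longrightarrow> \<phi> (a - b) = \<phi> a - \<phi> b"
  using phi_add[of "a - b" b] Ld(2)[of a b] by (simp add: algebra_simps)

lemma phi_power: "a \<in> L \<Longrightarrow> \<phi> (a ^ n) = \<phi> a ^ n"
  by (induction n) (auto simp: phi_1 phi_mult Ld(7))

lemma phi_sum: "(\<And>x. x \<in> F \<Longrightarrow> f x \<in> L) \<Longrightarrow> \<phi> (sum f F) = (\<Sum>x\<in>F. \<phi> (f x))"
  by (induction F rule: infinite_finite_induct) (auto simp: phi_0 phi_add is_subring_sum[OF L_subring])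

lemma phi_prod: "(\<And>x. x \<in> F \<Longrightarrow> f x \<in> L) \<Longrightarrow> \<phi> (prod f F) = (\<Prod>x\<in>F. \<phi> (f x))"
  by (induction F rule: infinite_finite_induct) (auto simp: phi_1 phi_mult is_subring_prod[OF L_subring])

lemma phi_kernelD: "R \<in> fiber_points Y p t \<Longrightarrow> a \<in> R \<Longrightarrow> \<phi> a = 0 \<Longrightarrow> \<exists>b\<in>R. a = q * b"
  using phi_kernel by blast

lemma phi_kernelI: "R \<in> fiber_points Y p t \<Longrightarrow> b \<in> R \<Longrightarrow> \<phi> (q * b) = 0"
  using phi_kernel by blast

lemma phi_image_subring:
  assumes "R \<in> fiber_points Y p t"
  shows "is_subring (\<phi> ` R)"
proof -
  note Rd = is_subringD[OF fiber_subring[OF assms]] and RL = fiber_subset[OF assms]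
  have "\<phi> a - \<phi> b \<in> \<phi> ` R" "\<phi> a * \<phi> b \<in> \<phi> ` R" if "a \<in> R" "b \<in> R" for a b
    using phi_diff[of a b] phi_mult[of a b] that RL Rd(2,3)[OF that] by (metis image_eqI subsetD)+
  moreover have "1 \<in> \<phi> ` R" using Rd(1) phi_1 by (metis image_eqI)
  ultimately show ?thesis unfolding is_subring_def by blast
qed

lemma phi_inverse: "u \<in> ring_units L \<Longrightarrow> \<phi> (inverse u) = inverse (\<phi> u)"
  and phi_unit_nonzero: "u \<in> ring_units L \<Longrightarrow> \<phi> u \<noteq> 0"
proof -
  assume u: "u \<in> ring_units L"
  then have u': "u \<noteq> 0" "u \<in> L" "inverse u \<in> L" by (auto simp: ring_units_def)
  have "\<phi> u * \<phi> (inverse u) = 1" using phi_mult[OF u'(2,3)] u'(1) by (simp add: phi_1)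
  then show "\<phi> (inverse u) = inverse (\<phi> u)" "\<phi> u \<noteq> 0" by (auto simp: inverse_unique)
qed

lemma phi_divide: "a \<in> L \<Longrightarrow> u \<in> ring_units L \<Longrightarrow> \<phi> (a / u) = \<phi> a / \<phi> u"
  by (simp add: divide_inverse phi_mult phi_inverse ring_units_def)

text \<open>If the images of \<open>u\<close> and \<open>v\<close> are inverse to each other,
  \<open>u * v - 1\<close> is a multiple of \<open>q\<close> and so lies in the maximal ideal; then
  \<open>u\<close> cannot lie there. Thus invertibility can be tested after restriction to the
  fiber.\<close>

lemma unit_iff:
  assumes R: "R \<in> fiber_points Y p t" and u: "u \<in> R"
  shows "u \<in> ring_units R \<longleftrightarrow> \<phi> u \<in> ring_units (\<phi> ` R)"
proof
  assume un: "u \<in> ring_units R"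
  then have "u \<in> ring_units L" using ring_units_mono[OF fiber_subset[OF R]] by blast
  then show "\<phi> u \<in> ring_units (\<phi> ` R)"
    using un phi_inverse[of u] phi_unit_nonzero[of u] unfolding ring_units_def by (auto intro: image_eqI[of _ _ "inverse u"])
next
  assume "\<phi> u \<in> ring_units (\<phi> ` R)"
  then have "\<phi> u \<noteq> 0" "inverse (\<phi> u) \<in> \<phi> ` R" by (auto simp: ring_units_def)
  then obtain v where v: "v \<in> R" "\<phi> u * \<phi> v = 1" by (auto simp: field_simps)
  note Rr = fiber_subring[OF R] and RL = fiber_subset[OF R]
  note Rd = is_subringD[OF Rr]
  have "\<phi> (u * v - 1) = 0"
    using phi_diff[of "u * v" 1] phi_mult[of u v] Ld u v RL by (simp add: phi_1 subset_iff)
  moreover have "u * v - 1 \<in> R" using Rd(1,2,3) u v by blast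
  ultimately obtain b where b: "b \<in> R" "u * v - 1 = q * b" using phi_kernelD[OF R] by blast
  note M = is_prime_idealD[OF local_subringD(3)[OF fiber_local[OF R]]]
  note I = is_idealD[OF M(1)]
  have "u \<notin> max_ideal R"
  proof
    assume "u \<in> max_ideal R"
    then have "v * u \<in> max_ideal R" using I(4) v(1) by blast
    moreover have "b * q \<in> max_ideal R" using I(4) b(1) fiber_max[OF R] by blast
    ultimately have "v * u - b * q \<in> max_ideal R" using is_ideal_diff[OF Rr M(1)] by blast
    moreover have "v * u - b * q = 1" using b(2) by (simp add: algebra_simps)
    ultimately show False using M(2) by simp
  qed
  then show "u \<in> ring_units R" using u by (simp add: max_ideal_def)
qed

lemma L_unit: "u \<in> L \<Longrightarrow> \<phi> u \<noteq> 0 \<Longrightarrow> u \<in> ring_units L"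
  using unit_iff[OF generic] phi_image target_inverse by (auto simp: ring_units_def)

text \<open>A generator \<open>y\<close> of the restricted stalk is lifted to \<open>f\<close>.
  Every element of the stalk differs from a multiple of \<open>f\<close> by an element of the
  kernel, which is \<open>q\<close> times the stalk, so Nakayama's lemma applies: invertibility on
  the fiber implies invertibility on the total space.\<close>

lemma restricted_generator:
  assumes F: "divisorial_sheaf Y F"
    and add: "\<And>m n. m \<in> F L \<Longrightarrow> n \<in> F L \<Longrightarrow> \<psi> (m + n) = \<psi> m + \<psi> n"
    and scale: "\<And>a m. a \<in> L \<Longrightarrow> m \<in> F L \<Longrightarrow> \<psi> (a * m) = \<phi> a * \<psi> m"
    and R: "R \<in> fiber_points Y p t"
    and im: "\<psi> ` F R = (*) y ` \<phi> ` R" and ker: "{m \<in> F R. \<psi> m = 0} = {q * m | m. m \<in> F R}" and y: "y \<noteq> 0"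
  shows "\<exists>f. f \<noteq> 0 \<and> F R = (*) f ` R \<and> \<psi> f = y"
proof -
  note Rr = fiber_subring[OF R] and RY = fiber_point[OF R] and RL = fiber_subset[OF R]
  note Rd = is_subringD[OF Rr]
  have FL: "F R \<subseteq> F L" using divisorial_stalk_mono[OF F RY fiber_point[OF generic] RL] .
  obtain H G where H: "finite H" "H \<subseteq> R" "finite G" "\<forall>S\<in>points Y. H \<subseteq> S \<longrightarrow> F S = mod_span S G"
    using F RY by (rule divisorial_stalk)
  have FR: "F R = mod_span R G" using H(2,4) RY by blast
  have "y * 1 \<in> (*) y ` \<phi> ` R" using is_subringD(1)[OF phi_image_subring[OF R]] by blast
  then obtain f where f: "f \<in> F R" "\<psi> f = y" unfolding im[symmetric] by auto
  have "\<exists>r\<in>R. \<exists>m'\<in>mod_span R G. m = r * f + q * m'" if m: "m \<in> mod_span R G" for m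
  proof -
    have "\<psi> m \<in> (*) y ` \<phi> ` R" using m FR im by blast
    then obtain r where r: "r \<in> R" "\<psi> m = y * \<phi> r" by blast
    have rf: "r * f \<in> mod_span R G" using mod_span_scale[OF Rr r(1)] f FR by blast
    have d: "m - r * f \<in> mod_span R G" using mod_span_diff[OF Rr m rf] .
    have "\<psi> (m - r * f) + \<psi> (r * f) = \<psi> m"
      using add[of "m - r * f" "r * f"] d rf FL FR by (simp add: subset_iff)
    moreover have "\<psi> (r * f) = y * \<phi> r" using scale[OF subsetD[OF RL r(1)] subsetD[OF FL f(1)]] f(2) by (simp add: mult.commute)
    ultimately have "\<psi> (m - r * f) = 0" using r(2) by simp
    then have "m - r * f \<in> {m \<in> F R. \<psi> m = 0}" using d FR by blast
    then have "m - r * f \<in> {q * m | m. m \<in> F R}" unfolding ker .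
    then obtain m' where "m' \<in> mod_span R G" "m - r * f = q * m'" unfolding FR by blast
    then have "m = r * f + q * m'" by (simp add: algebra_simps)
    then show ?thesis using r(1) \<open>m' \<in> mod_span R G\<close> by (intro bexI[of _ r] bexI[of _ m'])
  qed
  then have "mod_span R G = (*) f ` R"
    using nakayama[OF fiber_local[OF R] fiber_max[OF R] H(3)] f FR by blast
  moreover have "f \<noteq> 0"
  proof
    assume "f = 0"
    then have "0 \<in> F L" using f(1) FL by blast
    from add[OF this this] have "\<psi> 0 = 0" by (metis add.right_neutral add_left_cancel)
    then show False using \<open>f = 0\<close> f(2) y by simp
  qed
  ultimately show ?thesis using f FR by blast
qed

text \<open>The generator \<open>h\<close> at a point of the fiber is a function only after division
  by a generator \<open>e\<close> at the generic point of the fiber. The quotient is a unit of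
  \<open>L\<close>, so it can be restricted by \<open>\<phi>\<close>, and one \<open>e\<close>
  serves all points of the fiber.\<close>

lemma ratio_on_fiber:
  assumes F: "divisorial_sheaf Y F" "restricts_to Y p t \<phi> F E" "E (function_field W) = function_field W"
    and F': "divisorial_sheaf Y F'" "restricts_to Y p t \<phi> F' E'" "E' (function_field W) = function_field W"
  shows "\<exists>e. ratio_generator F F' n L e \<and>
    (\<forall>R\<in>fiber_points Y p t. \<forall>y y'. y \<noteq> 0 \<longrightarrow> y' \<noteq> 0 \<longrightarrow> E (\<phi> ` R) = (*) y ` \<phi> ` R \<longrightarrow> E' (\<phi> ` R) = (*) y' ` \<phi> ` R \<longrightarrow>
      (\<exists>h. ratio_generator F F' n R h \<and> h / e \<in> ring_units L \<and> \<phi> (h / e) = y' / y ^ n))"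
proof -
  have sheaf: "\<exists>a. a \<noteq> 0 \<and> F L = (*) a ` L \<and>
    (\<forall>R\<in>fiber_points Y p t. \<forall>y. y \<noteq> 0 \<longrightarrow> E (\<phi> ` R) = (*) y ` \<phi> ` R \<longrightarrow>
      (\<exists>u\<in>ring_units L. F R = (*) (a * u) ` R \<and> \<phi> u = y))"
    if F: "divisorial_sheaf Y F" and r: "restricts_to Y p t \<phi> F E" and E: "E (function_field W) = function_field W" for F E
  proof -
    from r obtain \<psi> where psi: "\<forall>m\<in>F L. \<forall>n\<in>F L. \<psi> (m + n) = \<psi> m + \<psi> n"
      "\<forall>a\<in>L. \<forall>m\<in>F L. \<psi> (a * m) = \<phi> a * \<psi> m"
      "\<forall>R\<in>fiber_points Y p t. \<psi> ` F R = E (\<phi> ` R) \<and> {m \<in> F R. \<psi> m = 0} = {q * m | m. m \<in> F R}"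
      unfolding restricts_to_def Let_def L_def[symmetric] by (elim exE conjE)
    have add: "\<psi> (m + n) = \<psi> m + \<psi> n" if "m \<in> F L" "n \<in> F L" for m n using psi(1) that by simp
    have scale: "\<psi> (a * m) = \<phi> a * \<psi> m" if "a \<in> L" "m \<in> F L" for a m using psi(2) that by simp
    have im: "\<psi> ` F R = E (\<phi> ` R)" and ker: "{m \<in> F R. \<psi> m = 0} = {q * m | m. m \<in> F R}"
      if "R \<in> fiber_points Y p t" for R using psi(3) that by (auto dest: bspec)
    \<comment> \<open>At the generic point the target stalk is the whole function field, so
      \<open>1\<close> can be prescribed as its generator; this normalizes \<open>a\<close>.\<close>
    have "\<psi> ` F L = (*) 1 ` \<phi> ` L" using im[OF generic] E phi_image by simp
    from restricted_generator[OF F add scale generic this ker[OF generic]]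
    obtain a where a: "a \<noteq> 0" "F L = (*) a ` L" "\<psi> a = 1" by auto
    have aL: "a \<in> F L" unfolding a(2) using Ld(1) by (metis image_eqI mult.right_neutral)
    have "\<exists>u\<in>ring_units L. F R = (*) (a * u) ` R \<and> \<phi> u = y"
      if R: "R \<in> fiber_points Y p t" and y: "y \<noteq> 0" "E (\<phi> ` R) = (*) y ` \<phi> ` R" for R y
    proof -
      have "\<psi> ` F R = (*) y ` \<phi> ` R" using im[OF R] y(2) by simp
      from restricted_generator[OF F add scale R this ker[OF R] y(1)]
      obtain f where f: "f \<noteq> 0" "F R = (*) f ` R" "\<psi> f = y" by auto
      have "f \<in> F R" unfolding f(2) using is_subringD(1)[OF fiber_subring[OF R]] by (metis image_eqI mult.right_neutral)
      then have "f \<in> F L"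
        using divisorial_stalk_mono[OF F fiber_point[OF R] fiber_point[OF generic] fiber_subset[OF R]] by blast
      then obtain u where u: "u \<in> L" "f = a * u" unfolding a(2) by blast
      have "\<phi> u = y" using scale[OF u(1) aL] u(2) a(3) f(3) by (simp add: mult.commute)
      then show ?thesis using L_unit[OF u(1)] y(1) u(2) f(2) by blast
    qed
    then show ?thesis using a(1,2) by blast
  qed
  from sheaf[OF F] obtain a where a: "a \<noteq> 0" "F L = (*) a ` L"
    and au: "\<forall>R\<in>fiber_points Y p t. \<forall>y. y \<noteq> 0 \<longrightarrow> E (\<phi> ` R) = (*) y ` \<phi> ` R \<longrightarrow>
      (\<exists>u\<in>ring_units L. F R = (*) (a * u) ` R \<and> \<phi> u = y)"
    by (elim exE conjE)
  from sheaf[OF F'] obtain b where b: "b \<noteq> 0" "F' L = (*) b ` L"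
    and bu: "\<forall>R\<in>fiber_points Y p t. \<forall>y. y \<noteq> 0 \<longrightarrow> E' (\<phi> ` R) = (*) y ` \<phi> ` R \<longrightarrow>
      (\<exists>u\<in>ring_units L. F' R = (*) (b * u) ` R \<and> \<phi> u = y)"
    by (elim exE conjE)
  have "ratio_generator F F' n L (b / a ^ n)"
    unfolding ratio_generator_def using a b by blast
  moreover have "\<exists>h. ratio_generator F F' n R h \<and> h / (b / a ^ n) \<in> ring_units L \<and> \<phi> (h / (b / a ^ n)) = y' / y ^ n"
    if R: "R \<in> fiber_points Y p t" and y: "y \<noteq> 0" "y' \<noteq> 0" "E (\<phi> ` R) = (*) y ` \<phi> ` R" "E' (\<phi> ` R) = (*) y' ` \<phi> ` R" for R y y'
  proof -
    from au[rule_format, OF R y(1,3)] obtain u where u: "u \<in> ring_units L" "F R = (*) (a * u) ` R" "\<phi> u = y"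
      by (elim bexE conjE)
    from bu[rule_format, OF R y(2,4)] obtain v where v: "v \<in> ring_units L" "F' R = (*) (b * v) ` R" "\<phi> v = y'"
      by (elim bexE conjE)
    have uv: "u \<noteq> 0" "v \<noteq> 0" "u \<in> L" "v \<in> L" using u(1) v(1) by (auto simp: ring_units_def)
    have "ratio_generator F F' n R ((b * v) / (a * u) ^ n)"
      unfolding ratio_generator_def using a(1) b(1) u(2) v(2) uv
      by (intro exI[of _ "a * u"] exI[of _ "b * v"]) auto
    moreover have eq: "((b * v) / (a * u) ^ n) / (b / a ^ n) = v / u ^ n"
      using a(1) b(1) by (simp add: power_mult_distrib)
    have un: "u ^ n \<in> ring_units L" using ring_units_power[OF L_subring u(1)] .
    have "v / u ^ n \<in> ring_units L" using ring_units_divide[OF L_subring v(1) un] .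
    moreover have "\<phi> (v / u ^ n) = y' / y ^ n"
      using phi_divide[OF uv(4) un] phi_power[OF uv(3)] u(3) v(3) by simp
    ultimately show ?thesis using eq by metis
  qed
  ultimately show ?thesis by blast
qed

end

subsection \<open>Trivialization of a fiberwise trivial sheaf\<close>

lemma spec_pointsI: "is_prime_ideal A q \<Longrightarrow> localization A q \<in> spec_points A"
  unfolding spec_points_def by blast

lemma localization_antimono: "q \<subseteq> r \<Longrightarrow> localization A r \<subseteq> localization A q"
  unfolding localization_def by blast

text \<open>This is how separatedness enters: a point of the ring generated by two charts dominates
  one point of each chart, so these two points are equal.\<close>

lemma dominates_contraction:
  assumes "is_subring A" "is_subring B" "A \<subseteq> B" "is_prime_ideal B q"
  shows "dominates (localization B q) (localization A (q \<inter> A))"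
proof -
  interpret B: prime_localization B q using assms(2,4) by unfold_locales
  interpret A: prime_localization A "q \<inter> A"
    using assms(1) is_prime_ideal_contract[OF assms(1,3,4)] by unfold_locales
  have sub: "localization A (q \<inter> A) \<subseteq> localization B q"
    unfolding localization_def using assms(3) by blast
  moreover have "max_ideal (localization B q) \<inter> localization A (q \<inter> A) = max_ideal (localization A (q \<inter> A))"
  proof
    show "max_ideal (localization A (q \<inter> A)) \<subseteq> max_ideal (localization B q) \<inter> localization A (q \<inter> A)"
    proof
      fix x assume x: "x \<in> max_ideal (localization A (q \<inter> A))"
      then obtain a s where "x = a / s" "a \<in> q" "s \<in> A" "s \<notin> q" unfolding A.max_ideal_eq by blast
      then have "x \<in> max_ideal (localization B q)" unfolding B.max_ideal_eq using assms(3) by blast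
      then show "x \<in> max_ideal (localization B q) \<inter> localization A (q \<inter> A)" using x by (simp add: max_ideal_def)
    qed
    show "max_ideal (localization B q) \<inter> localization A (q \<inter> A) \<subseteq> max_ideal (localization A (q \<inter> A))"
    proof
      fix x assume x: "x \<in> max_ideal (localization B q) \<inter> localization A (q \<inter> A)"
      then have "x \<notin> ring_units (localization A (q \<inter> A))" using ring_units_mono[OF sub] by (auto simp: max_ideal_def)
      then show "x \<in> max_ideal (localization A (q \<inter> A))" using x by (simp add: max_ideal_def)
    qed
  qed
  ultimately show ?thesis by (simp add: dominates_def)
qed

lemma common_denominator:
  assumes "prime_localization A q" "finite H" "H \<subseteq> localization A q"
  shows "\<exists>a\<in>A - q. \<forall>x\<in>H. a * x \<in> A"
proof -
  interpret prime_localization A q by fact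
  show ?thesis using assms(2,3)
  proof (induction H rule: finite_induct)
    case empty
    then show ?case using denominators(1) by blast
  next
    case (insert x H)
    then obtain a where a: "a \<in> A - q" "\<forall>x\<in>H. a * x \<in> A" by blast
    have "x \<in> localization A q" using insert.prems by blast
    then obtain b s where x: "b \<in> A" "s \<in> A" "s \<notin> q" "x = b / s" by (rule in_localizationE)
    have s0: "s \<noteq> 0" using x denominators(3) by blast
    have as: "a * s \<in> A - q" using a x denominators(2) by blast
    have "(a * s) * y \<in> A" if y: "y \<in> insert x H" for y
    proof (cases "y = x")
      case True
      then have "(a * s) * y = a * b" using x s0 by simp
      moreover have "a * b \<in> A" using A(3)[of a b] a(1) x(1) by blast
      ultimately show ?thesis by (rule ssubst)
    next
      case False
      then have "a * y \<in> A" using a y by blast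
      then have "s * (a * y) \<in> A" by (rule A(3)[OF x(2)])
      then show ?thesis by (simp add: ac_simps)
    qed
    then show ?case using as by blast
  qed
qed

section \<open>Fibers met by the closure of a point over the generic point of the line\<close>

context charted
begin

lemma point_of_chart: "A \<in> \<A> \<Longrightarrow> R \<in> spec_points A \<Longrightarrow> R \<in> points Y"
  using points_eq by blast

lemma regular_in_chart:
  assumes "A \<in> \<A>" "\<And>R. R \<in> points Y \<Longrightarrow> x \<in> R"
  shows "x \<in> A"
  by (rule in_base_if_in_all_localizations[OF chart_subring[OF assms(1)]])
     (rule assms(2)[OF point_of_chart[OF assms(1) spec_pointsI]])

text \<open>If the closure of \<open>Q\<close> misses the fiber over \<open>t\<close> inside the
  chart, \<open>p - t\<close> has an inverse \<open>a t\<close> modulo the prime \<open>q\<close> of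
  \<open>Q\<close>. Uncountably many such elements of the countably spanned algebra \<open>A\<close>
  are linearly dependent, and clearing denominators in the relation produces a nonzero polynomial in
  \<open>p\<close> inside \<open>q\<close>, so that \<open>Q\<close> lies over a closed
  point.\<close>

lemma horizontal_specialization:
  assumes A: "A \<in> \<A>" and p: "p \<in> A" and Q: "Q \<in> spec_points A" and hor: "\<And>c. p - scalar Y c \<notin> max_ideal Q"
  shows "countable {t. \<not> (\<exists>R. R \<in> spec_points A \<and> R \<in> fiber_points Y p t \<and> R \<subseteq> Q)}" (is "countable ?T")
proof (rule ccontr)
  assume T: "uncountable ?T"
  note Ar = chart_subring[OF A]
  note Ad = is_subringD[OF Ar]
  define q where "q = max_ideal Q \<inter> A"
  have q: "is_prime_ideal A q" "Q = localization A q"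
    unfolding q_def using spec_points_properties(3,4)[OF Ar Q] by auto
  note P = is_prime_idealD[OF q(1)]
  note I = is_idealD[OF P(1)]
  have pt: "p - scalar Y t \<in> A" for t using Ad(2)[OF p scalar_in_chart[OF A]] .
  have ex: "\<exists>a z. a \<in> A \<and> z \<in> q \<and> 1 = z + a * (p - scalar Y t)" if t: "t \<in> ?T" for t
  proof (rule ccontr)
    assume no: "\<not> ?thesis"
    note ad = is_ideal_adjoin[OF Ar P(1) pt[of t]]
    have "1 \<notin> ideal_adjoin A q (p - scalar Y t)" using no unfolding ideal_adjoin_def by blast
    then obtain r where r: "is_prime_ideal A r" "ideal_adjoin A q (p - scalar Y t) \<subseteq> r"
      using exists_prime_ideal[OF Ar ad(1), of "{1}"] by auto
    interpret r: prime_localization A r using Ar r(1) by unfold_locales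
    have "q \<subseteq> r" "p - scalar Y t \<in> r" using ad(2,3) r(2) by auto
    then have "localization A r \<subseteq> Q" using q(2) localization_antimono by metis
    moreover have "localization A r \<in> spec_points A" using r(1) by (rule spec_pointsI)
    moreover have "p - scalar Y t \<in> max_ideal (localization A r)" using \<open>p - scalar Y t \<in> r\<close> r.max_ideal_Int by auto
    ultimately have "localization A r \<in> spec_points A \<and> localization A r \<in> fiber_points Y p t \<and> localization A r \<subseteq> Q"
      using point_of_chart[OF A] unfolding fiber_points_def by simp
    then show False using t by blast
  qed
  define a where "a t = (SOME a. a \<in> A \<and> (\<exists>z. z \<in> q \<and> 1 = z + a * (p - scalar Y t)))" for t
  have a: "a t \<in> A \<and> (\<exists>z. z \<in> q \<and> 1 = z + a t * (p - scalar Y t))" if "t \<in> ?T" for t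
    unfolding a_def by (rule someI_ex) (use ex[OF that] in blast)
  obtain G where G: "finite G" "A = generated_algebra (scalar Y) G" using chart_generated[OF A] by blast
  have cs: "countably_spanned A" unfolding G(2) using countably_spanned_generated[OF G(1)] .
  have "\<exists>F l. finite F \<and> F \<noteq> {} \<and> F \<subseteq> ?T \<and> (\<forall>t\<in>F. l t \<noteq> 0) \<and> (\<forall>j\<in>{()}. (\<Sum>t\<in>F. scalar Y (l t) * a t) = 0)"
    by (rule uncountable_dependence[OF T, where V = "\<lambda>_. A" and f = "\<lambda>_. a"]) (use cs a in auto)
  then obtain F l where F: "finite F" "F \<noteq> {}" "F \<subseteq> ?T" "\<forall>t\<in>F. l t \<noteq> 0" "(\<Sum>t\<in>F. scalar Y (l t) * a t) = 0"
    by (elim exE conjE) simp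
  define D where "D t = (\<Prod>s\<in>F-{t}. p - scalar Y s)" for t
  have D: "(\<Prod>s\<in>F. p - scalar Y s) = (p - scalar Y t) * D t" if "t \<in> F" for t
    unfolding D_def using prod.remove[OF F(1) that] .
  have DA: "D t \<in> A" for t unfolding D_def using pt by (intro is_subring_prod[OF Ar])
  have "0 = (\<Sum>t\<in>F. scalar Y (l t) * a t) * (\<Prod>s\<in>F. p - scalar Y s)" using F(5) by simp
  also have "\<dots> = (\<Sum>t\<in>F. scalar Y (l t) * (a t * (p - scalar Y t)) * D t)"
    unfolding sum_distrib_right by (intro sum.cong refl) (simp add: D ac_simps)
  finally have zero: "(\<Sum>t\<in>F. scalar Y (l t) * (a t * (p - scalar Y t)) * D t) = 0" ..
  \<comment> \<open>The relation \<open>zero\<close> can be subtracted freely. Afterwards each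
    summand contains a factor \<open>1 - a t * (p - t)\<close>, which lies in
    \<open>q\<close>.\<close>
  have "ev p (node_poly F l) = (\<Sum>t\<in>F. scalar Y (l t) * D t)"
    unfolding ev_node_poly D_def ..
  also have "\<dots> = \<dots> - (\<Sum>t\<in>F. scalar Y (l t) * (a t * (p - scalar Y t)) * D t)"
    unfolding zero by simp
  also have "\<dots> = (\<Sum>t\<in>F. (scalar Y (l t) * D t) * (1 - a t * (p - scalar Y t)))"
    unfolding sum_subtractf[symmetric] by (intro sum.cong refl) (simp add: algebra_simps)
  also have "\<dots> \<in> q"
  proof (rule is_ideal_sum[OF P(1)])
    fix t assume "t \<in> F"
    then obtain z where z: "z \<in> q" "1 = z + a t * (p - scalar Y t)" using a F(3) by blast
    then have "1 - a t * (p - scalar Y t) = z" by (simp add: algebra_simps)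
    then show "(scalar Y (l t) * D t) * (1 - a t * (p - scalar Y t)) \<in> q"
      using I(4)[OF Ad(3)[OF scalar_in_chart[OF A] DA] z(1)] by simp
  qed
  finally have "ev p (node_poly F l) \<in> q" .
  then obtain c where "p - scalar Y c \<in> q"
    using ev_in_prime_ideal[OF Ar _ p q(1) node_poly_nonzero[OF F(1,2,4)]] scalar_in_chart[OF A] by blast
  then show False using hor[of c] unfolding q_def by blast
qed

end

text \<open>Named after the seesaw principle: a sheaf that is trivial on the fibers is trivial up to
  a contribution of the base. The element \<open>e t\<close> is the reference generator at the
  generic point of the fiber, and \<open>trivial\<close> says that the local generators can be
  chosen so that, relative to \<open>e t\<close>, they all restrict to \<open>1\<close>.\<close>

locale seesaw = charted Y \<A> for Y :: "'b::field model" and \<A> +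
  fixes p :: 'b and F F' :: "'b set \<Rightarrow> 'b set" and n :: nat
    and X :: "'k::field model" and \<Phi> :: "complex \<Rightarrow> 'b \<Rightarrow> 'k" and e :: "complex \<Rightarrow> 'b"
  assumes regular: "R \<in> points Y \<Longrightarrow> p \<in> R"
    and sheaves: "divisorial_sheaf Y F" "divisorial_sheaf Y F'"
    and fib: "t \<noteq> 0 \<Longrightarrow> fiber Y \<A> p t X (\<Phi> t)"
    and trivial: "t \<noteq> 0 \<Longrightarrow> R \<in> fiber_points Y p t \<Longrightarrow>
      \<exists>h. ratio_generator F F' n R h \<and> h / e t \<in> ring_units (\<Union>(fiber_points Y p t)) \<and> \<Phi> t (h / e t) = 1"
    and constants: "(\<And>R. R \<in> points X \<Longrightarrow> x \<in> R) \<Longrightarrow> x \<in> range (scalar X)"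
begin

abbreviation "gen \<equiv> ratio_generator F F' n"
abbreviation "pt t \<equiv> p - scalar Y t"
abbreviation "L t \<equiv> \<Union>(fiber_points Y p t)"

lemma fiber_generic: "t \<noteq> 0 \<Longrightarrow> L t \<in> fiber_points Y p t"
  using fiber.generic[OF fib] fiber.L_def[OF fib] by metis

lemma p_in_chart: "A \<in> \<A> \<Longrightarrow> p \<in> A"
  using regular_in_chart regular by blast

lemma pt_in_point: "R \<in> points Y \<Longrightarrow> pt t \<in> R"
  using regular scalar_in_point is_subringD(2)[OF point_subring] by blast

lemma scalar_nonunit:
  assumes "R \<in> points Y" "scalar Y c \<in> max_ideal R"
  shows "c = 0"
proof (rule ccontr)
  assume "c \<noteq> 0"
  then have "scalar Y c \<in> ring_units R"
    unfolding ring_units_def using scalar_in_point[OF assms(1)] by (simp add: sc_eq_0_iff flip: sc_inverse)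
  then show False using assms(2) by (simp add: max_ideal_def)
qed

lemma pt_in_max_ideal_unique:
  assumes "R \<in> points Y" "pt s \<in> max_ideal R" "pt t \<in> max_ideal R"
  shows "s = t"
proof -
  have "pt s - pt t \<in> max_ideal R"
    using is_ideal_diff[OF point_subring[OF assms(1)] local_subringD(2)[OF point_local[OF assms(1)]] assms(2,3)] .
  then have "scalar Y (t - s) \<in> max_ideal R" by (simp add: sc_diff)
  then show ?thesis using scalar_nonunit[OF assms(1)] by fastforce
qed

lemma pt_nonzero: "pt t \<noteq> 0"
proof
  assume *: "pt t = 0"
  \<comment> \<open>The fiber over \<open>u\<close> has a generic point because \<open>u\<close> is
    nonzero; that point cannot lie over \<open>t\<close> as well.\<close>
  define u :: complex where "u = (if t = 1 then 2 else 1)"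
  have u: "u \<noteq> 0" "u \<noteq> t" by (auto simp: u_def)
  have R: "L u \<in> points Y" "pt u \<in> max_ideal (L u)" using fiber_generic[OF u(1)] by (auto simp: fiber_points_def)
  have "pt t \<in> max_ideal (L u)" using * is_idealD(2)[OF local_subringD(2)[OF point_local[OF R(1)]]] by simp
  then show False using pt_in_max_ideal_unique[OF R(1) R(2)] u(2) by blast
qed

lemma inv_mono:
  assumes "R \<in> points Y" "S \<in> points Y" "R \<subseteq> S" "gen R h"
  shows "gen S h"
proof -
  from ratio_generator_neighbourhood[OF sheaves assms(1,4)]
  obtain H where H: "finite H" "H \<subseteq> R" "\<forall>S\<in>points Y. H \<subseteq> S \<longrightarrow> gen S h" by (elim exE conjE)
  then show ?thesis using assms(2,3) by (metis subset_trans)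
qed

text \<open>The condition \<open>inverse a \<in> S\<close> describes the principal open set of
  \<open>a\<close> in the chart; a single \<open>h\<close> has to generate on all of it.\<close>

definition good :: "'b set \<Rightarrow> 'b set" where
  "good A = {a \<in> A. a \<noteq> 0 \<and> (\<exists>h. \<forall>S\<in>spec_points A. inverse a \<in> S \<longrightarrow> gen S h)}"

text \<open>A local generator is valid where a finite set \<open>H\<close> of functions is regular.
  A common denominator \<open>a\<close> of \<open>H\<close> that is a unit at \<open>R\<close> makes
  \<open>H\<close> regular on the principal open set of \<open>a\<close>.\<close>

lemma good_near_fiber:
  assumes A: "A \<in> \<A>" and R: "R \<in> spec_points A" "R \<in> fiber_points Y p t" "t \<noteq> 0"
  shows "\<exists>a\<in>good A. a \<notin> max_ideal R"
proof -
  note Ar = chart_subring[OF A]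
  have RY: "R \<in> points Y" using R(2) by (simp add: fiber_points_def)
  obtain h where h: "gen R h" using trivial[OF R(3,2)] by blast
  from ratio_generator_neighbourhood[OF sheaves RY h]
  obtain H where H: "finite H" "H \<subseteq> R" "\<forall>S\<in>points Y. H \<subseteq> S \<longrightarrow> gen S h" by (elim exE conjE)
  obtain q where q: "prime_localization A q" "R = localization A q" using spec_pointsE[OF Ar R(1)] by blast
  interpret q: prime_localization A q by fact
  obtain a where a: "a \<in> A - q" "\<forall>x\<in>H. a * x \<in> A" using common_denominator[OF q(1) H(1)] H(2) q(2) by blast
  have a0: "a \<noteq> 0" using q.denominators(3)[OF a(1)] .
  have "gen S h" if S: "S \<in> spec_points A" "inverse a \<in> S" for S
  proof -
    have SY: "S \<in> points Y" using point_of_chart[OF A S(1)] .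
    have "x \<in> S" if "x \<in> H" for x
    proof -
      have "a * x \<in> S" using a(2) that spec_points_properties(2)[OF Ar S(1)] by blast
      then have "inverse a * (a * x) \<in> S" by (rule is_subringD(3)[OF point_subring[OF SY] S(2)])
      then show ?thesis using a0 by (simp flip: mult.assoc)
    qed
    then show ?thesis using H(3) SY by blast
  qed
  then have "a \<in> good A" using a(1) a0 by (auto simp: good_def)
  moreover have "a \<notin> max_ideal R" using q.max_ideal_Int a(1) q(2) by blast
  ultimately show ?thesis by blast
qed

text \<open>Otherwise some point \<open>Q\<close> with \<open>p\<close> invertible would lie in the
  zero set of all good functions. Such a point specializes to, or is, a point \<open>R\<close> over
  some \<open>t \<noteq> 0\<close>. A good function that is a unit at \<open>R\<close> is a unit at
  \<open>Q\<close> too, a contradiction.\<close>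

lemma good_generate_power:
  assumes A: "A \<in> \<A>"
  shows "\<exists>k. p ^ k \<in> mod_span A (good A)"
proof (rule ccontr)
  assume no: "\<not> ?thesis"
  note Ar = chart_subring[OF A]
  let ?J = "mod_span A (good A)"
  have gA: "good A \<subseteq> A" by (auto simp: good_def)
  have "?J \<subseteq> (*) 1 ` A" using gA by (intro mod_span_subset Ar) auto
  then have J: "is_ideal A ?J"
    unfolding is_ideal_def using mod_span_zero mod_span_add[OF Ar] mod_span_scale[OF Ar] by auto
  have "p ^ k \<notin> ?J" for k using no by auto
  from exists_prime_ideal_avoiding_powers[OF Ar J this]
  obtain q where q: "is_prime_ideal A q" "?J \<subseteq> q" and pq: "p \<notin> q" by (elim exE conjE)
  interpret q: prime_localization A q using Ar q(1) by unfold_locales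
  define Q where "Q = localization A q"
  have Q: "Q \<in> spec_points A" "Q \<in> points Y"
    unfolding Q_def using spec_pointsI[OF q(1)] point_of_chart[OF A] by auto
  have pQ: "p \<notin> max_ideal Q" using pq q.max_ideal_Int p_in_chart[OF A] unfolding Q_def by blast
  \<comment> \<open>A point over a closed point \<open>c\<close> is its own specialization, with
    \<open>c\<close> nonzero because \<open>p\<close> is not in \<open>q\<close>. Any other point
    specializes to all but countably many fibers, so one over a nonzero \<open>t\<close> can be
    chosen.\<close>
  have "\<exists>t R. t \<noteq> 0 \<and> R \<in> spec_points A \<and> R \<in> fiber_points Y p t \<and> R \<subseteq> Q"
  proof (cases "\<exists>c. pt c \<in> max_ideal Q")
    case True
    then obtain c where c: "pt c \<in> max_ideal Q" by blast
    then have "c \<noteq> 0" using pQ by (auto simp: sc_0)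
    moreover have "Q \<in> fiber_points Y p c" using Q(2) c by (simp add: fiber_points_def)
    ultimately show ?thesis using Q(1) by (intro exI[of _ c] exI[of _ Q]) simp
  next
    case False
    have "countable {t. \<not> (\<exists>R. R \<in> spec_points A \<and> R \<in> fiber_points Y p t \<and> R \<subseteq> Q)}"
      using False by (intro horizontal_specialization[OF A p_in_chart[OF A] Q(1)]) blast
    then have "countable (insert 0 {t. \<not> (\<exists>R. R \<in> spec_points A \<and> R \<in> fiber_points Y p t \<and> R \<subseteq> Q)})" by simp
    then have "insert 0 {t. \<not> (\<exists>R. R \<in> spec_points A \<and> R \<in> fiber_points Y p t \<and> R \<subseteq> Q)} \<noteq> UNIV"
      using uncountable_UNIV_complex by metis
    then obtain t where "t \<noteq> 0" "\<exists>R. R \<in> spec_points A \<and> R \<in> fiber_points Y p t \<and> R \<subseteq> Q" by auto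
    then show ?thesis by (elim exE) (intro exI conjI, auto)
  qed
  then obtain t R where R: "t \<noteq> 0" "R \<in> spec_points A" "R \<in> fiber_points Y p t" "R \<subseteq> Q" by (elim exE conjE)
  obtain a where a: "a \<in> good A" "a \<notin> max_ideal R" using good_near_fiber[OF A R(2,3,1)] by blast
  have "a \<in> q" using mod_span_base[OF Ar a(1)] q(2) by blast
  then have "a \<in> max_ideal Q" using q.max_ideal_Int unfolding Q_def by blast
  moreover have "a \<in> R" using a(1) spec_points_properties(2)[OF Ar R(2)] gA by blast
  then have "a \<in> ring_units R" using a(2) by (simp add: max_ideal_def)
  then have "a \<in> ring_units Q" using ring_units_mono[OF R(4)] by blast
  ultimately show False by (simp add: max_ideal_def)
qed

text \<open>A pair consists of the coordinate ring of an affine open set and one generator that is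
  valid at all its points. The finite generation is kept because the linear algebra requires
  countably spanned rings.\<close>

definition trivializing :: "'b set \<times> 'b \<Rightarrow> bool" where
  "trivializing c \<longleftrightarrow> (\<exists>G. finite G \<and> fst c = generated_algebra (scalar Y) G) \<and> spec_points (fst c) \<subseteq> points Y
     \<and> (\<forall>S\<in>spec_points (fst c). gen S (snd c))"

text \<open>The open set is the principal open set of \<open>a\<close>, with coordinate ring
  obtained by adjoining \<open>inverse a\<close>.\<close>

lemma trivializing_localization:
  assumes A: "A \<in> \<A>" and a: "a \<in> good A"
  shows "\<exists>c. trivializing c \<and> (\<forall>R\<in>spec_points A. a \<notin> max_ideal R \<longrightarrow> R \<in> spec_points (fst c))"
proof -
  note Ar = chart_subring[OF A]
  note Ad = is_subringD[OF Ar]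
  obtain h where h: "a \<in> A" "a \<noteq> 0" "\<forall>S\<in>spec_points A. inverse a \<in> S \<longrightarrow> gen S h"
    using a unfolding good_def by blast
  obtain G where G: "finite G" "A = generated_algebra (scalar Y) G" using chart_generated[OF A] by blast
  define B where "B = generated_algebra (scalar Y) (insert (inverse a) G)"
  have Br: "is_subring B" unfolding B_def by (rule is_subring_generated)
  have AB: "A \<subseteq> B" unfolding G(2) B_def by (rule generated_mono) blast
  have aB: "inverse a \<in> B" using generators_subset[of "insert (inverse a) G"] unfolding B_def by blast
  have den: "\<exists>k. a ^ k * b \<in> A" if "b \<in> B" for b
    using that unfolding B_def
  proof (induction rule: generated_induct)
    case (generator x)
    then show ?case
    proof
      assume "x = inverse a"
      then have "a ^ 1 * x \<in> A" using h Ad by simp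
      then show ?thesis ..
    next
      assume "x \<in> G"
      then have "a ^ 0 * x \<in> A" using generators_subset G(2) by auto
      then show ?thesis ..
    qed
  next
    case (scalar c)
    have "a ^ 0 * scalar Y c \<in> A" using scalar_in_chart[OF A] by simp
    then show ?case ..
  next
    case (add x y)
    then obtain k m where "a ^ k * x \<in> A" "a ^ m * y \<in> A" by blast
    then have "a ^ m * (a ^ k * x) + a ^ k * (a ^ m * y) \<in> A" using Ad(3,6,7) h(1) by metis
    then have "a ^ (k + m) * (x + y) \<in> A" by (simp add: power_add algebra_simps)
    then show ?case ..
  next
    case (mult x y)
    then obtain k m where "a ^ k * x \<in> A" "a ^ m * y \<in> A" by blast
    then have "(a ^ k * x) * (a ^ m * y) \<in> A" by (rule Ad(3))
    then have "a ^ (k + m) * (x * y) \<in> A" by (simp add: power_add algebra_simps)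
    then show ?case ..
  qed
  have sub: "S \<in> spec_points A" if "S \<in> spec_points B" for S
  proof (rule spec_points_mono_inverse[OF Ar Br AB that])
    fix b assume "b \<in> B"
    then obtain k where k: "a ^ k * b \<in> A" using den by blast
    have "inverse (a ^ k) \<in> B" using is_subringD(7)[OF Br aB, of k] by (simp add: power_inverse)
    then show "\<exists>s\<in>A. inverse s \<in> B \<and> s \<noteq> 0 \<and> s * b \<in> A"
      using k h(1,2) Ad(7) by (intro bexI[of _ "a ^ k"]) auto
  qed
  have "trivializing (B, h)"
    unfolding trivializing_def
  proof (intro conjI ballI)
    show "\<exists>Ga. finite Ga \<and> fst (B, h) = generated_algebra (scalar Y) Ga"
      using G(1) unfolding B_def by (intro exI[of _ "insert (inverse a) G"]) simp
    show "spec_points (fst (B, h)) \<subseteq> points Y" using sub point_of_chart[OF A] by auto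
    fix S assume "S \<in> spec_points (fst (B, h))"
    then have S: "S \<in> spec_points B" by simp
    then have "inverse a \<in> S" using aB spec_points_properties(2)[OF Br] by blast
    then show "gen S (snd (B, h))" using h(3) sub[OF S] by simp
  qed
  moreover have "R \<in> spec_points B" if R: "R \<in> spec_points A" "a \<notin> max_ideal R" for R
  proof (rule spec_points_intermediate[OF Ar R(1) Br AB])
    have AR: "A \<subseteq> R" using spec_points_properties(2)[OF Ar R(1)] .
    then have "inverse a \<in> R" using R(2) h(1) by (auto simp: max_ideal_def ring_units_def)
    moreover have "subalgebra (scalar Y) R"
      unfolding subalgebra_def using scalar_in_point[OF point_of_chart[OF A R(1)]]
        is_subringD(3,6)[OF point_subring[OF point_of_chart[OF A R(1)]]] by blast
    moreover have "G \<subseteq> A" unfolding G(2) by (rule generators_subset)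
    ultimately show "B \<subseteq> R" unfolding B_def using AR by (intro generated_subset) auto
  qed
  ultimately show ?thesis by (intro exI[of _ "(B, h)"]) simp
qed

text \<open>In each chart some power of \<open>p\<close> is a finite combination of good functions.
  At a point over \<open>t \<noteq> 0\<close> the function \<open>p\<close> is a unit, so one of
  these good functions is a unit there. Finiteness of the cover is what bounds the number of
  conditions in the gluing.\<close>

lemma finite_trivializing_cover:
  "\<exists>\<C>. finite \<C> \<and> (\<forall>c\<in>\<C>. trivializing c) \<and>
    (\<forall>t R. t \<noteq> 0 \<longrightarrow> R \<in> fiber_points Y p t \<longrightarrow> (\<exists>c\<in>\<C>. R \<in> spec_points (fst c)))"
proof -
  have one: "\<exists>\<C>. finite \<C> \<and> (\<forall>c\<in>\<C>. trivializing c) \<and>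
    (\<forall>t R. t \<noteq> 0 \<longrightarrow> R \<in> spec_points A \<longrightarrow> R \<in> fiber_points Y p t \<longrightarrow> (\<exists>c\<in>\<C>. R \<in> spec_points (fst c)))"
    if A: "A \<in> \<A>" for A
  proof -
    note Ar = chart_subring[OF A]
    obtain k where "p ^ k \<in> mod_span A (good A)" using good_generate_power[OF A] by blast
    then obtain H b where H: "finite H" "H \<subseteq> good A" "\<forall>a\<in>H. b a \<in> A" "p ^ k = (\<Sum>a\<in>H. b a * a)" by (rule mod_spanE)
    have "\<forall>a\<in>H. \<exists>c. trivializing c \<and> (\<forall>R\<in>spec_points A. a \<notin> max_ideal R \<longrightarrow> R \<in> spec_points (fst c))"
      using trivializing_localization[OF A] H(2) by blast
    from bchoice[OF this] obtain c where c: "\<forall>a\<in>H. trivializing (c a) \<and> (\<forall>R\<in>spec_points A. a \<notin> max_ideal R \<longrightarrow> R \<in> spec_points (fst (c a)))" ..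
    have "\<exists>d\<in>c ` H. R \<in> spec_points (fst d)" if R: "t \<noteq> 0" "R \<in> spec_points A" "R \<in> fiber_points Y p t" for t R
    proof -
      have RY: "R \<in> points Y" and m: "pt t \<in> max_ideal R" using R(3) by (auto simp: fiber_points_def)
      note pr = local_subringD(3)[OF point_local[OF RY]]
      note P = is_prime_idealD[OF pr]
      have "\<exists>a\<in>H. a \<notin> max_ideal R"
      proof (rule ccontr)
        assume "\<not> ?thesis"
        then have "b a * a \<in> max_ideal R" if "a \<in> H" for a
          using that H(3) is_idealD(4)[OF P(1), of "b a" a] spec_points_properties(2)[OF Ar R(2)] by blast
        then have "p ^ k \<in> max_ideal R" unfolding H(4) by (rule is_ideal_sum[OF P(1)])
        then have "p \<in> max_ideal R" by (rule prime_ideal_power[OF point_subring[OF RY] pr regular[OF RY]])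
        then have "pt 0 \<in> max_ideal R" by (simp add: sc_0)
        from pt_in_max_ideal_unique[OF RY this m] show False using R(1) by simp
      qed
      then obtain a where a: "a \<in> H" "a \<notin> max_ideal R" ..
      then have "R \<in> spec_points (fst (c a))" using c R(2) by simp
      then show ?thesis using a(1) by (intro bexI[of _ "c a"]) simp_all
    qed
    then show ?thesis using H(1) c by (intro exI[of _ "c ` H"]) auto
  qed
  then have "\<forall>A\<in>\<A>. \<exists>\<C>. finite \<C> \<and> (\<forall>c\<in>\<C>. trivializing c) \<and>
    (\<forall>t R. t \<noteq> 0 \<longrightarrow> R \<in> spec_points A \<longrightarrow> R \<in> fiber_points Y p t \<longrightarrow> (\<exists>c\<in>\<C>. R \<in> spec_points (fst c)))" ..
  from bchoice[OF this] obtain \<C> where C: "\<forall>A\<in>\<A>. finite (\<C> A) \<and> (\<forall>c\<in>\<C> A. trivializing c) \<and>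
    (\<forall>t R. t \<noteq> 0 \<longrightarrow> R \<in> spec_points A \<longrightarrow> R \<in> fiber_points Y p t \<longrightarrow> (\<exists>c\<in>\<C> A. R \<in> spec_points (fst c)))" ..
  show ?thesis
  proof (intro exI[of _ "\<Union>(\<C> ` \<A>)"] conjI allI impI)
    show "finite (\<Union>(\<C> ` \<A>))" using C finite_charts by simp
    show "\<forall>c\<in>\<Union>(\<C> ` \<A>). trivializing c" using C by simp
    fix t R assume t: "t \<noteq> 0" "R \<in> fiber_points Y p t"
    then have "R \<in> points Y" by (simp add: fiber_points_def)
    then obtain A where A: "A \<in> \<A>" "R \<in> spec_points A" using points_eq by auto
    from C[rule_format, OF A(1), THEN conjunct2, THEN conjunct2, rule_format, OF t(1) A(2) t(2)]
    obtain c where "c \<in> \<C> A" "R \<in> spec_points (fst c)" by (rule bexE)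
    then show "\<exists>c\<in>\<Union>(\<C> ` \<A>). R \<in> spec_points (fst c)" using A(1) by (intro bexI[of _ c] UN_I)
  qed
qed

lemma trivializing_ring: "trivializing c \<Longrightarrow> is_subring (fst c)"
  unfolding trivializing_def using is_subring_generated by auto

lemma trivializing_point: "trivializing c \<Longrightarrow> R \<in> spec_points (fst c) \<Longrightarrow> R \<in> points Y"
  and trivializing_gen: "trivializing c \<Longrightarrow> R \<in> spec_points (fst c) \<Longrightarrow> gen R (snd c)"
  unfolding trivializing_def by auto

lemma trivializing_pt: "trivializing c \<Longrightarrow> pt t \<in> fst c"
  by (rule in_base_if_in_all_localizations[OF trivializing_ring])
     (auto intro: pt_in_point trivializing_point spec_pointsI)

lemma trivializing_nonzero:
  assumes "trivializing c" "R \<in> spec_points (fst c)"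
  shows "snd c \<noteq> 0"
  using ratio_generator_nonzero trivializing_gen[OF assms] .

text \<open>By \<open>trivial\<close> there is a generator whose quotient by \<open>e t\<close>
  restricts to \<open>1\<close>, and any other generator at \<open>R\<close> differs from it by a
  unit of \<open>R\<close>.\<close>

lemma generator_on_fiber:
  assumes t: "t \<noteq> 0" and R: "R \<in> fiber_points Y p t" and h: "gen R h"
  shows "h / e t \<in> ring_units (L t)" "\<Phi> t (h / e t) \<in> ring_units (\<Phi> t ` R)"
proof -
  interpret f: fiber Y \<A> p t X "\<Phi> t" using fib[OF t] .
  have Rr: "is_subring R" using f.fiber_subring[OF R] .
  obtain k where k: "gen R k" "k / e t \<in> ring_units (L t)" "\<Phi> t (k / e t) = 1" using trivial[OF t R] by blast
  have k': "k / e t \<in> ring_units f.L" using k(2) f.L_def by simp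
  have hk: "h / k \<in> ring_units R" using ratio_generator_unique[OF Rr h k(1)] .
  then have hkL: "h / k \<in> ring_units f.L" using ring_units_mono[OF f.fiber_subset[OF R]] by blast
  have eq: "h / e t = (h / k) * (k / e t)" using ratio_generator_nonzero[OF k(1)] by simp
  show "h / e t \<in> ring_units (L t)" unfolding eq using ring_units_mult[OF f.L_subring hkL k'] f.L_def by simp
  have "\<Phi> t (h / e t) = \<Phi> t (h / k)"
    unfolding eq using f.phi_mult[of "h / k" "k / e t"] hkL k' k(3) by (simp add: ring_units_def)
  then show "\<Phi> t (h / e t) \<in> ring_units (\<Phi> t ` R)"
    using f.unit_iff[OF R, of "h / k"] hk ring_units_iff[OF Rr] by metis
qed

text \<open>With \<open>w\<close> the restriction of the chart generator, \<open>b\<close> has to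
  restrict to the inverse of \<open>w\<close>. This inverse is regular at all points of the fiber in
  the chart; since the chart is affine, it is the restriction of an element of the coordinate
  ring.\<close>

lemma local_lift:
  assumes t: "t \<noteq> 0" and c: "trivializing c"
  shows "\<exists>b\<in>fst c. \<forall>R. R \<in> spec_points (fst c) \<longrightarrow> R \<in> fiber_points Y p t \<longrightarrow> \<Phi> t (snd c * b / e t) = 1"
proof (cases "\<exists>R. R \<in> spec_points (fst c) \<and> R \<in> fiber_points Y p t")
  case False
  \<comment> \<open>The chart misses the fiber, so any element will do.\<close>
  then show ?thesis using is_subringD(4)[OF trivializing_ring[OF c]] by (intro bexI[of _ 0]) auto
next
  case True
  interpret f: fiber Y \<A> p t X "\<Phi> t" using fib[OF t] .
  obtain B h where ch: "c = (B, h)" by (cases c)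
  have Br: "is_subring B" using trivializing_ring[OF c] ch by simp
  note Bd = is_subringD[OF Br]
  define w where "w = \<Phi> t (h / e t)"
  obtain R0 where R0: "R0 \<in> spec_points B" "R0 \<in> fiber_points Y p t" using True ch by auto
  have BL: "B \<subseteq> f.L" using spec_points_properties(2)[OF Br R0(1)] f.fiber_subset[OF R0(2)] by blast
  have wR: "w \<in> ring_units (\<Phi> t ` R)" if "R \<in> spec_points B" "R \<in> fiber_points Y p t" for R
    unfolding w_def using generator_on_fiber(2)[OF t that(2)] trivializing_gen[OF c] that(1) ch by simp
  have w0: "w \<noteq> 0" using wR[OF R0] by (simp add: ring_units_def)
  have hL: "h / e t \<in> f.L"
    using generator_on_fiber(1)[OF t R0(2)] trivializing_gen[OF c] R0(1) ch f.L_def by (simp add: ring_units_def)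
  \<comment> \<open>These are the denominators of the inverse of \<open>w\<close> among the
    functions on the chart. A prime containing all of them contains \<open>p - t\<close>, so it is a
    point of the fiber; there \<open>w\<close> is a unit, which gives a denominator outside the
    prime.\<close>
  define I where "I = {s \<in> B. \<exists>b\<in>B. \<Phi> t s = w * \<Phi> t b}"
  have I: "is_ideal B I"
    unfolding is_ideal_def
  proof (intro conjI ballI)
    show "I \<subseteq> B" by (auto simp: I_def)
    show "0 \<in> I" unfolding I_def using Bd(4) by (auto intro!: bexI[of _ 0] simp: f.phi_0)
    fix x assume x: "x \<in> I"
    then obtain b where b: "x \<in> B" "b \<in> B" "\<Phi> t x = w * \<Phi> t b" unfolding I_def by blast
    { fix y assume "y \<in> I"
      then obtain d where d: "y \<in> B" "d \<in> B" "\<Phi> t y = w * \<Phi> t d" unfolding I_def by blast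
      have "\<Phi> t (x + y) = w * \<Phi> t (b + d)"
        using f.phi_add[OF subsetD[OF BL b(1)] subsetD[OF BL d(1)]]
          f.phi_add[OF subsetD[OF BL b(2)] subsetD[OF BL d(2)]] b(3) d(3) by (simp add: distrib_left)
      then show "x + y \<in> I" unfolding I_def using Bd(6)[OF b(1) d(1)] Bd(6)[OF b(2) d(2)] by blast }
    { fix a assume a: "a \<in> B"
      have "\<Phi> t (a * x) = w * \<Phi> t (a * b)"
        using f.phi_mult[OF subsetD[OF BL a] subsetD[OF BL b(1)]]
          f.phi_mult[OF subsetD[OF BL a] subsetD[OF BL b(2)]] b(3) by simp
      then show "a * x \<in> I" unfolding I_def using Bd(3)[OF a b(1)] Bd(3)[OF a b(2)] by blast }
  qed
  have ptI: "pt t \<in> I"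
  proof -
    have "\<Phi> t (pt t * 1) = w * \<Phi> t 0"
      using f.phi_kernelI[OF R0(2) is_subringD(1)[OF f.fiber_subring[OF R0(2)]]] by (simp add: f.phi_0)
    then have "\<Phi> t (pt t) = w * \<Phi> t 0" by simp
    then show ?thesis unfolding I_def using trivializing_pt[OF c] ch Bd(4) by auto
  qed
  have "1 \<in> I"
  proof (rule ccontr)
    assume "1 \<notin> I"
    then obtain r where r: "is_prime_ideal B r" "I \<subseteq> r"
      using exists_prime_ideal[OF Br I, of "{1}"] by auto
    interpret r: prime_localization B r using Br r(1) by unfold_locales
    let ?R = "localization B r"
    have Rs: "?R \<in> spec_points B" using r(1) by (rule spec_pointsI)
    have "pt t \<in> max_ideal ?R" using ptI r(2) r.max_ideal_Int by blast
    then have Rf: "?R \<in> fiber_points Y p t"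
      using trivializing_point[OF c] Rs ch by (simp add: fiber_points_def)
    have "inverse w \<in> \<Phi> t ` ?R" using wR[OF Rs Rf] by (simp add: ring_units_def)
    then obtain x where x: "x \<in> ?R" "inverse w = \<Phi> t x" by blast
    from x(1) obtain a s where as: "a \<in> B" "s \<in> B" "s \<notin> r" "x = a / s" by (rule in_localizationE)
    have "s \<noteq> 0" using r.denominators(3) as by blast
    then have "x * s = a" using as(4) by simp
    then have "\<Phi> t x * \<Phi> t s = \<Phi> t a"
      using f.phi_mult[of x s] subsetD[OF f.fiber_subset[OF Rf] x(1)] subsetD[OF BL as(2)] by simp
    then have "\<Phi> t s = w * \<Phi> t a" using w0 x(2) by (simp flip: x(2) add: field_simps)
    then have "s \<in> I" unfolding I_def using as(1,2) by blast
    then show False using r(2) as(3) by blast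
  qed
  then obtain b where b: "b \<in> B" "1 = w * \<Phi> t b" unfolding I_def by (auto simp: f.phi_1)
  have "\<Phi> t (h * b / e t) = \<Phi> t ((h / e t) * b)" by simp
  also have "\<dots> = 1" using f.phi_mult[OF hL subsetD[OF BL b(1)]] b(2) by (simp add: w_def)
  finally show ?thesis using b(1) ch by (intro bexI[of _ b]) simp_all
qed

text \<open>Both lifts restrict to \<open>1\<close> on the fiber, so their difference is divisible
  by \<open>p - t\<close> at the points of the fiber; elsewhere \<open>p - t\<close> is a unit. The
  quotient is thus a section over the intersection of the two charts, whose coordinate ring is
  generated by both coordinate rings.\<close>

lemma difference_quotient:
  assumes t: "t \<noteq> 0" and c: "trivializing c" and d: "trivializing d"
    and b: "b \<in> fst c" "\<And>R. R \<in> spec_points (fst c) \<Longrightarrow> R \<in> fiber_points Y p t \<Longrightarrow> \<Phi> t (snd c * b / e t) = 1"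
    and b': "b' \<in> fst d" "\<And>R. R \<in> spec_points (fst d) \<Longrightarrow> R \<in> fiber_points Y p t \<Longrightarrow> \<Phi> t (snd d * b' / e t) = 1"
  shows "(snd c * b - snd d * b') / pt t \<in> (*) (snd c) ` generated_algebra (scalar Y) (fst c \<union> fst d)"
proof -
  interpret f: fiber Y \<A> p t X "\<Phi> t" using fib[OF t] .
  let ?AB = "generated_algebra (scalar Y) (fst c \<union> fst d)"
  have ABr: "is_subring ?AB" by (rule is_subring_generated)
  have sub: "fst c \<subseteq> ?AB" "fst d \<subseteq> ?AB" using generators_subset[of "fst c \<union> fst d"] by auto
  \<comment> \<open>Each point of the spectrum of the generated ring contains a local ring common to
    both charts: the two contractions are dominated by it, hence equal by separatedness.\<close>
  have common: "\<exists>R. R \<in> spec_points (fst c) \<and> R \<in> spec_points (fst d) \<and> R \<subseteq> localization ?AB q"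
    if q: "is_prime_ideal ?AB q" for q
  proof -
    interpret q: prime_localization ?AB q using ABr q by unfold_locales
    let ?R = "localization (fst c) (q \<inter> fst c)" and ?S = "localization (fst d) (q \<inter> fst d)"
    have R: "?R \<in> spec_points (fst c)"
      by (rule spec_pointsI[OF is_prime_ideal_contract[OF trivializing_ring[OF c] sub(1) q]])
    have S: "?S \<in> spec_points (fst d)"
      by (rule spec_pointsI[OF is_prime_ideal_contract[OF trivializing_ring[OF d] sub(2) q]])
    have dR: "dominates (localization ?AB q) ?R" "dominates (localization ?AB q) ?S"
      using dominates_contraction[OF trivializing_ring[OF c] ABr sub(1) q]
        dominates_contraction[OF trivializing_ring[OF d] ABr sub(2) q] .
    have "?R = ?S"
      by (rule separated[OF trivializing_point[OF c R] trivializing_point[OF d S] q.local dR])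
    then show ?thesis using R S dR(1) by (intro exI[of _ ?R]) (simp add: dominates_def)
  qed
  have h0: "snd c \<noteq> 0"
    using common[OF is_prime_ideal_zero[OF ABr]] trivializing_nonzero[OF c] by blast
  have "(snd c * b - snd d * b') / pt t / snd c \<in> ?AB"
  proof (rule in_base_if_in_all_localizations[OF ABr])
    fix q assume "is_prime_ideal ?AB q"
    from common[OF this] obtain R where R: "R \<in> spec_points (fst c)" "R \<in> spec_points (fst d)" "R \<subseteq> localization ?AB q"
      by (elim exE conjE)
    have RY: "R \<in> points Y" using trivializing_point[OF c R(1)] .
    have Rr: "is_subring R" using point_subring[OF RY] .
    note Rd = is_subringD[OF Rr]
    have gen: "gen R (snd c)" "gen R (snd d)" using trivializing_gen[OF c R(1)] trivializing_gen[OF d R(2)] .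
    have dc: "snd d / snd c \<in> R" using ratio_generator_unique[OF Rr gen(2,1)] by (simp add: ring_units_def)
    define z where "z = b - (snd d / snd c) * b'"
    have bR: "b \<in> R" "b' \<in> R"
      using b(1) b'(1) spec_points_properties(2)[OF trivializing_ring[OF c] R(1)]
        spec_points_properties(2)[OF trivializing_ring[OF d] R(2)] by auto
    have zR: "z \<in> R" unfolding z_def using Rd(2)[OF bR(1) Rd(3)[OF dc bR(2)]] .
    have diff: "snd c * b - snd d * b' = snd c * z" using h0 by (simp add: z_def field_simps)
    have "z / pt t \<in> R"
    proof (cases "pt t \<in> max_ideal R")
      case False
      then have "inverse (pt t) \<in> R" using pt_in_point[OF RY] by (auto simp: max_ideal_def ring_units_def)
      then show ?thesis using Rd(3)[OF zR] by (simp add: divide_inverse)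
    next
      case True
      then have Rf: "R \<in> fiber_points Y p t" using RY by (simp add: fiber_points_def)
      have RL: "R \<subseteq> f.L" using f.fiber_subset[OF Rf] .
      have un: "snd c / e t \<in> ring_units f.L" "snd d / e t \<in> ring_units f.L"
        using generator_on_fiber(1)[OF t Rf gen(1)] generator_on_fiber(1)[OF t Rf gen(2)] f.L_def by simp_all
      then have unL: "snd c / e t \<in> f.L" "snd d / e t \<in> f.L" by (auto simp: ring_units_def)
      have l: "snd c * b / e t \<in> f.L" "snd d * b' / e t \<in> f.L"
        using f.Ld(3)[OF unL(1) subsetD[OF RL bR(1)]] f.Ld(3)[OF unL(2) subsetD[OF RL bR(2)]] by simp_all
      have "\<Phi> t (z * (snd c / e t)) = \<Phi> t (snd c * b / e t - snd d * b' / e t)"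
        by (rule arg_cong[of _ _ "\<Phi> t"]) (use diff in \<open>simp add: diff_divide_distrib[symmetric] mult.commute\<close>)
      also have "\<dots> = 0" using f.phi_diff[OF l] b(2)[OF R(1) Rf] b'(2)[OF R(2) Rf] by simp
      finally have "\<Phi> t z * \<Phi> t (snd c / e t) = 0"
        using f.phi_mult[OF subsetD[OF RL zR] unL(1)] by simp
      then have "\<Phi> t z = 0" using f.phi_unit_nonzero[OF un(1)] by simp
      then obtain y where "y \<in> R" "z = pt t * y" using f.phi_kernelD[OF Rf zR] by blast
      then show ?thesis using pt_nonzero by simp
    qed
    moreover have "(snd c * b - snd d * b') / pt t / snd c = z / pt t" using h0 by (simp add: diff)
    ultimately show "(snd c * b - snd d * b') / pt t / snd c \<in> localization ?AB q" using R(3) by auto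
  qed
  then show ?thesis using h0 by (intro image_eqI[of _ _ "(snd c * b - snd d * b') / pt t / snd c"]) auto
qed

text \<open>
  The fiberwise generators lift to each chart, and the failure of the lifts to glue lives in a space
  of countable dimension. As there are uncountably many fibers, a linear combination of the lifts glues.
\<close>

lemma exists_global_section:
  assumes C: "finite \<C>" "\<And>c. c \<in> \<C> \<Longrightarrow> trivializing c"
    and cover: "\<And>t R. t \<noteq> 0 \<Longrightarrow> R \<in> fiber_points Y p t \<Longrightarrow> \<exists>c\<in>\<C>. R \<in> spec_points (fst c)"
  shows "\<exists>s. s \<noteq> 0 \<and> (\<forall>c\<in>\<C>. s \<in> (*) (snd c) ` fst c)"
proof -
  define b where "b t c = (SOME b. b \<in> fst c \<and> (\<forall>R. R \<in> spec_points (fst c) \<longrightarrow> R \<in> fiber_points Y p t \<longrightarrow> \<Phi> t (snd c * b / e t) = 1))" for t c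
  have b_ex: "b t c \<in> fst c \<and> (\<forall>R. R \<in> spec_points (fst c) \<longrightarrow> R \<in> fiber_points Y p t \<longrightarrow> \<Phi> t (snd c * b t c / e t) = 1)"
    if "t \<noteq> 0" "c \<in> \<C>" for t c
    unfolding b_def by (rule someI_ex) (use local_lift[OF that(1) C(2)[OF that(2)]] in blast)
  have b: "b t c \<in> fst c" "\<And>R. R \<in> spec_points (fst c) \<Longrightarrow> R \<in> fiber_points Y p t \<Longrightarrow> \<Phi> t (snd c * b t c / e t) = 1"
    if "t \<noteq> 0" "c \<in> \<C>" for t c
    using b_ex[OF that] by auto
  have unc: "uncountable (UNIV - {0 :: complex})"
    using uncountable_UNIV_complex by (metis countable_insert insert_Diff_single insert_UNIV)
  define f where "f j t = (snd (fst j) * b t (fst j) - snd (snd j) * b t (snd j)) / pt t" for j t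
  have spanned: "countably_spanned ((*) (snd (fst j)) ` generated_algebra (scalar Y) (fst (fst j) \<union> fst (snd j)))"
    if j: "j \<in> \<C> \<times> \<C>" for j
  proof -
    obtain G where G: "finite G" "fst (fst j) = generated_algebra (scalar Y) G"
      using C(2)[of "fst j"] j unfolding trivializing_def by auto
    obtain H where H: "finite H" "fst (snd j) = generated_algebra (scalar Y) H"
      using C(2)[of "snd j"] j unfolding trivializing_def by auto
    have "generated_algebra (scalar Y) (fst (fst j) \<union> fst (snd j)) \<subseteq> generated_algebra (scalar Y) (G \<union> H)"
      unfolding G(2) H(2)
      by (intro generated_subset subalgebra_generated Un_least generated_mono) auto
    moreover have "countably_spanned ((*) (snd (fst j)) ` generated_algebra (scalar Y) (G \<union> H))"
      using G(1) H(1) by (intro countably_spanned_times countably_spanned_generated) simp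
    ultimately show ?thesis unfolding countably_spanned_def by (meson image_mono subset_trans)
  qed
  have "\<exists>T l. finite T \<and> T \<noteq> {} \<and> T \<subseteq> UNIV - {0} \<and> (\<forall>t\<in>T. l t \<noteq> 0) \<and> (\<forall>j\<in>\<C> \<times> \<C>. (\<Sum>t\<in>T. scalar Y (l t) * f j t) = 0)"
  proof (rule uncountable_dependence[OF unc])
    show "finite (\<C> \<times> \<C>)" using C(1) by simp
    show "countably_spanned ((*) (snd (fst j)) ` generated_algebra (scalar Y) (fst (fst j) \<union> fst (snd j)))"
      if "j \<in> \<C> \<times> \<C>" for j using spanned[OF that] .
    fix t :: complex and j assume t: "t \<in> UNIV - {0}" and j: "j \<in> \<C> \<times> \<C>"
    have t0: "t \<noteq> 0" and jC: "fst j \<in> \<C>" "snd j \<in> \<C>" using t j by auto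
    show "f j t \<in> (*) (snd (fst j)) ` generated_algebra (scalar Y) (fst (fst j) \<union> fst (snd j))"
      unfolding f_def
      by (rule difference_quotient[OF t0 C(2)[OF jC(1)] C(2)[OF jC(2)] b(1)[OF t0 jC(1)] b(2)[OF t0 jC(1)] b(1)[OF t0 jC(2)] b(2)[OF t0 jC(2)]])
  qed
  then obtain T l where T: "finite T" "T \<noteq> {}" "T \<subseteq> UNIV - {0}" "\<forall>t\<in>T. l t \<noteq> 0"
    and dep: "\<forall>j\<in>\<C> \<times> \<C>. (\<Sum>t\<in>T. scalar Y (l t) * f j t) = 0" by (elim exE conjE)
  define D where "D = (\<Prod>s\<in>T. pt s)"
  define E where "E t = (\<Prod>s\<in>T-{t}. pt s)" for t
  have DE: "D = pt t * E t" if "t \<in> T" for t unfolding D_def E_def using prod.remove[OF T(1) that] .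
  \<comment> \<open>A section with simple poles along the chosen fibers and residues proportional to
    \<open>l t\<close>. The linear relation says precisely that it does not depend on the chart;
    multiplication by \<open>D\<close> removes the poles.\<close>
  define S where "S c = (\<Sum>t\<in>T. scalar Y (l t) * (snd c * b t c / pt t))" for c
  have S_eq: "S c = S d" if "c \<in> \<C>" "d \<in> \<C>" for c d
  proof -
    have "0 = (\<Sum>t\<in>T. scalar Y (l t) * f (c, d) t)" using dep that by simp
    also have "\<dots> = S c - S d"
      unfolding S_def f_def sum_subtractf[symmetric] by (intro sum.cong refl) (simp add: diff_divide_distrib right_diff_distrib)
    finally show ?thesis by simp
  qed
  have SD: "S c * D = snd c * (\<Sum>t\<in>T. scalar Y (l t) * b t c * E t)" for c
    unfolding S_def sum_distrib_right sum_distrib_left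
    by (intro sum.cong refl) (use pt_nonzero in \<open>simp add: DE\<close>)
  obtain t0 where t0: "t0 \<in> T" using T(2) by blast
  then have t0z: "t0 \<noteq> 0" using T(3) by blast
  interpret f: fiber Y \<A> p t0 X "\<Phi> t0" using fib[OF t0z] .
  obtain c0 where c0: "c0 \<in> \<C>" "f.L \<in> spec_points (fst c0)" using cover[OF t0z f.generic] by blast
  note c0t = C(2)[OF c0(1)]
  have c0L: "fst c0 \<subseteq> f.L" using spec_points_properties(2)[OF trivializing_ring[OF c0t] c0(2)] .
  have un: "snd c0 / e t0 \<in> ring_units f.L"
    using generator_on_fiber(1)[OF t0z f.generic trivializing_gen[OF c0t c0(2)]] f.L_def by simp
  then have unL: "snd c0 / e t0 \<in> f.L" by (simp add: ring_units_def)
  have ptL: "pt s \<in> f.L" for s using pt_in_point[OF f.fiber_point[OF f.generic]] .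
  have EL: "E t \<in> f.L" for t unfolding E_def using ptL by (intro is_subring_prod[OF f.L_subring])
  have bL: "b t c0 \<in> f.L" if "t \<in> T" for t using b(1)[of t c0] that T(3) c0L c0(1) by blast
  have scL: "scalar Y k \<in> f.L" for k using scalar_in_point[OF f.fiber_point[OF f.generic]] .
  have phipt: "\<Phi> t0 (pt s) = scalar X t0 - scalar X s" for s
  proof -
    have "\<Phi> t0 (pt t0) = 0" using f.phi_kernelI[OF f.generic f.Ld(1)] by simp
    moreover have "pt s = pt t0 + scalar Y (t0 - s)" by (simp add: sc_diff)
    ultimately have "\<Phi> t0 (pt s) = \<Phi> t0 (scalar Y (t0 - s))"
      using f.phi_add[OF ptL[of t0] scL[of "t0 - s"]] by (metis add.left_neutral)
    also have "\<dots> = scalar X t0 - scalar X s"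
      using f.phi_diff[OF scL scL, of t0 s] by (simp add: sc_diff f.phi_scalar)
    finally show ?thesis .
  qed
  define g where "g t = scalar Y (l t) * (snd c0 / e t0 * b t c0)" for t
  have gL: "g t \<in> f.L" if "t \<in> T" for t
    unfolding g_def using f.Ld(3)[OF scL f.Ld(3)[OF unL bL[OF that]]] .
  \<comment> \<open>On the fiber over \<open>t0\<close> each \<open>E t\<close> with
    \<open>t \<noteq> t0\<close> contains a vanishing factor, and the lift for \<open>t0\<close>
    restricts to \<open>1\<close>. What remains is \<open>l t0\<close> times the product of the
    differences \<open>t0 - s\<close>, so the section is not zero.\<close>
  have "\<Phi> t0 (S c0 * D / e t0) \<noteq> 0"
  proof -
    have "S c0 * D / e t0 = (\<Sum>t\<in>T. g t * E t)"
      unfolding SD g_def by (simp add: sum_distrib_left sum_divide_distrib ac_simps)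
    then have "\<Phi> t0 (S c0 * D / e t0) = (\<Sum>t\<in>T. \<Phi> t0 (g t * E t))"
      using f.phi_sum[of T "\<lambda>t. g t * E t"] f.Ld(3)[OF gL EL] by simp
    also have "\<dots> = (\<Sum>t\<in>T. \<Phi> t0 (g t) * \<Phi> t0 (E t))"
      by (intro sum.cong refl f.phi_mult gL EL)
    also have "\<dots> = (\<Sum>t\<in>{t0}. \<Phi> t0 (g t) * \<Phi> t0 (E t))"
    proof (intro sum.mono_neutral_right T(1) ballI)
      fix t assume t: "t \<in> T - {t0}"
      have "\<Phi> t0 (E t) = (\<Prod>s\<in>T-{t}. \<Phi> t0 (pt s))" unfolding E_def using ptL by (intro f.phi_prod)
      also have "\<dots> = 0" using t t0 T(1) by (intro prod_zero bexI[of _ t0]) (auto simp: phipt)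
      finally show "\<Phi> t0 (g t) * \<Phi> t0 (E t) = 0" by simp
    qed (use t0 in auto)
    also have "\<dots> = \<Phi> t0 (scalar Y (l t0)) * \<Phi> t0 (snd c0 / e t0 * b t0 c0) * \<Phi> t0 (E t0)"
      unfolding g_def using f.phi_mult[OF scL f.Ld(3)[OF unL bL[OF t0]]] by simp
    also have "\<Phi> t0 (snd c0 / e t0 * b t0 c0) = 1" using b(2)[OF t0z c0(1) c0(2) f.generic] by simp
    also have "\<Phi> t0 (E t0) = (\<Prod>s\<in>T-{t0}. scalar X t0 - scalar X s)"
      unfolding E_def using ptL by (subst f.phi_prod) (auto simp: phipt)
    finally have eq: "\<Phi> t0 (S c0 * D / e t0) = \<Phi> t0 (scalar Y (l t0)) * (\<Prod>s\<in>T-{t0}. scalar X t0 - scalar X s)" by simp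
    have nz: "\<Phi> t0 (scalar Y k) \<noteq> 0" if "k \<noteq> 0" for k
    proof (rule f.phi_unit_nonzero)
      show "scalar Y k \<in> ring_units f.L"
        unfolding ring_units_def using that scL by (simp add: sc_eq_0_iff flip: sc_inverse)
    qed
    have "scalar X t0 - scalar X s \<noteq> 0" if "s \<noteq> t0" for s
      using nz[of "t0 - s"] that f.phi_diff[OF scL scL, of t0 s] by (simp add: sc_diff f.phi_scalar)
    then have "(\<Prod>s\<in>T-{t0}. scalar X t0 - scalar X s) \<noteq> 0" using T(1) by simp
    then show ?thesis unfolding eq using nz[of "l t0"] T(4) t0 by simp
  qed
  then have "S c0 * D \<noteq> 0" using f.phi_0 by auto
  moreover have "S c0 * D \<in> (*) (snd c) ` fst c" if c: "c \<in> \<C>" for c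
  proof -
    note cr = trivializing_ring[OF C(2)[OF c]]
    have "S c0 * D = snd c * (\<Sum>t\<in>T. scalar Y (l t) * b t c * E t)" unfolding S_eq[OF c0(1) c] SD ..
    moreover have "(\<Sum>t\<in>T. scalar Y (l t) * b t c * E t) \<in> fst c"
    proof (intro is_subring_sum[OF cr] is_subringD(3)[OF cr])
      fix t assume "t \<in> T"
      then show "b t c \<in> fst c" using b(1)[of t c] T(3) c by blast
      show "scalar Y (l t) \<in> fst c"
        using C(2)[OF c] scalar_in_generated unfolding trivializing_def by auto
      show "E t \<in> fst c" unfolding E_def by (intro is_subring_prod[OF cr] trivializing_pt[OF C(2)[OF c]])
    qed
    ultimately show ?thesis by blast
  qed
  ultimately show ?thesis by blast
qed

lemma zero_on_fiber_divisible:
  assumes t: "t \<noteq> 0" and R: "R \<in> fiber_points Y p t" and h: "gen R h" and a: "a \<in> R"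
    and zero: "\<Phi> t (h * a / e t) = 0"
  shows "a / pt t \<in> R"
proof -
  interpret f: fiber Y \<A> p t X "\<Phi> t" using fib[OF t] .
  have un: "h / e t \<in> ring_units f.L" using generator_on_fiber(1)[OF t R h] f.L_def by simp
  then have unL: "h / e t \<in> f.L" by (simp add: ring_units_def)
  have aL: "a \<in> f.L" using f.fiber_subset[OF R] a by blast
  have "\<Phi> t (h / e t) * \<Phi> t a = 0" using f.phi_mult[OF unL aL] zero by simp
  then have "\<Phi> t a = 0" using f.phi_unit_nonzero[OF un] by simp
  then obtain y where "y \<in> R" "a = pt t * y" using f.phi_kernelD[OF R a] by blast
  then show ?thesis using pt_nonzero by simp
qed

text \<open>A linear relation among uncountably many quotients \<open>a / (p - t)\<close>,
  multiplied by the product of the \<open>p - t\<close> involved, becomes \<open>a\<close> times a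
  nonzero polynomial in \<open>p\<close>. In a domain that polynomial would vanish at
  \<open>p\<close>, so some \<open>p - t\<close> would be zero.\<close>

lemma countable_divisors:
  assumes c: "trivializing c" and a: "a \<in> fst c" "a \<noteq> 0"
  shows "countable {t. a / pt t \<in> fst c}"
proof (rule ccontr)
  assume T: "\<not> ?thesis"
  note cr = trivializing_ring[OF c]
  obtain G where G: "finite G" "fst c = generated_algebra (scalar Y) G" using c unfolding trivializing_def by blast
  have cs: "countably_spanned (fst c)" unfolding G(2) using countably_spanned_generated[OF G(1)] .
  have "\<exists>F l. finite F \<and> F \<noteq> {} \<and> F \<subseteq> {t. a / pt t \<in> fst c} \<and> (\<forall>t\<in>F. l t \<noteq> 0) \<and>
    (\<forall>j\<in>{()}. (\<Sum>t\<in>F. scalar Y (l t) * (a / pt t)) = 0)"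
    by (rule uncountable_dependence[OF T, where V = "\<lambda>_. fst c" and f = "\<lambda>_ t. a / pt t"]) (use cs in auto)
  then obtain F l where F: "finite F" "F \<noteq> {}" "\<forall>t\<in>F. l t \<noteq> 0" "(\<Sum>t\<in>F. scalar Y (l t) * (a / pt t)) = 0"
    by (elim exE conjE) simp
  have "a * ev p (node_poly F l) = (\<Sum>t\<in>F. scalar Y (l t) * (a / pt t)) * (\<Prod>s\<in>F. pt s)"
    unfolding ev_node_poly sum_distrib_left sum_distrib_right
  proof (intro sum.cong refl)
    fix t assume "t \<in> F"
    then have "(\<Prod>s\<in>F. pt s) = pt t * (\<Prod>s\<in>F-{t}. pt s)" by (rule prod.remove[OF F(1)])
    then show "a * (scalar Y (l t) * (\<Prod>s\<in>F-{t}. pt s)) = scalar Y (l t) * (a / pt t) * (\<Prod>s\<in>F. pt s)"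
      using pt_nonzero by simp
  qed
  then have "ev p (node_poly F l) \<in> {0}" using F(4) a(2) by simp
  moreover have "range (scalar Y) \<subseteq> fst c" unfolding G(2) using scalar_in_generated by blast
  moreover have "p \<in> fst c" using trivializing_pt[OF c, of 0] by (simp add: sc_0)
  ultimately obtain k where "pt k \<in> {0}"
    using ev_in_prime_ideal[OF cr _ _ is_prime_ideal_zero[OF cr] node_poly_nonzero[OF F(1,2,3)]] by blast
  then show False using pt_nonzero[of k] by blast
qed

text \<open>Relative to the trivialization of a fiber, \<open>s\<close> restricts to a global
  function on \<open>X\<close>, hence to a constant. If that constant is nonzero, \<open>s\<close>
  generates along the whole fiber, and generators persist at generizations.\<close>

lemma horizontal_generator:
  "\<exists>s. s \<noteq> 0 \<and> (\<forall>Q\<in>points Y. (\<forall>c. pt c \<notin> max_ideal Q) \<longrightarrow> gen Q s)"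
proof -
  from finite_trivializing_cover obtain \<C> where C: "finite \<C>" "\<forall>c\<in>\<C>. trivializing c"
    "\<forall>t R. t \<noteq> 0 \<longrightarrow> R \<in> fiber_points Y p t \<longrightarrow> (\<exists>c\<in>\<C>. R \<in> spec_points (fst c))" by (elim exE conjE)
  have "\<exists>s. s \<noteq> 0 \<and> (\<forall>c\<in>\<C>. s \<in> (*) (snd c) ` fst c)"
  proof (rule exists_global_section[OF C(1)])
    show "trivializing c" if "c \<in> \<C>" for c using C(2) that by (rule bspec)
    show "\<exists>c\<in>\<C>. R \<in> spec_points (fst c)" if "t \<noteq> 0" "R \<in> fiber_points Y p t" for t R
      using C(3) that by simp
  qed
  then obtain s where s: "s \<noteq> 0" "\<forall>c\<in>\<C>. s \<in> (*) (snd c) ` fst c" by (elim exE conjE)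
  \<comment> \<open>Where \<open>s\<close> restricts to zero, its coefficient on any chart of the
    cover is divisible by \<open>p - t\<close>; this happens for only countably many
    \<open>t\<close>.\<close>
  define bad where "bad = {t. t \<noteq> 0 \<and> \<Phi> t (s / e t) = 0}"
  have "countable bad"
  proof -
    from C(3)[rule_format, OF one_neq_zero fiber_generic[OF one_neq_zero]]
    obtain c where c: "c \<in> \<C>" by (rule bexE)
    then have ct: "trivializing c" using C(2) by blast
    note cr = trivializing_ring[OF ct]
    obtain a where a: "a \<in> fst c" "s = snd c * a" using s(2) c by blast
    have "a / pt t \<in> fst c" if t: "t \<in> bad" for t
    proof (rule in_base_if_in_all_localizations[OF cr])
      fix q assume "is_prime_ideal (fst c) q"
      then have R: "localization (fst c) q \<in> spec_points (fst c)" by (rule spec_pointsI)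
      define R where "R = localization (fst c) q"
      have RY: "R \<in> points Y" "R \<in> spec_points (fst c)" using trivializing_point[OF ct R] R by (simp_all add: R_def)
      have aR: "a \<in> R" using a(1) spec_points_properties(2)[OF cr RY(2)] by blast
      have "a / pt t \<in> R"
      proof (cases "pt t \<in> max_ideal R")
        case True
        have "R \<in> fiber_points Y p t" using RY(1) True by (simp add: fiber_points_def)
        then show ?thesis
          using zero_on_fiber_divisible[OF _ _ trivializing_gen[OF ct RY(2)] aR, of t] t a(2) by (simp add: bad_def)
      next
        case False
        then have "inverse (pt t) \<in> R" using pt_in_point[OF RY(1)] by (auto simp: max_ideal_def ring_units_def)
        then show ?thesis using is_subringD(3)[OF point_subring[OF RY(1)] aR] by (simp add: divide_inverse)
      qed
      then show "a / pt t \<in> localization (fst c) q" by (simp add: R_def)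
    qed
    then have "bad \<subseteq> {t. a / pt t \<in> fst c}" by blast
    moreover have "a \<noteq> 0" using s(1) a(2) by auto
    ultimately show ?thesis using countable_divisors[OF ct a(1)] countable_subset by blast
  qed
  have good: "gen R s" if t: "t \<noteq> 0" "t \<notin> bad" and R: "R \<in> fiber_points Y p t" for t R
  proof -
    interpret f: fiber Y \<A> p t X "\<Phi> t" using fib[OF t(1)] .
    define w where "w = \<Phi> t (s / e t)"
    have w0: "w \<noteq> 0" using t by (simp add: bad_def w_def)
    have local: "\<exists>h a. gen R h \<and> a \<in> R \<and> s = h * a \<and> w = \<Phi> t (h / e t) * \<Phi> t a" if R: "R \<in> fiber_points Y p t" for R
    proof -
      from C(3)[rule_format, OF t(1) R] obtain c where c: "c \<in> \<C>" "R \<in> spec_points (fst c)" by (rule bexE)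
      then have ct: "trivializing c" using C(2) by blast
      obtain a where a: "a \<in> fst c" "s = snd c * a" using s(2) c(1) by blast
      have aR: "a \<in> R" using a(1) spec_points_properties(2)[OF trivializing_ring[OF ct] c(2)] by blast
      have g: "gen R (snd c)" using trivializing_gen[OF ct c(2)] .
      have "snd c / e t \<in> f.L" using generator_on_fiber(1)[OF t(1) R g] f.L_def by (simp add: ring_units_def)
      from f.phi_mult[OF this subsetD[OF f.fiber_subset[OF R] aR]]
      have "w = \<Phi> t (snd c / e t) * \<Phi> t a" unfolding w_def a(2) by simp
      then show ?thesis using g aR a(2) by blast
    qed
    \<comment> \<open>In terms of a local generator, \<open>w\<close> is a product of regular
      functions on the fiber.\<close>
    have "w \<in> S" if S: "S \<in> points X" for S
    proof -
      obtain R where R: "R \<in> fiber_points Y p t" "S = \<Phi> t ` R" using f.points_image[OF S] by blast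
      obtain h a where ha: "gen R h" "a \<in> R" "w = \<Phi> t (h / e t) * \<Phi> t a" using local[OF R(1)] by blast
      have "\<Phi> t (h / e t) \<in> \<Phi> t ` R" using generator_on_fiber(2)[OF t(1) R(1) ha(1)] by (simp add: ring_units_def)
      from is_subringD(3)[OF f.phi_image_subring[OF R(1)] this imageI[OF ha(2)]]
      show ?thesis using ha(3) R(2) by simp
    qed
    from constants[OF this] obtain k where k: "w = scalar X k" by blast
    have scR: "scalar Y j \<in> R" for j using scalar_in_point[OF f.fiber_point[OF R]] .
    have "k \<noteq> 0" using w0 k f.phi_scalar[of 0] f.phi_0 by (auto simp: sc_0)
    then have "scalar Y k \<in> ring_units R"
      unfolding ring_units_def using scR by (simp add: sc_eq_0_iff flip: sc_inverse)
    then have wu: "w \<in> ring_units (\<Phi> t ` R)" using f.unit_iff[OF R scR] k f.phi_scalar by metis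
    obtain h a where ha: "gen R h" "a \<in> R" "s = h * a" "w = \<Phi> t (h / e t) * \<Phi> t a" using local[OF R] by blast
    have hu: "\<Phi> t (h / e t) \<in> ring_units (\<Phi> t ` R)" using generator_on_fiber(2)[OF t(1) R ha(1)] .
    then have "\<Phi> t (h / e t) \<noteq> 0" by (simp add: ring_units_def)
    then have "\<Phi> t a = w / \<Phi> t (h / e t)" using ha(4) by simp
    then have "\<Phi> t a \<in> ring_units (\<Phi> t ` R)" using ring_units_divide[OF f.phi_image_subring[OF R] wu hu] by metis
    then have "a \<in> ring_units R" using f.unit_iff[OF R ha(2)] by simp
    then show ?thesis unfolding ha(3) by (rule ratio_generator_unit[OF f.fiber_subring[OF R] ha(1)])
  qed
  have "gen Q s" if Q: "Q \<in> points Y" and hor: "\<forall>c. pt c \<notin> max_ideal Q" for Q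
  proof -
    obtain A where A: "A \<in> \<A>" "Q \<in> spec_points A" using Q points_eq by auto
    \<comment> \<open>The fibers to be avoided are the special one, the bad ones and those that the
      closure of \<open>Q\<close> misses in the chart; together they are countably many.\<close>
    define T where "T = {t. \<not> (\<exists>R. R \<in> spec_points A \<and> R \<in> fiber_points Y p t \<and> R \<subseteq> Q)}"
    have "countable T" unfolding T_def
      by (rule horizontal_specialization[OF A(1) p_in_chart[OF A(1)] A(2)]) (use hor in blast)
    then have "countable (insert 0 (bad \<union> T))" using \<open>countable bad\<close> by simp
    then have "insert 0 (bad \<union> T) \<noteq> UNIV" using uncountable_UNIV_complex by metis
    then obtain t where t: "t \<noteq> 0" "t \<notin> bad" "t \<notin> T" by blast
    then obtain R where R: "R \<in> fiber_points Y p t" "R \<subseteq> Q" unfolding T_def by blast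
    have RY: "R \<in> points Y" using R(1) by (simp add: fiber_points_def)
    show ?thesis using inv_mono[OF RY Q R(2) good[OF t(1,2) R(1)]] .
  qed
  then show ?thesis using s(1) by blast
qed

text \<open>The quotient of \<open>s\<close> and \<open>h\<close> is a unit wherever
  \<open>p\<close> is invertible near \<open>R\<close>, so it and its inverse become elements of
  \<open>R\<close> after multiplication by powers of \<open>p\<close>. As \<open>p\<close> generates
  a prime ideal, the factors of a power of \<open>p\<close> are units times powers of
  \<open>p\<close>.\<close>

lemma central_order:
  assumes s: "\<And>Q. Q \<in> points Y \<Longrightarrow> (\<And>c. pt c \<notin> max_ideal Q) \<Longrightarrow> gen Q s" "s \<noteq> 0"
    and R: "R \<in> fiber_points Y p 0" and h: "gen R h"
    and prime: "\<And>y z. y \<in> R \<Longrightarrow> z \<in> R \<Longrightarrow> y * z \<in> (*) p ` R \<Longrightarrow> y \<in> (*) p ` R \<or> z \<in> (*) p ` R"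
  shows "\<exists>k u. u \<in> ring_units R \<and> s = h * u * p powi k"
proof -
  have RY: "R \<in> points Y" and pR: "p \<in> max_ideal R" using R by (auto simp: fiber_points_def sc_0)
  have pR': "p \<in> R" using pR by (simp add: max_ideal_def)
  have p0: "p \<noteq> 0" using pt_nonzero[of 0] by (simp add: sc_0)
  note Rr = point_subring[OF RY]
  note Rd = is_subringD[OF Rr]
  have h0: "h \<noteq> 0" using ratio_generator_nonzero[OF h] .
  define x where "x = s / h"
  have x0: "x \<noteq> 0" using s(2) h0 by (simp add: x_def)
  \<comment> \<open>A generization of \<open>R\<close> at which \<open>p\<close> is invertible lies
    over no closed point: it could only lie over that of \<open>R\<close>, which is
    \<open>0\<close>. So \<open>s\<close> generates there.\<close>
  have x: "x \<in> ring_units (localization R q)" if q: "is_prime_ideal R q" "p \<notin> q" for q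
  proof -
    interpret q: prime_localization R q using Rr q(1) by unfold_locales
    let ?Q = "localization R q"
    have Q: "?Q \<in> points Y" using point_localization[OF RY q(1)] .
    have qm: "q \<subseteq> max_ideal R"
    proof
      fix a assume a: "a \<in> q"
      then have aR: "a \<in> R" using is_prime_idealD(3)[OF q(1)] by blast
      have "a \<notin> ring_units R"
      proof
        assume "a \<in> ring_units R"
        then have "inverse a * a \<in> q" "a \<noteq> 0"
          using is_idealD(4)[OF is_prime_idealD(1)[OF q(1)] _ a, of "inverse a"] by (simp_all add: ring_units_def)
        then show False using is_prime_idealD(2)[OF q(1)] by simp
      qed
      then show "a \<in> max_ideal R" using aR by (simp add: max_ideal_def)
    qed
    have "pt c \<notin> max_ideal ?Q" for c
    proof
      assume "pt c \<in> max_ideal ?Q"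
      then have c: "pt c \<in> q" using q.max_ideal_Int pt_in_point[OF RY] by blast
      moreover have "pt 0 \<in> max_ideal R" using pR by (simp add: sc_0)
      ultimately have "c = 0" using pt_in_max_ideal_unique[OF RY] qm by blast
      then show False using c q(2) by (simp add: sc_0)
    qed
    then have "gen ?Q s" using s(1)[OF Q] by blast
    moreover have "gen ?Q h" using inv_mono[OF RY Q q.base_subset h] .
    ultimately show ?thesis unfolding x_def using ratio_generator_unique[OF q.subring] by blast
  qed
  obtain a where a: "p ^ a * x \<in> R"
    using in_all_localizations[OF Rr, of p x] x pR' by (auto simp: ring_units_def)
  obtain b where b: "p ^ b * inverse x \<in> R"
    using in_all_localizations[OF Rr, of p "inverse x"] x pR' by (auto simp: ring_units_def)
  \<comment> \<open>At each step one of the two factors absorbs a factor \<open>p\<close>; if it is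
    \<open>z\<close>, the exponent \<open>k\<close> of \<open>y\<close> stays the same.\<close>
  have fact: "\<exists>k u. u \<in> ring_units R \<and> y = u * p ^ k" if "y \<in> R" "z \<in> R" "y * z = p ^ m" for y z m
    using that
  proof (induction m arbitrary: y z)
    case 0
    then have "y * z = 1" by simp
    then have "inverse y = z" "y \<noteq> 0" by (auto simp: inverse_unique)
    then have "y \<in> ring_units R" using 0 by (simp add: ring_units_def)
    then show ?case by (intro exI[of _ 0] exI[of _ y]) simp
  next
    case (Suc m)
    have "y * z \<in> (*) p ` R" unfolding Suc.prems(3) power_Suc using Rd(7)[OF pR', of m] by (rule imageI)
    then consider "y \<in> (*) p ` R" | "z \<in> (*) p ` R" using prime[OF Suc.prems(1,2)] by blast
    then show ?case
    proof cases
      case 1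
      then obtain y' where y': "y' \<in> R" "y = p * y'" by blast
      then have "y' * z = p ^ m" using Suc.prems(3) p0 by simp
      from Suc.IH[OF y'(1) Suc.prems(2) this] obtain k u where "u \<in> ring_units R" "y' = u * p ^ k" by (elim exE conjE)
      then show ?thesis using y'(2) by (intro exI[of _ "Suc k"] exI[of _ u]) simp
    next
      case 2
      then obtain z' where z': "z' \<in> R" "z = p * z'" by blast
      then have "y * z' = p ^ m" using Suc.prems(3) p0 by simp
      from Suc.IH[OF Suc.prems(1) z'(1) this] show ?thesis .
    qed
  qed
  have "(p ^ a * x) * (p ^ b * inverse x) = p ^ (a + b)" using x0 by (simp add: power_add)
  from fact[OF a b this] obtain k u where u: "u \<in> ring_units R" "p ^ a * x = u * p ^ k" by (elim exE conjE)
  have "x = u * p powi (int k - int a)"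
    using u(2) p0 by (simp add: power_int_diff field_simps)
  then have "s = h * u * p powi (int k - int a)" using h0 by (simp add: x_def field_simps)
  then show ?thesis using u(1) by blast
qed

end

subsection \<open>Global functions on a projective variety\<close>

lemma prod_list_count:
  fixes w :: "'a::comm_monoid_mult list"
  shows "prod_list w = g ^ count_list w g * prod_list (filter (\<lambda>x. x \<noteq> g) w)"
  by (induction w) (auto simp: ac_simps)

lemma length_count: "length w = count_list w g + length (filter (\<lambda>x. x \<noteq> g) w)"
  by (induction w) auto

context scalars
begin

text \<open>The image in the function field of the degree \<open>k\<close> part of the homogeneous
  coordinate ring.\<close>

definition forms :: "'k set \<Rightarrow> nat \<Rightarrow> 'k set" where
  "forms G k = lin_span (prod_list ` {w. set w \<subseteq> G \<and> length w = k})"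

lemma forms_mult:
  assumes "x \<in> forms G k" "y \<in> forms G m"
  shows "x * y \<in> forms G (k + m)"
  using assms unfolding forms_def
proof (rule lin_span_mult)
  fix z w assume "z \<in> prod_list ` {w. set w \<subseteq> G \<and> length w = k}" "w \<in> prod_list ` {w. set w \<subseteq> G \<and> length w = m}"
  then obtain u v where "z = prod_list u" "set u \<subseteq> G" "length u = k" "w = prod_list v" "set v \<subseteq> G" "length v = m" by auto
  then have "z * w = prod_list (u @ v)" "u @ v \<in> {w. set w \<subseteq> G \<and> length w = k + m}" by auto
  then show "z * w \<in> lin_span (prod_list ` {w. set w \<subseteq> G \<and> length w = k + m})"
    by (intro lin_span_base) blast
qed

lemma prod_list_in_forms: "set w \<subseteq> G \<Longrightarrow> length w = k \<Longrightarrow> prod_list w \<in> forms G k"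
  unfolding forms_def by (intro lin_span_base) blast

lemma power_in_forms: "g \<in> G \<Longrightarrow> g ^ k \<in> forms G k"
  using prod_list_in_forms[of "replicate k g" G k] by (simp add: prod_list_replicate set_replicate_conv_if)

text \<open>A function on the chart of \<open>g\<close> is a polynomial in the quotients
  \<open>y / g\<close>, so a sufficiently high power of \<open>g\<close> makes it homogeneous.
  Larger powers work as well, which allows one exponent for all charts.\<close>

lemma chart_function_form:
  assumes g: "g \<in> G" "g \<noteq> 0" and x: "x \<in> generated_algebra sc ((\<lambda>y. y / g) ` G)"
  shows "\<exists>k. \<forall>m\<ge>k. x * g ^ m \<in> forms G m"
proof -
  have raise: "\<forall>m\<ge>k. y * g ^ m \<in> forms G m" if y: "y * g ^ k \<in> forms G k" for y k
  proof (intro allI impI)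
    fix m assume "k \<le> m"
    then obtain j where m: "m = k + j" using le_Suc_ex by blast
    have "(y * g ^ k) * g ^ j \<in> forms G (k + j)" using y power_in_forms[OF g(1)] by (rule forms_mult)
    then show "y * g ^ m \<in> forms G m" by (simp add: m power_add ac_simps)
  qed
  have "\<exists>k. x * g ^ k \<in> forms G k" using x
  proof (induction rule: generated_induct)
    case (generator x)
    then obtain y where "y \<in> G" "x = y / g" by blast
    then have "x * g ^ 1 \<in> forms G 1" using g(2) power_in_forms[of y G 1] by simp
    then show ?case ..
  next
    case (scalar c)
    have "sc c * 1 \<in> forms G 0" unfolding forms_def by (rule lin_span_single) force
    then have "sc c * g ^ 0 \<in> forms G 0" by simp
    then show ?case ..
  next
    case (add x y)
    then obtain k m where "x * g ^ k \<in> forms G k" "y * g ^ m \<in> forms G m" by blast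
    then have "x * g ^ (k + m) \<in> forms G (k + m)" "y * g ^ (k + m) \<in> forms G (k + m)" using raise by simp_all
    then have "x * g ^ (k + m) + y * g ^ (k + m) \<in> forms G (k + m)" unfolding forms_def by (rule lin_span_add)
    then have "(x + y) * g ^ (k + m) \<in> forms G (k + m)" by (simp add: distrib_right)
    then show ?case ..
  next
    case (mult x y)
    then obtain k m where "x * g ^ k \<in> forms G k" "y * g ^ m \<in> forms G m" by blast
    then have "(x * g ^ k) * (y * g ^ m) \<in> forms G (k + m)" by (rule forms_mult)
    then have "(x * y) * g ^ (k + m) \<in> forms G (k + m)" by (simp add: power_add ac_simps)
    then show ?case ..
  qed
  then show ?thesis using raise by blast
qed

text \<open>In a degree as large as \<open>K\<close> every nonzero monomial contains some coordinate
  \<open>g\<close> at least \<open>N\<close> times, by the pigeonhole principle. That power of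
  \<open>g\<close> absorbs \<open>x\<close>, since \<open>x\<close> is regular on the chart of
  \<open>g\<close>.\<close>

lemma forms_stable:
  assumes G: "finite G" "G - {0} \<noteq> {}"
    and x: "\<And>g. g \<in> G - {0} \<Longrightarrow> x \<in> generated_algebra sc ((\<lambda>y. y / g) ` G)"
  shows "\<exists>k. \<forall>y\<in>forms G k. x * y \<in> forms G k"
proof -
  have "\<forall>g\<in>G-{0}. \<exists>k. \<forall>m\<ge>k. x * g ^ m \<in> forms G m"
    using chart_function_form x by blast
  from bchoice[OF this] obtain k where k: "\<forall>g\<in>G-{0}. \<forall>m\<ge>k g. x * g ^ m \<in> forms G m" ..
  define N where "N = Suc (\<Sum>g\<in>G-{0}. k g)"
  have kN: "k g \<le> N" if "g \<in> G - {0}" for g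
    using member_le_sum[of g "G - {0}" k] that G(1) by (simp add: N_def)
  define K where "K = card (G - {0}) * N"
  have mono: "x * prod_list w \<in> forms G K" if w: "set w \<subseteq> G" "length w = K" for w
  proof (cases "0 \<in> set w")
    case True
    then have "prod_list w = 0" by (simp add: prod_list_zero_iff)
    then show ?thesis by (simp add: forms_def lin_span_zero)
  next
    case False
    then have w': "set w \<subseteq> G - {0}" using w by blast
    have "\<exists>g\<in>G-{0}. N \<le> count_list w g"
    proof (rule ccontr)
      assume "\<not> ?thesis"
      then have "(\<Sum>g\<in>G-{0}. count_list w g) < (\<Sum>g\<in>G-{0}. N)"
        using G by (intro sum_strict_mono) (auto simp: not_le)
      moreover have "(\<Sum>g\<in>G-{0}. count_list w g) = K" using sum_count_set[OF w'] G(1) w(2) by simp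
      ultimately show False by (simp add: K_def)
    qed
    then obtain g where g: "g \<in> G - {0}" "N \<le> count_list w g" ..
    define v where "v = replicate (count_list w g - N) g @ filter (\<lambda>x. x \<noteq> g) w"
    have "length v = K - N" using length_count[of w g] g(2) w(2) by (simp add: v_def)
    moreover have "set v \<subseteq> G" using w(1) g(1) by (auto simp: v_def)
    ultimately have v: "prod_list v \<in> forms G (K - N)" by (intro prod_list_in_forms)
    have "prod_list w = g ^ N * prod_list v"
      unfolding prod_list_count[of w g] v_def using g(2)
      by (simp add: prod_list_replicate flip: mult.assoc power_add)
    moreover have "x * g ^ N \<in> forms G N" using k g(1) kN by blast
    from forms_mult[OF this v] have "(x * g ^ N) * prod_list v \<in> forms G (N + (K - N))" .
    moreover have "N + (K - N) = K" using length_count[of w g] g(2) w(2) by simp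
    ultimately show ?thesis by (simp add: mult.assoc)
  qed
  have "x * y \<in> forms G K" if y: "y \<in> forms G K" for y
    unfolding forms_def
  proof (rule lin_span_mult)
    show "x \<in> lin_span {x}" by (simp add: lin_span_base)
    show "y \<in> lin_span (prod_list ` {w. set w \<subseteq> G \<and> length w = K})" using y by (simp add: forms_def)
    fix z w assume "z \<in> {x}" "w \<in> prod_list ` {w. set w \<subseteq> G \<and> length w = K}"
    then show "z * w \<in> lin_span (prod_list ` {w. set w \<subseteq> G \<and> length w = K})"
      using mono by (auto simp: forms_def)
  qed
  then show ?thesis by blast
qed

lemma ev_monom: "ev x (monom a n) = sc a * x ^ n"
  by (induction n) (auto simp: monom_0 monom_Suc ev_pCons ev_0 sc_0)

text \<open>The vectors \<open>x ^ i * y\<close> lie in a finite-dimensional space, so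
  \<open>x\<close> is a root of a nonzero complex polynomial. In a field that contains the
  algebraically closed field of scalars this forces \<open>x\<close> to be a scalar.\<close>

lemma eigenvalue_scalar:
  assumes Z: "finite Z" and x: "\<And>y. y \<in> lin_span Z \<Longrightarrow> x * y \<in> lin_span Z" and y: "y \<in> lin_span Z" "y \<noteq> 0"
  shows "x \<in> range sc"
proof -
  have pow: "x ^ i * y \<in> lin_span Z" for i
    by (induction i) (auto simp: y mult.assoc intro: x)
  have "\<exists>c. x ^ i * y = (\<Sum>z\<in>Z. sc (c z) * z)" for i
  proof -
    obtain H c where H: "finite H" "H \<subseteq> Z" "x ^ i * y = (\<Sum>z\<in>H. sc (c z) * z)"
      using pow[of i] unfolding lin_span_def by blast
    have "(\<Sum>z\<in>Z. sc (if z \<in> H then c z else 0) * z) = (\<Sum>z\<in>H. sc (c z) * z)"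
      using Z H(2) by (intro sum.mono_neutral_cong_right) (auto simp: sc_0)
    then have "x ^ i * y = (\<Sum>z\<in>Z. sc (if z \<in> H then c z else 0) * z)" using H(3) by simp
    then show ?thesis by (intro exI[of _ "\<lambda>z. if z \<in> H then c z else 0"])
  qed
  then have "\<forall>i. \<exists>c. x ^ i * y = (\<Sum>z\<in>Z. sc (c z) * z)" by blast
  from choice[OF this] obtain c where c: "\<forall>i. x ^ i * y = (\<Sum>z\<in>Z. sc (c i z) * z)" ..
  have "card Z < card {..card Z}" by simp
  from homogeneous_system_nontrivial[OF Z finite_atMost this, of c]
  obtain l where l: "\<exists>i\<in>{..card Z}. l i \<noteq> 0" "\<forall>z\<in>Z. (\<Sum>i\<in>{..card Z}. l i * c i z) = 0" by (elim exE conjE)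
  define g where "g = (\<Sum>i\<in>{..card Z}. monom (l i) i)"
  have "g \<noteq> 0"
  proof
    assume "g = 0"
    then have "coeff g i = 0" for i by simp
    moreover have "coeff g i = l i" if "i \<le> card Z" for i
      using that by (simp add: g_def coeff_sum)
    ultimately show False using l(1) by auto
  qed
  have "ev x g * y = (\<Sum>i\<in>{..card Z}. sc (l i) * (x ^ i * y))"
    unfolding g_def ev_sum ev_monom by (simp add: sum_distrib_right mult.assoc)
  also have "\<dots> = (\<Sum>i\<in>{..card Z}. \<Sum>z\<in>Z. sc (l i * c i z) * z)"
    using c by (simp add: sum_distrib_left sc_mult mult.assoc)
  also have "\<dots> = (\<Sum>z\<in>Z. sc (\<Sum>i\<in>{..card Z}. l i * c i z) * z)"
    by (subst sum.swap) (simp add: sc_sum sum_distrib_right)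
  also have "\<dots> = 0" using l(2) by (simp add: sc_0)
  finally have "ev x g \<in> {0}" using y(2) by simp
  moreover have U: "is_subring (UNIV :: 'k set)" by (simp add: is_subring_def)
  ultimately obtain k where "x - sc k \<in> {0}"
    using ev_in_prime_ideal[OF U _ _ is_prime_ideal_zero[OF U] \<open>g \<noteq> 0\<close>] by blast
  then show ?thesis by simp
qed

end

text \<open>An elementary replacement for the finiteness of global sections: a global function acts
  by multiplication on the forms of a suitable degree, a nonzero finite-dimensional space.\<close>

lemma projective_global_functions:
  assumes X: "projective_variety X" and x: "\<And>R. R \<in> points X \<Longrightarrow> x \<in> R"
  shows "x \<in> range (scalar X)"
proof -
  obtain G where G: "finite G" "points X = proj_points (scalar X) {} G"
    using X unfolding projective_variety_def by blast
  obtain \<A> where "charted X \<A>" using X variety_charted unfolding projective_variety_def by blast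
  interpret charted X \<A> by fact
  have "points X \<noteq> {}" using function_field_point by blast
  then have G0: "G - {0} \<noteq> {}" unfolding G(2) proj_points_def by blast
  have "x \<in> generated_algebra (scalar X) ((\<lambda>y. y / g) ` G)" if g: "g \<in> G - {0}" for g
  proof (rule in_base_if_in_all_localizations[OF is_subring_generated])
    fix q assume "is_prime_ideal (generated_algebra (scalar X) ((\<lambda>y. y / g) ` G)) q"
    then have "localization (generated_algebra (scalar X) ((\<lambda>y. y / g) ` G)) q \<in> points X"
      unfolding G(2) proj_points_def using spec_pointsI[of _ q] g by force
    then show "x \<in> localization (generated_algebra (scalar X) ((\<lambda>y. y / g) ` G)) q" by (rule x)
  qed
  from forms_stable[OF G(1) G0 this] obtain k where k: "\<forall>y\<in>forms G k. x * y \<in> forms G k" ..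
  obtain g where g: "g \<in> G" "g \<noteq> 0" using G0 by blast
  show ?thesis
  proof (rule eigenvalue_scalar)
    show "finite (prod_list ` {w. set w \<subseteq> G \<and> length w = k})"
      using finite_lists_length_eq[OF G(1), of k] by (rule finite_imageI)
    show "x * y \<in> lin_span (prod_list ` {w. set w \<subseteq> G \<and> length w = k})"
      if "y \<in> lin_span (prod_list ` {w. set w \<subseteq> G \<and> length w = k})" for y
      using k that by (simp add: forms_def)
    show "g ^ k \<in> lin_span (prod_list ` {w. set w \<subseteq> G \<and> length w = k})"
      using power_in_forms[OF g(1)] by (simp add: forms_def)
    show "g ^ k \<noteq> 0" using g(2) by simp
  qed
qed

subsection \<open>Comparison of divisors on the special fiber\<close>

lemma times_image_field:
  assumes "is_subring K" "y \<in> K" "y \<noteq> 0" "\<And>x. x \<in> K \<Longrightarrow> inverse x \<in> K"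
  shows "(*) y ` K = K"
proof -
  have "y \<in> ring_units K" using assms by (simp add: ring_units_def)
  from unit_times_image[OF assms(1) this, of 1] show ?thesis by simp
qed

text \<open>With \<open>e0\<close> a generator at the generic point of the special fiber, the
  horizontal generator is \<open>s = e0 * u * p powi k\<close>, and \<open>\<theta>\<close> is the
  restriction of \<open>u\<close>. It measures the restricted homomorphism sheaf against the sheaves
  on \<open>W\<close> at every point where both of these are principal.\<close>

lemma degeneration_ratio:
  fixes Y :: "'b::field model" and X :: "'k::field model" and W :: "'c::field model"
  assumes Y: "variety Y" "regular_function Y p"
    and X: "projective_variety X" "\<And>t. t \<noteq> 0 \<Longrightarrow> fiber_iso Y p t X (\<Phi> t)"
    and W: "fiber_iso Y p 0 W \<phi>" "scalar W 1 = 1" "\<And>x. x \<in> function_field W \<Longrightarrow> inverse x \<in> function_field W"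
    and F: "divisorial_sheaf Y F" "\<And>t. t \<noteq> 0 \<Longrightarrow> restricts_to Y p t (\<Phi> t) F E" "restricts_to Y p 0 \<phi> F E0"
    and F': "divisorial_sheaf Y F'" "\<And>t. t \<noteq> 0 \<Longrightarrow> restricts_to Y p t (\<Phi> t) F' E'" "restricts_to Y p 0 \<phi> F' E0'"
    and principal: "\<And>S. S \<in> points X \<Longrightarrow>
      \<exists>y\<in>function_field X. y \<noteq> 0 \<and> E S = (*) y ` S \<and> E' S = (*) (y ^ n) ` S"
    and gen: "E0 (function_field W) = function_field W" "E0' (function_field W) = function_field W"
  shows "\<exists>\<theta>\<in>function_field W. \<theta> \<noteq> 0 \<and> (\<forall>S\<in>points W. \<forall>y y'. y \<noteq> 0 \<longrightarrow> y' \<noteq> 0 \<longrightarrow>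
    E0 S = (*) y ` S \<longrightarrow> E0' S = (*) y' ` S \<longrightarrow> \<theta> * y ^ n / y' \<in> ring_units S)"
proof -
  obtain \<A> where A: "charted Y \<A>" using variety_charted[OF Y(1)] ..
  interpret Y: charted Y \<A> by fact
  have varX: "variety X" using X(1) by (simp add: projective_variety_def)
  obtain \<B> where "charted X \<B>" using variety_charted[OF varX] ..
  interpret X: charted X \<B> by fact
  have fib: "fiber Y \<A> p t X (\<Phi> t)" if "t \<noteq> 0" for t
    using that X(2) X.sc_1 X.function_field_inverse A by (simp add: fiber_def fiber_axioms_def)
  interpret c: fiber Y \<A> p 0 W \<phi>
    using W A by (simp add: fiber_def fiber_axioms_def)
  have "\<exists>y\<in>function_field X. y \<noteq> 0 \<and> E (function_field X) = (*) y ` function_field X \<and> E' (function_field X) = (*) (y ^ n) ` function_field X"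
    using principal[OF X.function_field_point] .
  then obtain y0 where y0: "y0 \<in> function_field X" "y0 \<noteq> 0"
    "E (function_field X) = (*) y0 ` function_field X" "E' (function_field X) = (*) (y0 ^ n) ` function_field X"
    by (elim bexE conjE)
  have EX: "E (function_field X) = function_field X"
    unfolding y0(3) by (rule times_image_field[OF X.function_field_subring y0(1,2) X.function_field_inverse])
  have EX': "E' (function_field X) = function_field X"
    unfolding y0(4) using y0(1,2)
    by (intro times_image_field X.function_field_subring X.function_field_inverse is_subringD(7)) auto
  \<comment> \<open>Off the special fiber the second sheaf is the \<open>n\<close>-th power of the
    first, so the local ratios \<open>y' / y ^ n\<close> equal \<open>1\<close> for matching
    generators.\<close>
  have e_ex: "\<exists>e. \<forall>R\<in>fiber_points Y p t. \<exists>h. ratio_generator F F' n R h \<and>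
      h / e \<in> ring_units (\<Union>(fiber_points Y p t)) \<and> \<Phi> t (h / e) = 1" if t: "t \<noteq> 0" for t
  proof -
    interpret f: fiber Y \<A> p t X "\<Phi> t" using fib[OF t] .
    obtain e where e: "\<forall>R\<in>fiber_points Y p t. \<forall>y y'. y \<noteq> 0 \<longrightarrow> y' \<noteq> 0 \<longrightarrow> E (\<Phi> t ` R) = (*) y ` \<Phi> t ` R \<longrightarrow>
        E' (\<Phi> t ` R) = (*) y' ` \<Phi> t ` R \<longrightarrow>
        (\<exists>h. ratio_generator F F' n R h \<and> h / e \<in> ring_units f.L \<and> \<Phi> t (h / e) = y' / y ^ n)"
      using f.ratio_on_fiber[OF F(1) F(2)[OF t] EX F'(1) F'(2)[OF t] EX', of n] by (elim exE conjE)
    have "\<exists>h. ratio_generator F F' n R h \<and> h / e \<in> ring_units f.L \<and> \<Phi> t (h / e) = 1" if R: "R \<in> fiber_points Y p t" for R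
    proof -
      obtain y where y: "y \<noteq> 0" "E (\<Phi> t ` R) = (*) y ` \<Phi> t ` R" "E' (\<Phi> t ` R) = (*) (y ^ n) ` \<Phi> t ` R"
        using principal[OF f.phi_image_point[OF R]] by (elim bexE conjE)
      have "y ^ n \<noteq> 0" using y(1) by simp
      from e[rule_format, OF R y(1) this y(2,3)] show ?thesis using y(1) by simp
    qed
    then show ?thesis unfolding f.L_def by blast
  qed
  define e where "e t = (SOME e. \<forall>R\<in>fiber_points Y p t. \<exists>h. ratio_generator F F' n R h \<and>
      h / e \<in> ring_units (\<Union>(fiber_points Y p t)) \<and> \<Phi> t (h / e) = 1)" for t
  have e: "\<forall>R\<in>fiber_points Y p t. \<exists>h. ratio_generator F F' n R h \<and>
      h / e t \<in> ring_units (\<Union>(fiber_points Y p t)) \<and> \<Phi> t (h / e t) = 1" if t: "t \<noteq> 0" for t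
    unfolding e_def by (rule someI_ex[OF e_ex[OF t]])
  interpret seesaw Y \<A> p F F' n X \<Phi> e
  proof (rule seesaw.intro[OF A seesaw_axioms.intro])
    show "p \<in> R" if "R \<in> points Y" for R using Y(2) that by (simp add: regular_function_def)
    show "divisorial_sheaf Y F" "divisorial_sheaf Y F'" by fact+
    show "fiber Y \<A> p t X (\<Phi> t)" if "t \<noteq> 0" for t by (rule fib[OF that])
    show "\<exists>h. ratio_generator F F' n R h \<and> h / e t \<in> ring_units (\<Union>(fiber_points Y p t)) \<and> \<Phi> t (h / e t) = 1"
      if "t \<noteq> 0" "R \<in> fiber_points Y p t" for t R using e[OF that(1)] that(2) by (rule bspec)
  next
    fix x assume *: "\<And>R. R \<in> points X \<Longrightarrow> x \<in> R"
    show "x \<in> range (scalar X)"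
      by (rule projective_global_functions[OF X(1) *])
  qed
  obtain s where s: "s \<noteq> 0" "\<forall>Q\<in>points Y. (\<forall>c. p - scalar Y c \<notin> max_ideal Q) \<longrightarrow> ratio_generator F F' n Q s"
    using horizontal_generator by (elim exE conjE)
  obtain e0 where e0: "ratio_generator F F' n c.L e0"
    and ratio: "\<forall>R\<in>fiber_points Y p 0. \<forall>y y'. y \<noteq> 0 \<longrightarrow> y' \<noteq> 0 \<longrightarrow> E0 (\<phi> ` R) = (*) y ` \<phi> ` R \<longrightarrow>
        E0' (\<phi> ` R) = (*) y' ` \<phi> ` R \<longrightarrow>
        (\<exists>h. ratio_generator F F' n R h \<and> h / e0 \<in> ring_units c.L \<and> \<phi> (h / e0) = y' / y ^ n)"
    using c.ratio_on_fiber[OF F(1,3) gen(1) F'(1,3) gen(2), of n] by (elim exE conjE)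
  have p0: "p \<noteq> 0" using pt_nonzero[of 0] by (simp add: Y.sc_0)
  \<comment> \<open>The function \<open>p\<close> generates a prime ideal at each point of the
    special fiber, because it generates the kernel of a map to a field.\<close>
  have order: "\<exists>k u. u \<in> ring_units R \<and> s = h * u * p powi k"
    if R: "R \<in> fiber_points Y p 0" and h: "ratio_generator F F' n R h" for R h
  proof (rule central_order[OF _ s(1) R h])
    show "ratio_generator F F' n Q s" if "Q \<in> points Y" "\<And>c. p - scalar Y c \<notin> max_ideal Q" for Q
      using s(2) that by simp
    fix y z assume yz: "y \<in> R" "z \<in> R" "y * z \<in> (*) p ` R"
    note RL = c.fiber_subset[OF R]
    obtain r where r: "r \<in> R" "y * z = p * r" using yz(3) by blast
    have "\<phi> y * \<phi> z = 0"
      using c.phi_kernelI[OF R r(1)] c.phi_mult[OF subsetD[OF RL yz(1)] subsetD[OF RL yz(2)]] r(2) by (simp add: Y.sc_0)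
    then consider "\<phi> y = 0" | "\<phi> z = 0" by auto
    then show "y \<in> (*) p ` R \<or> z \<in> (*) p ` R"
    proof cases
      case 1
      then show ?thesis using c.phi_kernelD[OF R yz(1)] by (auto simp: Y.sc_0)
    next
      case 2
      then show ?thesis using c.phi_kernelD[OF R yz(2)] by (auto simp: Y.sc_0)
    qed
  qed
  obtain k u where u: "u \<in> ring_units c.L" "s = e0 * u * p powi k" using order[OF c.generic e0] by (elim exE conjE)
  have e00: "e0 \<noteq> 0" using ratio_generator_nonzero[OF e0] .
  have pL: "p \<in> max_ideal c.L" using c.fiber_max[OF c.generic] by (simp add: Y.sc_0)
  \<comment> \<open>This makes the exponent of \<open>p\<close> unique, so it can be compared
    between the points of the special fiber.\<close>
  have p_unit: "j = 0" if "p powi j \<in> ring_units c.L" for j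
  proof (rule ccontr)
    assume "j \<noteq> 0"
    define m where "m = nat \<bar>j\<bar>"
    have m0: "m \<noteq> 0" using \<open>j \<noteq> 0\<close> by (simp add: m_def)
    have "p ^ m \<in> ring_units c.L"
    proof (cases "j \<ge> 0")
      case True
      then show ?thesis using that by (simp add: m_def power_int_def)
    next
      case False
      then have "p ^ m = inverse (p powi j)" by (simp add: m_def power_int_def power_inverse)
      then show ?thesis using ring_units_inverse[OF that] by simp
    qed
    moreover obtain i where i: "m = Suc i" using m0 not0_implies_Suc by blast
    have "p ^ i * p \<in> max_ideal c.L"
      using is_idealD(4)[OF local_subringD(2)[OF Y.point_local[OF c.fiber_point[OF c.generic]]] _ pL]
        c.Ld(7)[of p i] pL by (simp add: max_ideal_def)
    then have "p ^ m \<in> max_ideal c.L" by (simp add: i mult.commute)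
    ultimately show False by (simp add: max_ideal_def)
  qed
  have uL: "u \<in> c.L" using u(1) by (simp add: ring_units_def)
  define \<theta> where "\<theta> = \<phi> u"
  have "\<theta> \<in> function_field W" unfolding \<theta>_def using uL c.phi_image by blast
  moreover have "\<theta> \<noteq> 0" unfolding \<theta>_def using c.phi_unit_nonzero[OF u(1)] .
  moreover have "\<theta> * y ^ n / y' \<in> ring_units S"
    if S: "S \<in> points W" and y: "y \<noteq> 0" "y' \<noteq> 0" "E0 S = (*) y ` S" "E0' S = (*) y' ` S" for S y y'
  proof -
    obtain R where R: "R \<in> fiber_points Y p 0" "S = \<phi> ` R" using c.points_image[OF S] by blast
    obtain h where h: "ratio_generator F F' n R h" "h / e0 \<in> ring_units c.L" "\<phi> (h / e0) = y' / y ^ n"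
      using ratio[rule_format, OF R(1) y(1,2) y(3)[unfolded R(2)] y(4)[unfolded R(2)]] by (elim exE conjE)
    obtain j v where v: "v \<in> ring_units R" "s = h * v * p powi j" using order[OF R(1) h(1)] by (elim exE conjE)
    have h0: "h \<noteq> 0" using ratio_generator_nonzero[OF h(1)] .
    have vL: "v \<in> ring_units c.L" using v(1) ring_units_mono[OF c.fiber_subset[OF R(1)]] by blast
    then have v0: "v \<noteq> 0" by (simp add: ring_units_def)
    \<comment> \<open>The expressions of \<open>s\<close> at \<open>R\<close> and at the generic
      point of the fiber are compared inside \<open>L\<close>, where \<open>h / e0\<close>,
      \<open>u\<close> and \<open>v\<close> are units.\<close>
    have "p powi (j - k) = u / ((h / e0) * v)"
      using u(2) v(2) p0 h0 e00 v0 by (simp add: power_int_diff field_simps)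
    also have "\<dots> \<in> ring_units c.L"
      using ring_units_divide[OF c.L_subring u(1) ring_units_mult[OF c.L_subring h(2) vL]] .
    finally have "j = k" using p_unit by force
    then have "u = (h / e0) * v" using u(2) v(2) p0 e00 by (simp add: field_simps)
    then have "\<theta> = (y' / y ^ n) * \<phi> v"
      unfolding \<theta>_def using c.phi_mult[of "h / e0" v] h(2,3) vL by (simp add: ring_units_def)
    then have "\<theta> * y ^ n / y' = \<phi> v" using y(1,2) by simp
    moreover have "\<phi> v \<in> ring_units S"
      using c.unit_iff[OF R(1), of v] v(1) R(2) by (simp add: ring_units_def)
    ultimately show ?thesis by simp
  qed
  ultimately show ?thesis by blast
qed

subsection \<open>Discrete valuation rings\<close>

lemma in_ring_unitsD: "u \<in> ring_units R \<Longrightarrow> u \<in> R" "u \<in> ring_units R \<Longrightarrow> inverse u \<in> R" "u \<in> ring_units R \<Longrightarrow> u \<noteq> 0"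
  by (auto simp: ring_units_def)

lemma ring_units_powi: "is_subring R \<Longrightarrow> u \<in> ring_units R \<Longrightarrow> u powi n \<in> ring_units R"
  by (auto simp: power_int_def ring_units_power ring_units_inverse)

text \<open>A discrete valuation ring of the field \<open>K\<close> with uniformizer
  \<open>u\<close>, described by the property that each nonzero element of \<open>K\<close> is a
  unit times a power of \<open>u\<close>. This form is what the gradings and the principal ideal
  domain below provide.\<close>

locale dvr =
  fixes K S :: "'k::field set" and u :: 'k
  assumes S_subring: "is_subring S" and S_subset: "S \<subseteq> K" and K_subring: "is_subring K"
    and K_inverse: "x \<in> K \<Longrightarrow> inverse x \<in> K"
    and u_in: "u \<in> S" and u_nonunit: "u \<notin> ring_units S" and u_nonzero: "u \<noteq> 0"
    and order_exists: "f \<in> K \<Longrightarrow> f \<noteq> 0 \<Longrightarrow> \<exists>n::int. f * u powi n \<in> ring_units S"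
begin

lemmas Sd = is_subringD[OF S_subring]

lemma u_power_in: "n \<ge> 0 \<Longrightarrow> u powi n \<in> S"
  using Sd(7)[OF u_in] by (simp add: power_int_def)

lemma u_power_not_in: "n < 0 \<Longrightarrow> u powi n \<notin> S"
proof
  assume n: "n < 0" "u powi n \<in> S"
  have "u powi n * u powi (- n - 1) \<in> S" using n u_power_in[of "- n - 1"] by (intro Sd(3)) auto
  moreover have "u powi n * u powi (- n - 1) = inverse u"
    using u_nonzero by (simp flip: power_int_add add: power_int_minus)
  ultimately have "u \<in> ring_units S" using u_in u_nonzero by (simp add: ring_units_def)
  then show False using u_nonunit by simp
qed

lemma unit_u_power: "u powi n \<in> ring_units S \<Longrightarrow> n = 0"
proof (rule ccontr)
  assume n: "u powi n \<in> ring_units S" "n \<noteq> 0"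
  have "u powi n \<in> S" "u powi (- n) \<in> S"
    using in_ring_unitsD[OF n(1)] by (auto simp: power_int_minus)
  then show False using u_power_not_in[of n] u_power_not_in[of "- n"] n(2) by linarith
qed

lemma decompose:
  assumes "f \<in> K" "f \<noteq> 0"
  obtains n w where "w \<in> ring_units S" "f = w * u powi n"
proof -
  obtain n where n: "f * u powi n \<in> ring_units S" using order_exists[OF assms] by blast
  have "f = (f * u powi n) * u powi (- n)" using u_nonzero by (simp add: power_int_minus)
  then show ?thesis using that n by blast
qed

lemma in_iff:
  assumes "w \<in> ring_units S"
  shows "w * u powi n \<in> S \<longleftrightarrow> n \<ge> 0"
proof
  assume "w * u powi n \<in> S"
  then have "inverse w * (w * u powi n) \<in> S" using in_ring_unitsD(2)[OF assms] by (rule Sd(3)[rotated])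
  then have "u powi n \<in> S" using in_ring_unitsD(3)[OF assms] by (simp flip: mult.assoc)
  then show "n \<ge> 0" using u_power_not_in by force
next
  assume "n \<ge> 0"
  then show "w * u powi n \<in> S" using u_power_in in_ring_unitsD(1)[OF assms] by (intro Sd(3))
qed

lemma max_ideal_eq: "max_ideal S = {u * a | a. a \<in> S}"
proof
  show "max_ideal S \<subseteq> {u * a | a. a \<in> S}"
  proof
    fix x assume "x \<in> max_ideal S"
    then have x: "x \<in> S" "x \<notin> ring_units S" by (auto simp: max_ideal_def)
    show "x \<in> {u * a | a. a \<in> S}"
    proof (cases "x = 0")
      case True
      then show ?thesis using Sd(4) by (intro CollectI exI[of _ 0]) simp
    next
      case False
      obtain n w where w: "w \<in> ring_units S" "x = w * u powi n" using decompose[OF subsetD[OF S_subset x(1)] False] .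
      have "n \<ge> 0" using in_iff[OF w(1)] w(2) x(1) by simp
      moreover have "n \<noteq> 0" using w x(2) by auto
      ultimately have "w * u powi (n - 1) \<in> S" using in_iff[OF w(1), of "n - 1"] by simp
      moreover have "x = u * (w * u powi (n - 1))" using w(2) u_nonzero by (simp add: power_int_diff)
      ultimately show ?thesis by blast
    qed
  qed
  show "{u * a | a. a \<in> S} \<subseteq> max_ideal S"
  proof clarify
    fix a assume a: "a \<in> S"
    have "u * a \<notin> ring_units S"
    proof
      assume un: "u * a \<in> ring_units S"
      then have "a * inverse (u * a) \<in> S" using Sd(3)[OF a] in_ring_unitsD(2) by blast
      moreover have "a * inverse (u * a) = inverse u" using in_ring_unitsD(3)[OF un] by auto
      ultimately have "inverse u \<in> S" by (simp only:)
      then show False using u_in u_nonzero u_nonunit by (simp add: ring_units_def)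
    qed
    then show "u * a \<in> max_ideal S" using Sd(3)[OF u_in a] by (simp add: max_ideal_def)
  qed
qed

text \<open>The definite description in \<open>ord_at\<close> allows any generator \<open>v\<close>
  of the maximal ideal; it differs from \<open>u\<close> by a unit, so the exponent is
  unique.\<close>

lemma ord_at_eq:
  assumes w: "w \<in> ring_units S"
  shows "ord_at S (w * u powi n) = n"
  unfolding ord_at_def
proof (rule the_equality)
  show "\<exists>v. max_ideal S = {v * a | a. a \<in> S} \<and> w * u powi n * v powi (- n) \<in> ring_units S"
    using max_ideal_eq w u_nonzero by (intro exI[of _ u]) (simp add: power_int_minus mult.assoc)
  fix m assume "\<exists>v. max_ideal S = {v * a | a. a \<in> S} \<and> w * u powi n * v powi (- m) \<in> ring_units S"
  then obtain v where v: "max_ideal S = {v * a | a. a \<in> S}" "w * u powi n * v powi (- m) \<in> ring_units S" by blast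
  have "u * 1 \<in> max_ideal S" unfolding max_ideal_eq using Sd(1) by blast
  then obtain a where a: "a \<in> S" "u = v * a" unfolding v(1) by auto
  have "v * 1 \<in> max_ideal S" unfolding v(1) using Sd(1) by blast
  then obtain b where b: "b \<in> S" "v = u * b" unfolding max_ideal_eq by auto
  have b0: "b \<noteq> 0" "a \<noteq> 0" using a(2) b(2) u_nonzero by auto
  have "u * (b * a) = u * 1" using a(2) b(2) by (simp flip: mult.assoc)
  then have "b * a = 1" using u_nonzero by simp
  then have "inverse b = a" by (rule inverse_unique)
  then have bu: "b \<in> ring_units S" using a b b0 by (simp add: ring_units_def)
  have "(w * u powi n * v powi (- m)) / (w * b powi (- m)) \<in> ring_units S"
    using ring_units_divide[OF S_subring v(2) ring_units_mult[OF S_subring w ring_units_powi[OF S_subring bu]]] .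
  moreover have "(w * u powi n * v powi (- m)) / (w * b powi (- m)) = u powi (n - m)"
    using in_ring_unitsD(3)[OF w] b0 u_nonzero unfolding b(2)
    by (simp add: power_int_mult_distrib power_int_minus power_int_diff field_simps)
  ultimately show "m = n" using unit_u_power by force
qed

text \<open>A ring that contains an element of negative order contains the inverse of
  \<open>u\<close>, hence everything. So a point with such a local ring has only the generic point
  above it and is a prime divisor.\<close>

lemma overring:
  assumes T: "is_subring T" "S \<subseteq> T" "T \<subseteq> K"
  shows "T = S \<or> T = K"
proof (rule disjCI)
  assume "T \<noteq> K"
  note Td = is_subringD[OF T(1)]
  have iu: "inverse u \<notin> T"
  proof
    assume iu: "inverse u \<in> T"
    have pow: "u powi n \<in> T" for n
    proof (cases "n \<ge> 0")
      case True
      then show ?thesis using u_power_in T(2) by blast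
    next
      case False
      then have "u powi n = inverse u ^ nat (- n)" by (simp add: power_int_def power_inverse)
      then show ?thesis using Td(7)[OF iu] by simp
    qed
    have "f \<in> T" if f: "f \<in> K" for f
    proof (cases "f = 0")
      case False
      obtain n w where "w \<in> ring_units S" "f = w * u powi n" using decompose[OF f False] .
      then show ?thesis using Td(3)[OF _ pow] in_ring_unitsD(1) T(2) by blast
    qed (simp add: Td(4))
    then show False using T(3) \<open>T \<noteq> K\<close> by blast
  qed
  have "f \<in> S" if f: "f \<in> T" for f
  proof (cases "f = 0")
    case False
    obtain n w where w: "w \<in> ring_units S" "f = w * u powi n" using decompose[OF subsetD[OF T(3) f] False] .
    have "n \<ge> 0"
    proof (rule ccontr)
      assume "\<not> n \<ge> 0"
      then have "u powi (- n - 1) \<in> T" using u_power_in[of "- n - 1"] T(2) by auto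
      moreover have "inverse w \<in> T" using in_ring_unitsD(2)[OF w(1)] T(2) by blast
      ultimately have "f * inverse w * u powi (- n - 1) \<in> T" using f by (intro Td(3))
      moreover have "f * inverse w * u powi (- n - 1) = inverse u"
        unfolding w(2) using in_ring_unitsD(3)[OF w(1)] u_nonzero
        by (simp add: power_int_minus power_int_diff field_simps)
      ultimately show False using iu by simp
    qed
    then show ?thesis using in_iff[OF w(1)] w(2) by simp
  qed (simp add: Sd(4))
  then show "T = S" using T(2) by blast
qed

lemma proper: "S \<noteq> K"
  using u_power_not_in[of "-1"] K_inverse[OF subsetD[OF S_subset u_in]] by (auto simp: power_int_minus)

end

lemma dvr_prime_divisor:
  assumes "dvr (function_field X) S u" "S \<in> points X" "\<And>T. T \<in> points X \<Longrightarrow> is_subring T"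
  shows "S \<in> prime_divisors X"
proof -
  interpret dvr "function_field X" S u by fact
  have "T = S \<or> T = function_field X" if "T \<in> points X" "S \<subseteq> T" for T
    using overring[OF assms(3)[OF that(1)] that(2)] that(1) unfolding function_field_def by blast
  then show ?thesis unfolding prime_divisors_def using assms(2) proper by auto
qed

text \<open>The only prime divisor through its own generic point is that divisor itself, so the
  stalk is given by a single order condition.\<close>

lemma weil_sheaf_dvr:
  assumes "dvr (function_field X) S u" "S \<in> prime_divisors X"
  shows "weil_sheaf X E S = (*) (u powi (- E S)) ` S"
proof -
  interpret dvr "function_field X" S u by fact
  have over: "T = S" if "T \<in> prime_divisors X" "S \<subseteq> T" for T
    using assms(2) that unfolding prime_divisors_def by auto
  have uK: "u powi n \<in> function_field X" for n
  proof -
    have uu: "u \<in> ring_units (function_field X)"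
      using u_in S_subset K_inverse u_nonzero by (auto simp: ring_units_def)
    show ?thesis using in_ring_unitsD(1)[OF ring_units_powi[OF K_subring uu]] .
  qed
  have *: "f \<in> weil_sheaf X E S \<longleftrightarrow> f \<in> (*) (u powi (- E S)) ` S" if f: "f \<in> function_field X" for f
  proof (cases "f = 0")
    case True
    then show ?thesis using f Sd(4) by (auto simp: weil_sheaf_def intro!: image_eqI[of _ _ 0])
  next
    case False
    obtain n w where w: "w \<in> ring_units S" "f = w * u powi n" using decompose[OF f False] .
    have "f \<in> weil_sheaf X E S \<longleftrightarrow> n \<ge> - E S"
    proof
      assume "f \<in> weil_sheaf X E S"
      then show "n \<ge> - E S" unfolding weil_sheaf_def using False assms(2) ord_at_eq[OF w(1), of n] w(2) by auto
    next
      assume n: "n \<ge> - E S"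
      have "ord_at T f \<ge> - E T" if "T \<in> prime_divisors X" "S \<subseteq> T" for T
        unfolding over[OF that] w(2) ord_at_eq[OF w(1)] using n .
      then show "f \<in> weil_sheaf X E S" unfolding weil_sheaf_def using f by simp
    qed
    also have "\<dots> \<longleftrightarrow> w * u powi (n + E S) \<in> S" unfolding in_iff[OF w(1)] by linarith
    also have "\<dots> \<longleftrightarrow> f \<in> (*) (u powi (- E S)) ` S"
    proof
      assume *: "w * u powi (n + E S) \<in> S"
      have "f = u powi (- E S) * (w * u powi (n + E S))"
        using w(2) u_nonzero by (simp add: power_int_add power_int_minus field_simps)
      then show "f \<in> (*) (u powi (- E S)) ` S" using * by blast
    next
      assume "f \<in> (*) (u powi (- E S)) ` S"
      then obtain s where "s \<in> S" "f = u powi (- E S) * s" by blast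
      moreover from this have "s = w * u powi (n + E S)"
        using w(2) u_nonzero by (simp add: power_int_add power_int_minus field_simps)
      ultimately show "w * u powi (n + E S) \<in> S" by simp
    qed
    finally show ?thesis .
  qed
  have "(*) (u powi (- E S)) ` S \<subseteq> function_field X"
    using is_subringD(3)[OF K_subring uK] S_subset by blast
  moreover have "weil_sheaf X E S \<subseteq> function_field X" by (auto simp: weil_sheaf_def)
  ultimately show ?thesis using * by blast
qed

text \<open>
  A principal ideal domain is the intersection of its localizations at prime elements, and these
  are discrete valuation rings: the ideal generated by all \<open>z / g ^ k\<close> is principal, so \<open>z\<close> is divisible
  by only finitely many powers of \<open>g\<close>.
\<close>

lemma principal_ideal_domain_valuation:
  assumes E: "is_subring E" and pid: "\<And>I. is_ideal E I \<Longrightarrow> \<exists>w\<in>E. I = (*) w ` E"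
    and f: "f \<in> localization E {0}" "f \<notin> E"
  shows "\<exists>q g. is_prime_ideal E q \<and> dvr (localization E {0}) (localization E q) g \<and> f \<notin> localization E q"
proof -
  note Ed = is_subringD[OF E]
  interpret z: prime_localization E "{0}" using E is_prime_ideal_zero[OF E] by unfold_locales
  \<comment> \<open>The denominators of \<open>f\<close>. A prime containing all of them is a point
    at which \<open>f\<close> is not regular.\<close>
  define I where "I = {s \<in> E. s * f \<in> E}"
  have I: "is_ideal E I" unfolding I_def by (rule is_ideal_denominators[OF E])
  have "1 \<notin> I" using f(2) by (simp add: I_def)
  then obtain q where q: "is_prime_ideal E q" "I \<subseteq> q" using exists_prime_ideal[OF E I, of "{1}"] by auto
  interpret q: prime_localization E q using E q(1) by unfold_locales
  obtain g where g: "g \<in> E" "q = (*) g ` E" using pid[OF is_prime_idealD(1)[OF q(1)]] by blast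
  obtain b s where f': "b \<in> E" "s \<in> E" "s \<notin> {0}" "f = b / s" using f(1) by (rule in_localizationE)
  have "s \<in> I" using f' by (simp add: I_def)
  then have "s \<in> q" using q(2) by blast
  then have g0: "g \<noteq> 0" using f'(3) g(2) by auto
  have gq: "g \<in> q" using g Ed(1) by (metis image_eqI mult.right_neutral)
  have fnot: "f \<notin> localization E q"
  proof
    assume "f \<in> localization E q"
    then obtain a r where ar: "a \<in> E" "r \<in> E" "r \<notin> q" "f = a / r" by (rule in_localizationE)
    then have "r \<noteq> 0" using q.denominators(3) by blast
    then have "r \<in> I" using ar by (simp add: I_def)
    then show False using q(2) ar(3) by blast
  qed
  have finite_order: "\<exists>n. \<exists>y\<in>E - q. z = g ^ n * y" if z: "z \<in> E" "z \<noteq> 0" for z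
  proof (rule ccontr)
    assume no: "\<not> ?thesis"
    have all: "z \<in> (*) (g ^ n) ` E" for n
    proof (induction n)
      case 0
      show ?case using z(1) by simp
    next
      case (Suc n)
      then obtain y where y: "y \<in> E" "z = g ^ n * y" by blast
      then have "y \<in> q" using no by blast
      then obtain x where "x \<in> E" "y = g * x" unfolding g(2) by blast
      then have "z = g ^ Suc n * x" using y(2) by (simp add: ac_simps)
      then show ?case using \<open>x \<in> E\<close> by blast
    qed
    define J where "J = {c * (z / g ^ n) | c n. c \<in> E}"
    have zn: "z / g ^ n \<in> E" for n using all[of n] g0 by auto
    have J: "is_ideal E J"
      unfolding is_ideal_def
    proof (intro conjI ballI)
      show "J \<subseteq> E" unfolding J_def using Ed(3) zn by blast
      show "0 \<in> J" unfolding J_def using Ed(4) by (intro CollectI exI[of _ 0]) auto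
      fix x assume "x \<in> J"
      then obtain c n where x: "c \<in> E" "x = c * (z / g ^ n)" unfolding J_def by blast
      { fix y assume "y \<in> J"
        then obtain d m where y: "d \<in> E" "y = d * (z / g ^ m)" unfolding J_def by blast
        have "x + y = (c * g ^ m + d * g ^ n) * (z / g ^ (n + m))"
          unfolding x y using g0 by (simp add: power_add field_simps)
        moreover have "c * g ^ m + d * g ^ n \<in> E" using x y g(1) by (intro Ed(3,6,7))
        ultimately show "x + y \<in> J" unfolding J_def by blast }
      { fix a assume "a \<in> E"
        then have "a * c \<in> E" using x(1) by (rule Ed(3))
        then show "a * x \<in> J" unfolding J_def x(2) by (intro CollectI exI[of _ "a * c"] exI[of _ n]) simp }
    qed
    then obtain w where w: "w \<in> E" "J = (*) w ` E" using pid by blast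
    have "w \<in> J" unfolding w(2) using Ed(1) by (metis image_eqI mult.right_neutral)
    then obtain c n where c: "c \<in> E" "w = c * (z / g ^ n)" unfolding J_def by blast
    have "z / g ^ Suc n \<in> J" unfolding J_def using Ed(1) by (metis (mono_tags, lifting) CollectI mult_1)
    then obtain e where e: "e \<in> E" "z / g ^ Suc n = w * e" unfolding w(2) by blast
    \<comment> \<open>The generator of \<open>J\<close> is \<open>c * (z / g ^ n)\<close>, and the
      next quotient \<open>z / g ^ Suc n\<close> is a multiple of it; cancelling makes
      \<open>g\<close> a unit.\<close>
    have "g * (c * e) = 1" using e(2) unfolding c(2) using g0 z(2) by (simp add: field_simps)
    moreover have "g * (c * e) \<in> q" unfolding g(2) using Ed(3)[OF c(1) e(1)] by blast
    ultimately show False using is_prime_idealD(2)[OF q(1)] by simp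
  qed
  have "dvr (localization E {0}) (localization E q) g"
  proof
    show "is_subring (localization E q)" "is_subring (localization E {0})" by (rule q.subring z.subring)+
    show "localization E q \<subseteq> localization E {0}"
      using localization_antimono[of "{0}" q E] is_prime_idealD(4)[OF q(1)] by blast
    show "inverse x \<in> localization E {0}" if x: "x \<in> localization E {0}" for x
    proof -
      obtain a r where a: "a \<in> E" "r \<in> E" "r \<notin> {0}" "x = a / r" using x by (rule in_localizationE)
      show ?thesis
      proof (cases "a = 0")
        case True
        then show ?thesis using a is_subringD(4)[OF z.subring] by simp
      next
        case False
        then show ?thesis using a in_localizationI[of r E a "{0}"] by simp
      qed
    qed
    show "g \<in> localization E q" using g(1) q.base_subset by blast
    show "g \<notin> ring_units (localization E q)"
      using q.max_ideal_Int gq by (auto simp: max_ideal_def)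
    show "g \<noteq> 0" by fact
    fix x assume x: "x \<in> localization E {0}" "x \<noteq> 0"
    obtain a r where a: "a \<in> E" "r \<in> E" "r \<notin> {0}" "x = a / r" using x(1) by (rule in_localizationE)
    have a0: "a \<noteq> 0" "r \<noteq> 0" using a x(2) by auto
    obtain n y where y: "y \<in> E - q" "a = g ^ n * y" using finite_order[OF a(1) a0(1)] by blast
    obtain m w where w: "w \<in> E - q" "r = g ^ m * w" using finite_order[OF a(2) a0(2)] by blast
    have "x * g powi (int m - int n) = y / w"
      unfolding a(4) y(2) w(2) using g0 by (simp add: power_int_diff)
    moreover have "y / w \<in> ring_units (localization E q)" unfolding q.units using y(1) w(1) by blast
    ultimately show "\<exists>n::int. x * g powi n \<in> ring_units (localization E q)" by metis
  qed
  then show ?thesis using q(1) fnot by blast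
qed

subsection \<open>Characters of the torus\<close>

definition poly_embed :: "((nat \<Rightarrow>\<^sub>0 nat) \<Rightarrow>\<^sub>0 complex) \<Rightarrow> toric_field" where
  "poly_embed a = Fract a 1"

lemma poly_embed_add: "poly_embed (a + b) = poly_embed a + poly_embed b"
  and poly_embed_mult: "poly_embed (a * b) = poly_embed a * poly_embed b"
  and poly_embed_eq_0_iff: "poly_embed a = 0 \<longleftrightarrow> a = 0"
  and poly_embed_1: "poly_embed 1 = 1"
  by (simp_all add: poly_embed_def Zero_fract_def One_fract_def eq_fract)

lemma poly_embed_0: "poly_embed 0 = 0"
  by (simp add: poly_embed_eq_0_iff)

lemma poly_embed_sum: "poly_embed (sum f F) = (\<Sum>x\<in>F. poly_embed (f x))"
  by (induction F rule: infinite_finite_induct) (auto simp: poly_embed_0 poly_embed_add)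

lemma poly_embed_prod: "poly_embed (prod f F) = (\<Prod>x\<in>F. poly_embed (f x))"
  by (induction F rule: infinite_finite_induct) (auto simp: poly_embed_1 poly_embed_mult)

lemma poly_embed_power: "poly_embed (a ^ n) = poly_embed a ^ n"
  by (induction n) (auto simp: poly_embed_1 poly_embed_mult)

lemma toric_scalar_embed: "toric_scalar c = poly_embed (Poly_Mapping.single 0 c)"
  by (simp add: toric_scalar_def poly_embed_def)

interpretation toric: scalars toric_scalar
proof
  show "toric_scalar 1 = 1"
    unfolding toric_scalar_embed by (simp add: poly_embed_1)
  fix a b
  show "toric_scalar (a + b) = toric_scalar a + toric_scalar b"
    unfolding toric_scalar_embed by (simp add: single_add flip: poly_embed_add)
  show "toric_scalar (a * b) = toric_scalar a * toric_scalar b"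
    unfolding toric_scalar_embed by (simp add: mult_single flip: poly_embed_mult)
qed

lemma single_power: "Poly_Mapping.single k (1::complex) ^ n = Poly_Mapping.single (of_nat n * k) 1"
  for k :: "nat \<Rightarrow>\<^sub>0 nat"
  by (induction n) (auto simp: mult_single algebra_simps)

text \<open>The product of finitely supported functions is convolution, for which multiplication by
  \<open>of_nat k\<close> is the \<open>k\<close>-fold sum.\<close>

definition exponent :: "('d::finite \<Rightarrow> nat) \<Rightarrow> nat \<Rightarrow>\<^sub>0 nat" where
  "exponent n = (\<Sum>i\<in>UNIV. of_nat (n i) * Poly_Mapping.single (to_nat i) 1)"

lemma prod_single: "(\<Prod>i\<in>F. Poly_Mapping.single (f i) (1::complex)) = Poly_Mapping.single (\<Sum>i\<in>F. f i) 1"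
  for f :: "'d \<Rightarrow> nat \<Rightarrow>\<^sub>0 nat"
  by (induction F rule: infinite_finite_induct) (auto simp: mult_single)

lemma torus_coordinate_nonzero: "torus_coordinate i \<noteq> 0"
proof -
  have "torus_coordinate i = poly_embed (Poly_Mapping.single (Poly_Mapping.single (to_nat i) 1) 1)"
    by (simp add: torus_coordinate_def poly_embed_def)
  moreover have "Poly_Mapping.single (Poly_Mapping.single (to_nat i) 1) 1 \<noteq> (0 :: (nat \<Rightarrow>\<^sub>0 nat) \<Rightarrow>\<^sub>0 complex)"
    by (metis lookup_single_eq lookup_zero one_neq_zero)
  ultimately show ?thesis by (simp add: poly_embed_eq_0_iff)
qed

lemma coordinate_monomial:
  "(\<Prod>i\<in>UNIV. torus_coordinate i ^ n i) = poly_embed (Poly_Mapping.single (exponent n) 1)"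
  for n :: "'d::finite \<Rightarrow> nat"
proof -
  have "torus_coordinate i ^ n i = poly_embed (Poly_Mapping.single (of_nat (n i) * Poly_Mapping.single (to_nat i) 1) 1)" for i :: 'd
    by (simp add: torus_coordinate_def flip: single_power poly_embed_def poly_embed_power)
  then show ?thesis
    by (simp add: exponent_def flip: poly_embed_prod prod_single)
qed

lemma lookup_of_nat_mult: "Poly_Mapping.lookup (of_nat k * f) j = k * Poly_Mapping.lookup f j"
  for f :: "nat \<Rightarrow>\<^sub>0 nat"
  by (induction k) (auto simp: algebra_simps lookup_add)

lemma lookup_exponent: "Poly_Mapping.lookup (exponent n) (to_nat i) = n i"
proof -
  have "Poly_Mapping.lookup (exponent n) (to_nat i) = (\<Sum>j\<in>UNIV. if j = i then n j else 0)"
    unfolding exponent_def lookup_sum lookup_of_nat_mult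
    by (intro sum.cong) (auto simp: lookup_single when_def)
  then show ?thesis by simp
qed

lemma character_add: "character (m + n) = character m * character n"
  by (simp add: character_def power_int_add torus_coordinate_nonzero prod.distrib)

lemma character_0: "character 0 = 1"
  by (simp add: character_def)

lemma character_nonzero: "character m \<noteq> 0"
  by (simp add: character_def torus_coordinate_nonzero)

lemma character_uminus: "character (- m) = inverse (character m)"
  using character_add[of m "- m"] by (simp add: character_0 inverse_unique)

text \<open>Multiplication by one large character turns the given ones into distinct monomials of
  the polynomial ring, where coefficients can be read off.\<close>

lemma character_independent:
  fixes c :: "int ^ 'd \<Rightarrow> complex"
  assumes M: "finite M" and zero: "(\<Sum>m\<in>M. toric_scalar (c m) * character m) = 0"
  shows "\<forall>m\<in>M. c m = 0"
proof -
  \<comment> \<open>This shift dominates all negative exponents in \<open>M\<close>.\<close>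
  define N :: "int ^ 'd" where "N = (\<chi> i. \<Sum>m\<in>M. \<bar>m $ i\<bar>)"
  define E where "E m = exponent (\<lambda>i. nat ((m + N) $ i))" for m
  have nonneg: "0 \<le> (m + N) $ i" if "m \<in> M" for m i
  proof -
    have "\<bar>m $ i\<bar> \<le> (\<Sum>m\<in>M. \<bar>m $ i\<bar>)" using M that by (intro member_le_sum) auto
    then show ?thesis by (simp add: N_def)
  qed
  have char: "character (m + N) = poly_embed (Poly_Mapping.single (E m) 1)" if m: "m \<in> M" for m
  proof -
    have "character (m + N) = (\<Prod>i\<in>UNIV. torus_coordinate i ^ nat ((m + N) $ i))"
      unfolding character_def using nonneg[OF m] by (intro prod.cong refl) (simp add: power_int_def)
    then show ?thesis unfolding E_def coordinate_monomial .
  qed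
  have inj: "inj_on E M"
  proof (rule inj_onI)
    fix m n assume mn: "m \<in> M" "n \<in> M" "E m = E n"
    have "nat ((m + N) $ i) = nat ((n + N) $ i)" for i
      using mn(3) unfolding E_def by (metis lookup_exponent)
    then have "(m + N) $ i = (n + N) $ i" for i
      using nonneg[OF mn(1)] nonneg[OF mn(2)] by (metis eq_nat_nat_iff)
    then show "m = n" by (simp add: vec_eq_iff)
  qed
  have "0 = (\<Sum>m\<in>M. toric_scalar (c m) * character m) * character N" using zero by simp
  also have "\<dots> = (\<Sum>m\<in>M. toric_scalar (c m) * character (m + N))"
    by (simp add: sum_distrib_right character_add mult.assoc)
  also have "\<dots> = (\<Sum>m\<in>M. poly_embed (Poly_Mapping.single (E m) (c m)))"
    by (intro sum.cong refl) (simp add: char toric_scalar_embed mult_single flip: poly_embed_mult)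
  also have "\<dots> = poly_embed (\<Sum>m\<in>M. Poly_Mapping.single (E m) (c m))" by (simp add: poly_embed_sum)
  finally have z: "(\<Sum>m\<in>M. Poly_Mapping.single (E m) (c m)) = 0" using poly_embed_eq_0_iff by metis
  show ?thesis
  proof
    fix m assume m: "m \<in> M"
    have "0 = Poly_Mapping.lookup (\<Sum>m\<in>M. Poly_Mapping.single (E m) (c m)) (E m)" using z by simp
    also have "\<dots> = (\<Sum>n\<in>M. if n = m then c n else 0)"
      unfolding lookup_sum using inj m by (intro sum.cong refl) (auto simp: lookup_single when_def inj_on_def)
    also have "\<dots> = c m" using M m by simp
    finally show "c m = 0" ..
  qed
qed

subsection \<open>Spaces of Laurent polynomials with given exponents\<close>

definition laurent :: "(int ^ 'd) set \<Rightarrow> toric_field set" where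
  "laurent M = toric.lin_span (character ` M)"

lemma laurent_iff:
  "x \<in> laurent M \<longleftrightarrow> (\<exists>N c. finite N \<and> N \<subseteq> M \<and> (\<forall>m\<in>N. c m \<noteq> 0) \<and> x = (\<Sum>m\<in>N. toric_scalar (c m) * character m))"
proof
  assume "x \<in> laurent M"
  then obtain H c where H: "finite H" "H \<subseteq> character ` M" "x = (\<Sum>z\<in>H. toric_scalar (c z) * z)"
    unfolding laurent_def toric.lin_span_def by blast
  from H(2) obtain N where N: "N \<subseteq> M" "inj_on character N" "H = character ` N" using subset_image_inj by metis
  have fin: "finite N" using H(1) N(2,3) finite_image_iff by blast
  have "x = (\<Sum>m\<in>N. toric_scalar (c (character m)) * character m)"
    unfolding H(3) N(3) by (simp add: sum.reindex[OF N(2)])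
  also have "\<dots> = (\<Sum>m\<in>{m\<in>N. c (character m) \<noteq> 0}. toric_scalar (c (character m)) * character m)"
    using fin by (intro sum.mono_neutral_right) (auto simp: toric.sc_0)
  finally show "\<exists>N c. finite N \<and> N \<subseteq> M \<and> (\<forall>m\<in>N. c m \<noteq> 0) \<and> x = (\<Sum>m\<in>N. toric_scalar (c m) * character m)"
    using fin N(1) by (intro exI[of _ "{m\<in>N. c (character m) \<noteq> 0}"] exI[of _ "\<lambda>m. c (character m)"]) auto
next
  assume "\<exists>N c. finite N \<and> N \<subseteq> M \<and> (\<forall>m\<in>N. c m \<noteq> 0) \<and> x = (\<Sum>m\<in>N. toric_scalar (c m) * character m)"
  then obtain N c where N: "N \<subseteq> M" "x = (\<Sum>m\<in>N. toric_scalar (c m) * character m)" by blast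
  show "x \<in> laurent M"
    unfolding N(2) laurent_def using N(1) by (intro toric.lin_span_sum toric.lin_span_single) auto
qed

lemma laurentE:
  assumes "x \<in> laurent M"
  obtains N c where "finite N" "N \<subseteq> M" "\<forall>m\<in>N. c m \<noteq> 0" "x = (\<Sum>m\<in>N. toric_scalar (c m) * character m)"
  using assms[unfolded laurent_iff] by (elim exE conjE)

lemma laurent_character: "m \<in> M \<Longrightarrow> character m \<in> laurent M"
  unfolding laurent_def by (intro toric.lin_span_base) blast

lemma laurent_0: "0 \<in> laurent M"
  and laurent_add: "x \<in> laurent M \<Longrightarrow> y \<in> laurent M \<Longrightarrow> x + y \<in> laurent M"
  and laurent_scale: "x \<in> laurent M \<Longrightarrow> toric_scalar c * x \<in> laurent M"
  unfolding laurent_def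
  using toric.lin_span_zero toric.lin_span_add toric.lin_span_scale by auto

lemma laurent_sum: "(\<And>i. i \<in> I \<Longrightarrow> f i \<in> laurent M) \<Longrightarrow> sum f I \<in> laurent M"
  unfolding laurent_def by (rule toric.lin_span_sum)

lemma laurent_diff: "x \<in> laurent M \<Longrightarrow> y \<in> laurent M \<Longrightarrow> x - y \<in> laurent M"
  using laurent_add[of x M "toric_scalar (- 1) * y"] laurent_scale[of y M "- 1"]
  by (simp add: toric.sc_minus toric.sc_1)

lemma laurent_mono: "M \<subseteq> N \<Longrightarrow> laurent M \<subseteq> laurent N"
  unfolding laurent_def toric.lin_span_def by blast

lemma laurent_mult:
  assumes "x \<in> laurent M" "y \<in> laurent N" "\<And>m n. m \<in> M \<Longrightarrow> n \<in> N \<Longrightarrow> m + n \<in> L"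
  shows "x * y \<in> laurent L"
  using assms(1,2) unfolding laurent_def
proof (rule toric.lin_span_mult)
  fix z w :: toric_field assume "z \<in> character ` M" "w \<in> character ` N"
  then obtain m n where "m \<in> M" "n \<in> N" "z * w = character (m + n)" by (auto simp: character_add)
  then show "z * w \<in> toric.lin_span (character ` L)" using assms(3) by (auto intro: toric.lin_span_base)
qed

text \<open>By linear independence of the characters, an element determines its exponents with
  nonzero coefficients. This makes degrees and orders of Laurent polynomials well defined.\<close>

lemma laurent_support:
  fixes c :: "int ^ 'd \<Rightarrow> complex"
  assumes N: "finite N" "\<forall>m\<in>N. c m \<noteq> 0" and x: "(\<Sum>m\<in>N. toric_scalar (c m) * character m) \<in> laurent M"
  shows "N \<subseteq> M"
proof -
  obtain K d where K: "finite K" "K \<subseteq> M" "(\<Sum>m\<in>N. toric_scalar (c m) * character m) = (\<Sum>m\<in>K. toric_scalar (d m) * character m)"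
    using x by (rule laurentE)
  define e where "e m = (if m \<in> N then c m else 0) - (if m \<in> K then d m else 0)" for m
  have "(\<Sum>m\<in>N \<union> K. toric_scalar (e m) * character m)
    = (\<Sum>m\<in>N \<union> K. if m \<in> N then toric_scalar (c m) * character m else 0)
      - (\<Sum>m\<in>N \<union> K. if m \<in> K then toric_scalar (d m) * character m else 0)"
    unfolding sum_subtractf[symmetric] by (intro sum.cong) (auto simp: e_def toric.sc_diff toric.sc_0 left_diff_distrib)
  also have "(\<Sum>m\<in>N \<union> K. if m \<in> N then toric_scalar (c m) * character m else 0) = (\<Sum>m\<in>N. toric_scalar (c m) * character m)"
    using N(1) K(1) by (intro sum.mono_neutral_cong_right) auto
  also have "(\<Sum>m\<in>N \<union> K. if m \<in> K then toric_scalar (d m) * character m else 0) = (\<Sum>m\<in>K. toric_scalar (d m) * character m)"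
    using N(1) K(1) by (intro sum.mono_neutral_cong_right) auto
  also have "(\<Sum>m\<in>N. toric_scalar (c m) * character m) - (\<Sum>m\<in>K. toric_scalar (d m) * character m) = 0" using K(3) by simp
  finally have z: "(\<Sum>m\<in>N \<union> K. toric_scalar (e m) * character m) = 0" .
  have e: "\<forall>m\<in>N \<union> K. e m = 0" using character_independent[OF _ z] N(1) K(1) by simp
  show ?thesis
  proof
    fix m assume m: "m \<in> N"
    then have "e m = 0" "c m \<noteq> 0" using e N(2) by auto
    then have "m \<in> K" using m by (auto simp: e_def split: if_splits)
    then show "m \<in> M" using K(2) by blast
  qed
qed

lemma laurent_Int: "x \<in> laurent M \<Longrightarrow> x \<in> laurent N \<Longrightarrow> x \<in> laurent (M \<inter> N)"
proof -
  assume "x \<in> laurent M" and x: "x \<in> laurent N"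
  then obtain K c where K: "finite K" "K \<subseteq> M" "\<forall>m\<in>K. c m \<noteq> 0" "x = (\<Sum>m\<in>K. toric_scalar (c m) * character m)"
    by (elim laurentE)
  have "K \<subseteq> N" using laurent_support[OF K(1,3)] x K(4) by simp
  then show "x \<in> laurent (M \<inter> N)"
    unfolding K(4) using K(2) by (intro laurent_sum laurent_scale laurent_character) auto
qed

lemma laurent_empty: "laurent {} = {0}"
  by (auto simp: laurent_iff)

lemma laurent_disjoint: "x \<in> laurent M \<Longrightarrow> x \<in> laurent N \<Longrightarrow> M \<inter> N = {} \<Longrightarrow> x = 0"
  using laurent_Int[of x M N] laurent_empty by auto

lemma laurent_split:
  assumes "x \<in> laurent (M \<union> N)"
  shows "\<exists>y\<in>laurent M. \<exists>z\<in>laurent N. x = y + z"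
proof -
  obtain K c where K: "finite K" "K \<subseteq> M \<union> N" "x = (\<Sum>m\<in>K. toric_scalar (c m) * character m)" using assms by (rule laurentE)
  have "x = (\<Sum>m\<in>K \<inter> M. toric_scalar (c m) * character m) + (\<Sum>m\<in>K - M. toric_scalar (c m) * character m)"
    unfolding K(3) using K(1) by (rule sum.Int_Diff)
  moreover have "(\<Sum>m\<in>K \<inter> M. toric_scalar (c m) * character m) \<in> laurent M"
    by (intro laurent_sum laurent_scale laurent_character) auto
  moreover have "(\<Sum>m\<in>K - M. toric_scalar (c m) * character m) \<in> laurent N"
    using K(2) by (intro laurent_sum laurent_scale laurent_character) auto
  ultimately show ?thesis by blast
qed

lemma laurent_zero_exponent: "laurent {0 :: int ^ 'd} = range toric_scalar"
proof
  show "laurent {0 :: int ^ 'd} \<subseteq> range toric_scalar"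
  proof
    fix x assume "x \<in> laurent {0 :: int ^ 'd}"
    then obtain N c where N: "N \<subseteq> {0 :: int ^ 'd}" "x = (\<Sum>m\<in>N. toric_scalar (c m) * character m)" by (rule laurentE)
    then consider "N = {}" | "N = {0}" by blast
    then show "x \<in> range toric_scalar"
      by cases (use N(2) toric.sc_0 in \<open>auto simp: character_0 intro: range_eqI[of _ _ 0]\<close>)
  qed
  show "range toric_scalar \<subseteq> laurent {0 :: int ^ 'd}"
    using laurent_scale[OF laurent_character[of 0 "{0 :: int ^ 'd}"]] by (auto simp: character_0)
qed

lemma is_subring_laurent:
  assumes "0 \<in> M" "\<And>m n. m \<in> M \<Longrightarrow> n \<in> M \<Longrightarrow> m + n \<in> M"
  shows "is_subring (laurent M)"
  unfolding is_subring_def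
  using laurent_character[OF assms(1)] laurent_diff[of _ M] laurent_mult[of _ M _ M M, OF _ _ assms(2)]
  by (auto simp: character_0)

lemma generated_characters:
  assumes "0 \<in> M" "\<And>m n. m \<in> M \<Longrightarrow> n \<in> M \<Longrightarrow> m + n \<in> M"
  shows "generated_algebra toric_scalar (character ` M) = laurent M"
proof
  have "range toric_scalar \<subseteq> laurent M"
    using laurent_scale[OF laurent_character[OF assms(1)]] by (auto simp: character_0)
  then have "subalgebra toric_scalar (laurent M)"
    unfolding subalgebra_def using laurent_add laurent_mult[of _ M _ M M, OF _ _ assms(2)] by auto
  then show "generated_algebra toric_scalar (character ` M) \<subseteq> laurent M"
    by (rule toric.generated_subset) (use laurent_character in blast)
  show "laurent M \<subseteq> generated_algebra toric_scalar (character ` M)"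
  proof
    fix x assume "x \<in> laurent M"
    then obtain N c where N: "N \<subseteq> M" "x = (\<Sum>m\<in>N. toric_scalar (c m) * character m)" by (rule laurentE)
    show "x \<in> generated_algebra toric_scalar (character ` M)"
      unfolding N(2) using N(1) toric.generators_subset[of "character ` M"]
      by (intro is_subring_sum[OF toric.is_subring_generated] is_subringD(3)[OF toric.is_subring_generated] toric.scalar_in_generated) auto
  qed
qed

lemma is_subring_torus: "is_subring (laurent UNIV)"
  by (rule is_subring_laurent) auto

subsection \<open>Gradings of the torus ring\<close>

text \<open>Used twice: with a coordinate of the exponent, to remove that variable from
  denominators, and with the pairing against the primitive generator of a ray, to obtain the
  valuation of its divisor. The exponent \<open>e\<close> of degree \<open>1\<close> gives an
  invertible homogeneous element, the uniformizer.\<close>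

locale grading =
  fixes l :: "int ^ 'd \<Rightarrow> int" and e :: "int ^ 'd" and T :: "toric_field set"
  assumes l_add: "l (m + n) = l m + l n" and l_e: "l e = 1" and T_eq: "T = laurent (UNIV :: (int ^ 'd) set)"
begin

lemma l_0: "l 0 = 0" using l_add[of 0 0] by simp

lemma l_uminus: "l (- m) = - l m" using l_add[of m "- m"] l_0 by simp

abbreviation "x \<equiv> character e"
abbreviation "level k \<equiv> laurent {m. l m = k}"
abbreviation "ge k \<equiv> laurent {m. l m \<ge> k}"
abbreviation "K \<equiv> localization T {0}"

lemma x_power: "x powi k \<in> level k"
proof -
  have nat: "x ^ n \<in> level (int n)" "inverse x ^ n \<in> level (- int n)" for n
  proof (induction n)
    case 0
    case 1
    show ?case using laurent_character[of 0 "{m. l m = 0}"] by (simp add: l_0 character_0)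
    case 2
    show ?case using laurent_character[of 0 "{m. l m = 0}"] by (simp add: l_0 character_0)
  next
    case (Suc n)
    case 1
    have "x * x ^ n \<in> level (int (Suc n))"
      by (rule laurent_mult[OF laurent_character[of e "{m. l m = 1}"] Suc(1)]) (auto simp: l_e l_add)
    then show ?case by simp
    case 2
    have "inverse x * inverse x ^ n \<in> level (- int (Suc n))"
      unfolding character_uminus[symmetric]
      by (rule laurent_mult[OF laurent_character[of "- e" "{m. l m = - 1}"]])
         (use Suc(2) in \<open>auto simp: l_e l_add l_uminus character_uminus\<close>)
    then show ?case by simp
  qed
  show ?thesis
  proof (cases "k \<ge> 0")
    case True
    then show ?thesis using nat(1)[of "nat k"] by (simp add: power_int_def)
  next
    case False
    then show ?thesis using nat(2)[of "nat (- k)"] by (simp add: power_int_def)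
  qed
qed

lemma level_ge: "level k \<subseteq> ge k"
  by (rule laurent_mono) auto

lemma ge_antimono: "k \<le> j \<Longrightarrow> ge j \<subseteq> ge k"
  by (rule laurent_mono) auto

lemma ge_mult: "a \<in> ge k \<Longrightarrow> b \<in> ge j \<Longrightarrow> a * b \<in> ge (k + j)"
  by (erule (1) laurent_mult) (auto simp: l_add)

lemma level_mult: "a \<in> level k \<Longrightarrow> b \<in> level j \<Longrightarrow> a * b \<in> level (k + j)"
  by (erule (1) laurent_mult) (auto simp: l_add)

lemma level_ge_disjoint: "a \<in> level k \<Longrightarrow> a \<in> ge (k + 1) \<Longrightarrow> a = 0"
  by (erule (1) laurent_disjoint) auto

lemma ge_split: "a \<in> ge k \<Longrightarrow> \<exists>b\<in>level k. \<exists>c\<in>ge (k + 1). a = b + c"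
proof -
  assume "a \<in> ge k"
  moreover have "{m. l m \<ge> k} = {m. l m = k} \<union> {m. l m \<ge> k + 1}" by auto
  ultimately show ?thesis using laurent_split[of a "{m. l m = k}" "{m. l m \<ge> k + 1}"] by simp
qed

text \<open>The homogeneous parts of lowest degree have a nonzero product, since they lie in a
  field. So the lowest degree is additive, as a valuation has to be.\<close>

lemma leading_mult:
  assumes "a \<in> ge k - ge (k + 1)" "b \<in> ge j - ge (j + 1)"
  shows "a * b \<in> ge (k + j) - ge (k + j + 1)"
proof -
  obtain a0 a1 where a: "a0 \<in> level k" "a1 \<in> ge (k + 1)" "a = a0 + a1" using ge_split assms(1) by blast
  obtain b0 b1 where b: "b0 \<in> level j" "b1 \<in> ge (j + 1)" "b = b0 + b1" using ge_split assms(2) by blast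
  have nz: "a0 \<noteq> 0" "b0 \<noteq> 0" using a b assms by auto
  have ab0: "a0 * b0 \<in> level (k + j)" using level_mult[OF a(1) b(1)] .
  have "a0 * b1 + a1 * b \<in> ge (k + j + 1)"
  proof (rule laurent_add)
    show "a0 * b1 \<in> ge (k + j + 1)" using ge_mult[OF subsetD[OF level_ge a(1)] b(2)] by (simp add: add.assoc)
    show "a1 * b \<in> ge (k + j + 1)" using ge_mult[OF a(2), of b j] assms(2) by (simp add: ac_simps)
  qed
  moreover have eq: "a * b - (a0 * b1 + a1 * b) = a0 * b0" unfolding a(3) b(3) by (simp add: algebra_simps)
  ultimately have "a0 * b0 \<in> ge (k + j + 1)" if "a * b \<in> ge (k + j + 1)"
    using laurent_diff[OF that] by metis
  then have "a * b \<notin> ge (k + j + 1)" using level_ge_disjoint[OF ab0] nz by auto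
  then show ?thesis using ge_mult[of a k b j] assms by blast
qed

lemma order_exists:
  assumes t: "t \<in> T" "t \<noteq> 0"
  shows "\<exists>k. t \<in> ge k - ge (k + 1)"
proof -
  obtain N and c :: "int ^ 'd \<Rightarrow> complex"
    where N: "finite N" "\<forall>m\<in>N. c m \<noteq> 0" "t = (\<Sum>m\<in>N. toric_scalar (c m) * character m)"
    using t(1)[unfolded T_eq] by (rule laurentE)
  have ne: "N \<noteq> {}" using N(3) t(2) by auto
  define k where "k = Min (l ` N)"
  have "k \<in> l ` N" unfolding k_def using N(1) ne by (intro Min_in) auto
  then obtain m where m: "m \<in> N" "l m = k" by blast
  have "k \<le> l m" if "m \<in> N" for m unfolding k_def using N(1) that by (intro Min_le) auto
  then have "t \<in> ge k" unfolding N(3) by (intro laurent_sum laurent_scale laurent_character) auto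
  moreover have "t \<notin> ge (k + 1)"
  proof
    assume "t \<in> ge (k + 1)"
    then have "N \<subseteq> {m. l m \<ge> k + 1}" using laurent_support[OF N(1,2)] N(3) by simp
    then show False using m by auto
  qed
  ultimately show ?thesis by blast
qed

lemma x_power_order: "x powi k \<in> ge k - ge (k + 1)"
  using x_power[of k] level_ge level_ge_disjoint[of "x powi k" k] character_nonzero[of e] by auto

lemma shift_order: "t \<in> ge k - ge (k + 1) \<Longrightarrow> t * x powi (- k) \<in> ge 0 - ge 1"
  using leading_mult[OF _ x_power_order[of "- k"], of t k] by simp

lemma ge_0_subring: "is_subring (ge 0)"
  by (rule is_subring_laurent) (auto simp: l_0 l_add)

lemma ge_1_prime: "is_prime_ideal (ge 0) (ge 1)"
  unfolding is_prime_ideal_def is_ideal_def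
proof (intro conjI ballI impI)
  show "ge 1 \<subseteq> ge 0" by (rule ge_antimono) simp
  show "0 \<in> ge 1" by (rule laurent_0)
  show "1 \<notin> ge 1" using x_power_order[of 0] by simp
  show "a + b \<in> ge 1" if "a \<in> ge 1" "b \<in> ge 1" for a b using that by (rule laurent_add)
  show "a * b \<in> ge 1" if "a \<in> ge 0" "b \<in> ge 1" for a b using ge_mult[OF that] by simp
  show "a \<in> ge 1 \<or> b \<in> ge 1" if "a \<in> ge 0" "b \<in> ge 0" "a * b \<in> ge 1" for a b
    using leading_mult[of a 0 b 0] that by auto
qed

text \<open>Identifies the ideal in the definition of \<open>ray_divisor\<close> with the elements
  of positive order.\<close>

lemma mod_span_ge: "mod_span (ge 0) (character ` {m. l m > 0}) = ge 1"
proof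
  show "mod_span (ge 0) (character ` {m. l m > 0}) \<subseteq> ge 1"
  proof
    fix y assume "y \<in> mod_span (ge 0) (character ` {m. l m > 0})"
    then obtain H c where H: "finite H" "H \<subseteq> character ` {m. l m > 0}" "\<forall>g\<in>H. c g \<in> ge 0" "y = (\<Sum>g\<in>H. c g * g)"
      by (rule mod_spanE)
    show "y \<in> ge 1" unfolding H(4)
    proof (rule laurent_sum)
      fix g assume g: "g \<in> H"
      then obtain m where "g = character m" "l m > 0" using H(2) by blast
      then have "g \<in> ge 1" using laurent_character[of m "{m. l m \<ge> 1}"] by simp
      then show "c g * g \<in> ge 1" using ge_mult[of "c g" 0 g 1] H(3) g by simp
    qed
  qed
  show "ge 1 \<subseteq> mod_span (ge 0) (character ` {m. l m > 0})"
  proof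
    fix y assume "y \<in> ge 1"
    then obtain N c where N: "finite N" "N \<subseteq> {m. l m \<ge> 1}" "y = (\<Sum>m\<in>N. toric_scalar (c m) * character m)" by (rule laurentE)
    have sc: "toric_scalar a \<in> ge 0" for a
      using laurent_scale[OF laurent_character[of 0 "{m. l m \<ge> 0}"], of a] by (simp add: character_0 l_0)
    have "(\<Sum>m\<in>F. toric_scalar (c m) * character m) \<in> mod_span (ge 0) (character ` {m. l m > 0})" if "finite F" "F \<subseteq> N" for F
      using that
    proof (induction F rule: finite_induct)
      case empty
      show ?case by (simp add: mod_span_zero)
    next
      case (insert m F)
      have "character m \<in> character ` {m. l m > 0}" using insert(4) N(2) by auto
      then have "toric_scalar (c m) * character m \<in> mod_span (ge 0) (character ` {m. l m > 0})"
        by (rule mod_span_single[OF ge_0_subring sc])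
      then show ?case using insert by (simp add: mod_span_add[OF ge_0_subring])
    qed
    then show "y \<in> mod_span (ge 0) (character ` {m. l m > 0})" using N(1,3) by simp
  qed
qed

lemma T_subring: "is_subring T"
  unfolding T_eq by (rule is_subring_torus)

lemma K_subring: "is_subring K"
proof -
  interpret prime_localization T "{0}"
    using T_subring is_prime_ideal_zero[OF T_subring] by unfold_locales
  show ?thesis by (rule subring)
qed

lemma K_inverse: "y \<in> K \<Longrightarrow> inverse y \<in> K"
proof -
  assume "y \<in> K"
  then obtain a r where a: "a \<in> T" "r \<in> T" "r \<notin> {0}" "y = a / r" by (rule in_localizationE)
  show ?thesis
  proof (cases "a = 0")
    case True
    then show ?thesis using a is_subringD(4)[OF K_subring] by simp
  next
    case False
    then show ?thesis using a in_localizationI[of r T a "{0}"] by simp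
  qed
qed

text \<open>The numerator and the denominator of a fraction are shifted to order zero by powers of
  \<open>x\<close>; the shifted elements are units of the localization.\<close>

lemma grading_dvr: "dvr K (localization (ge 0) (ge 1)) x"
proof -
  interpret prime_localization "ge 0" "ge 1" using ge_0_subring ge_1_prime by unfold_locales
  have x1: "x \<in> ge 1" using x_power[of 1] level_ge[of 1] by auto
  have sub: "ge 0 \<subseteq> T" unfolding T_eq by (rule laurent_mono) simp
  show ?thesis
  proof
    show "is_subring (localization (ge 0) (ge 1))" "is_subring K" by (rule subring K_subring)+
    show "localization (ge 0) (ge 1) \<subseteq> K"
    proof
      fix y assume "y \<in> localization (ge 0) (ge 1)"
      then obtain a s where "a \<in> ge 0" "s \<in> ge 0" "s \<notin> ge 1" "y = a / s" by (rule in_localizationE)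
      then show "y \<in> K" using sub laurent_0[of "{m. l m \<ge> 1}"] by (auto intro!: in_localizationI)
    qed
    show "inverse y \<in> K" if "y \<in> K" for y using that by (rule K_inverse)
    show "x \<in> localization (ge 0) (ge 1)" using x1 P(3) base_subset by blast
    show "x \<notin> ring_units (localization (ge 0) (ge 1))"
      using max_ideal_Int x1 by (auto simp: max_ideal_def)
    show "x \<noteq> 0" by (rule character_nonzero)
    fix f assume f: "f \<in> K" "f \<noteq> 0"
    obtain a r where a: "a \<in> T" "r \<in> T" "r \<notin> {0}" "f = a / r" using f(1) by (rule in_localizationE)
    then have "a \<noteq> 0" "r \<noteq> 0" using f(2) by auto
    then obtain k j where kj: "a \<in> ge k - ge (k + 1)" "r \<in> ge j - ge (j + 1)" using order_exists a(1,2) by meson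
    have "f * x powi (j - k) = (a * x powi (- k)) / (r * x powi (- j))"
      unfolding a(4) using character_nonzero[of e] by (simp add: power_int_diff power_int_minus field_simps)
    moreover have "(a * x powi (- k)) / (r * x powi (- j)) \<in> ring_units (localization (ge 0) (ge 1))"
      unfolding units using shift_order[OF kj(1)] shift_order[OF kj(2)] by blast
    ultimately show "\<exists>n::int. f * x powi n \<in> ring_units (localization (ge 0) (ge 1))" by metis
  qed
qed

text \<open>A denominator of order zero does not change the lowest degree, so a Laurent polynomial
  without pole along the divisor has no exponent of negative degree.\<close>

lemma regular_along_divisor:
  assumes "f \<in> T" "f \<in> localization (ge 0) (ge 1)"
  shows "f \<in> ge 0"
proof (cases "f = 0")
  case False
  obtain a s where as: "a \<in> ge 0" "s \<in> ge 0" "s \<notin> ge 1" "f = a / s" using assms(2) by (rule in_localizationE)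
  have "s \<noteq> 0" using as(3) laurent_0 by auto
  then have fs: "f * s = a" using as(4) by simp
  obtain k where k: "f \<in> ge k - ge (k + 1)" using order_exists[OF assms(1) False] by blast
  have "f * s \<notin> ge (k + 1)" using leading_mult[OF k, of s 0] as(2,3) by simp
  then have "\<not> k + 1 \<le> 0" using fs as(1) ge_antimono[of "k + 1" 0] by auto
  then show ?thesis using k ge_antimono[of 0 k] by auto
qed (simp add: laurent_0)

subsection \<open>Inverting all elements of degree zero\<close>

text \<open>The ring of Laurent polynomials in \<open>x\<close> over the fraction field of the
  degree zero part, because each character is a power of \<open>x\<close> times a character of
  degree zero.\<close>

definition E where "E = {t / s | t s. t \<in> T \<and> s \<in> level 0 \<and> s \<noteq> 0}"

lemma EI: "t \<in> T \<Longrightarrow> s \<in> level 0 \<Longrightarrow> s \<noteq> 0 \<Longrightarrow> t / s \<in> E"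
  unfolding E_def by blast

lemma EE:
  assumes "y \<in> E"
  obtains t s where "t \<in> T" "s \<in> level 0" "s \<noteq> 0" "y = t / s"
  using assms unfolding E_def by blast

lemma level_0_subring: "is_subring (level 0)"
  by (rule is_subring_laurent) (auto simp: l_0 l_add)

lemma level_T: "level k \<subseteq> T" and ge_T: "ge k \<subseteq> T"
  unfolding T_eq by (rule laurent_mono, simp)+

lemmas Td = is_subringD[OF T_subring]

lemma E_subring: "is_subring E"
  unfolding is_subring_def
proof (intro conjI ballI)
  have "1 / 1 \<in> E" using Td(1) is_subringD(1)[OF level_0_subring] by (intro EI) auto
  then show "1 \<in> E" by simp
  fix y z assume "y \<in> E" "z \<in> E"
  then obtain t s t' s' where y: "t \<in> T" "s \<in> level 0" "s \<noteq> 0" "y = t / s"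
    and z: "t' \<in> T" "s' \<in> level 0" "s' \<noteq> 0" "z = t' / s'" by (elim EE)
  have ss: "s * s' \<in> level 0" "s * s' \<noteq> 0" using is_subringD(3)[OF level_0_subring] y z by auto
  have sT: "s \<in> T" "s' \<in> T" using y z level_T by auto
  have "y - z = (t * s' - t' * s) / (s * s')" using y z by (simp add: field_simps)
  moreover have "t * s' - t' * s \<in> T" using y z sT by (intro Td(2,3))
  ultimately show "y - z \<in> E" using EI[OF _ ss] by metis
  have "y * z = (t * t') / (s * s')" using y z by simp
  then show "y * z \<in> E" using EI[OF Td(3)[OF y(1) z(1)] ss] by simp
qed

lemma T_subset_E: "T \<subseteq> E"
  using EI[of _ 1] is_subringD(1)[OF level_0_subring] by auto

lemma level_0_inverse: "s \<in> level 0 \<Longrightarrow> s \<noteq> 0 \<Longrightarrow> inverse s \<in> E"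
  using EI[of 1 s] Td(1) by (simp add: inverse_eq_divide)

lemma E_fractions: "localization E {0} = K"
proof
  show "K \<subseteq> localization E {0}" unfolding localization_def using T_subset_E by blast
  show "localization E {0} \<subseteq> K"
  proof
    fix y assume "y \<in> localization E {0}"
    then obtain a b where ab: "a \<in> E" "b \<in> E" "b \<notin> {0}" "y = a / b" by (rule in_localizationE)
    from ab(1) obtain t s where a: "t \<in> T" "s \<in> level 0" "s \<noteq> 0" "a = t / s" by (rule EE)
    from ab(2) obtain t' s' where b: "t' \<in> T" "s' \<in> level 0" "s' \<noteq> 0" "b = t' / s'" by (rule EE)
    have sT: "s \<in> T" "s' \<in> T" using a b level_T by auto
    have "y = (t * s') / (t' * s)" using ab(4) a(4) b(4) by simp
    moreover have "t' * s \<notin> {0}" using ab(3) a b by simp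
    moreover have "t * s' \<in> T" "t' * s \<in> T" using a b sT by (auto intro: Td(3))
    ultimately show "y \<in> K" using in_localizationI[of "t * s'" T "t' * s" "{0}"] by simp
  qed
qed

text \<open>
  The exponents of a Laurent polynomial lie in an interval, and an element of minimal length generates
  the ideal: the leading term is removed after multiplication by elements of degree zero, which are units.
\<close>

lemma E_principal:
  assumes I: "is_ideal E I"
  shows "\<exists>w\<in>E. I = (*) w ` E"
proof (cases "I = {0}")
  case True
  then show ?thesis using is_subringD(4)[OF E_subring] by (intro bexI[of _ 0]) auto
next
  case False
  note Id = is_idealD[OF I] and Ed = is_subringD[OF E_subring]
  \<comment> \<open>Elements whose degrees lie in the interval of length \<open>n\<close> that
    starts at \<open>k\<close>.\<close>
  define W where "W k n = laurent {m. k \<le> l m \<and> l m < k + int n}" for k n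
  have numerator: "\<exists>s\<in>level 0. s \<noteq> 0 \<and> s * y \<in> I \<and> s * y \<in> T" if y: "y \<in> I" for y
  proof -
    obtain t s where ts: "t \<in> T" "s \<in> level 0" "s \<noteq> 0" "y = t / s" using y Id(1) by (blast elim: EE)
    have "s \<in> E" using ts(2) level_T T_subset_E by blast
    then have "s * y \<in> I" using Id(4) y by blast
    moreover have "s * y \<in> T" using ts by simp
    ultimately show ?thesis using ts(2,3) by blast
  qed
  have in_W: "\<exists>k n. t \<in> W k n" if t: "t \<in> T" for t
  proof -
    obtain N and c :: "int ^ 'd \<Rightarrow> complex" where N: "finite N" "t = (\<Sum>m\<in>N. toric_scalar (c m) * character m)"
      using t[unfolded T_eq] by (rule laurentE)
    define k where "k = - (\<Sum>m\<in>N. \<bar>l m\<bar>)"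
    have "\<bar>l m\<bar> \<le> - k" if "m \<in> N" for m
      unfolding k_def using member_le_sum[OF that, of "\<lambda>m. \<bar>l m\<bar>"] N(1) by simp
    then have "k \<le> l m \<and> l m < k + int (nat (- 2 * k + 1))" if "m \<in> N" for m using that by fastforce
    then have "t \<in> W k (nat (- 2 * k + 1))"
      unfolding N(2) W_def by (intro laurent_sum laurent_scale laurent_character) auto
    then show ?thesis by blast
  qed
  obtain y where y: "y \<in> I" "y \<noteq> 0" using False Id(2) by blast
  obtain s where s: "s \<in> level 0" "s \<noteq> 0" "s * y \<in> I" "s * y \<in> T" using numerator[OF y(1)] by blast
  obtain k0 n0 where kn0: "s * y \<in> W k0 n0" using in_W[OF s(4)] by blast
  have "s * y \<noteq> 0" using s(2) y(2) by simp
  then have ex: "\<exists>n k t. t \<in> I \<and> t \<in> W k n \<and> t \<noteq> 0" using s(3) kn0 by blast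
  define n where "n = (LEAST n. \<exists>k t. t \<in> I \<and> t \<in> W k n \<and> t \<noteq> 0)"
  from LeastI_ex[OF ex] obtain k t where t: "t \<in> I" "t \<in> W k n" "t \<noteq> 0" unfolding n_def by blast
  have minimal: "z = 0" if "z \<in> I" "z \<in> W j i" "i < n" for z j i
    using not_less_Least[of i "\<lambda>n. \<exists>k t. t \<in> I \<and> t \<in> W k n \<and> t \<noteq> 0"] that unfolding n_def by blast
  have W_0: "W j 0 = {0}" for j
  proof -
    have *: "{m. j \<le> l m \<and> l m < j + int 0} = {}" by auto
    show ?thesis unfolding W_def * by (rule laurent_empty)
  qed
  obtain n' where n': "n = Suc n'" using t(2,3) W_0 by (cases n) auto
  have W_Suc: "\<exists>a\<in>level (j + int i). \<exists>b\<in>W j i. z = a + b" if z: "z \<in> W j (Suc i)" for z j i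
  proof -
    have *: "{m. j \<le> l m \<and> l m < j + int (Suc i)} = {m. l m = j + int i} \<union> {m. j \<le> l m \<and> l m < j + int i}" by auto
    show ?thesis unfolding W_def by (rule laurent_split[OF z[unfolded W_def *]])
  qed
  have W_mult: "a * b \<in> W (j + h) i" if "a \<in> level h" "b \<in> W j i" for a b h j i
    using that unfolding W_def by (rule laurent_mult) (auto simp: l_add)
  obtain th tr where th: "th \<in> level (k + int n')" "tr \<in> W k n'" "t = th + tr" using W_Suc t(2) n' by blast
  have th0: "th \<noteq> 0" using minimal[OF t(1), of k n'] th t(3) n' by auto
  \<comment> \<open>The leading part of \<open>t\<close>, moved to degree zero by a power of the
    unit \<open>x\<close>; it is invertible in \<open>E\<close>.\<close>
  define a where "a = th * x powi (- (k + int n'))"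
  have a: "a \<in> level 0" "a \<noteq> 0"
    using level_mult[OF th(1) x_power[of "- (k + int n')"]] th0 character_nonzero by (auto simp: a_def)
  have div: "z \<in> (*) t ` E" if "z \<in> I" "z \<in> W j i" for z j i
    using that
  proof (induction i arbitrary: z)
    case 0
    then have "z = t * 0" using W_0 by simp
    then show ?case using Ed(4) by blast
  next
    case (Suc i)
    show ?case
    proof (cases "Suc i < n")
      case True
      then have "z = t * 0" using minimal[OF Suc.prems] by simp
      then show ?thesis using Ed(4) by blast
    next
      case False
      then have ni: "n' \<le> i" using n' by simp
      obtain zh zr where zh: "zh \<in> level (j + int i)" "zr \<in> W j i" "z = zh + zr" using W_Suc[OF Suc.prems(2)] by blast
      define b where "b = zh * x powi (- (k + int n'))"
      have bl: "b \<in> level (j + int i - (k + int n'))"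
        using level_mult[OF zh(1) x_power[of "- (k + int n')"]] by (simp add: b_def algebra_simps)
      have bE: "b \<in> E" using bl level_T T_subset_E by blast
      have aE: "a \<in> E" using a(1) level_T T_subset_E by blast
      \<comment> \<open>With \<open>a\<close> and \<open>b\<close> the leading parts of
        \<open>t\<close> and \<open>z\<close> after the same shift, the leading parts cancel as in a
        division with remainder.\<close>
      have "a * z - b * t = a * zr - b * tr"
        unfolding zh(3) th(3) a_def b_def by (simp add: algebra_simps)
      moreover have "a * zr \<in> W j i" using W_mult[OF a(1) zh(2)] by simp
      moreover have "b * tr \<in> W j i"
      proof -
        have "b * tr \<in> W (k + (j + int i - (k + int n'))) n'" using W_mult[OF bl th(2)] .
        moreover have "W (k + (j + int i - (k + int n'))) n' \<subseteq> W j i"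
          unfolding W_def using ni by (intro laurent_mono) auto
        ultimately show ?thesis by blast
      qed
      ultimately have "a * z - b * t \<in> W j i" using laurent_diff unfolding W_def by metis
      moreover have "a * z - b * t \<in> I"
        using Id(4)[OF aE Suc.prems(1)] Id(4)[OF bE t(1)] is_ideal_diff[OF E_subring I] by blast
      ultimately obtain c where c: "c \<in> E" "a * z - b * t = t * c" using Suc.IH by blast
      have "a * z = t * (b + c)" using c(2) by (simp add: algebra_simps)
      then have "z = t * (inverse a * (b + c))" using a(2) by (simp add: field_simps)
      moreover have "inverse a * (b + c) \<in> E" using level_0_inverse[OF a] bE c(1) by (intro Ed(3,6))
      ultimately show ?thesis by blast
    qed
  qed
  have tE: "t \<in> E" using t(1) Id(1) by blast
  have "I = (*) t ` E"
  proof
    show "(*) t ` E \<subseteq> I" using Id(4)[OF _ t(1)] by (auto simp: mult.commute)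
    show "I \<subseteq> (*) t ` E"
    proof
      fix z assume "z \<in> I"
      then obtain r where r: "r \<in> level 0" "r \<noteq> 0" "r * z \<in> I" "r * z \<in> T" using numerator by blast
      obtain j i where "r * z \<in> W j i" using in_W[OF r(4)] by blast
      then obtain c where c: "c \<in> E" "r * z = t * c" using div[OF r(3)] by blast
      then have "z = t * (inverse r * c)" using r(2) by (simp add: field_simps)
      moreover have "inverse r * c \<in> E" using level_0_inverse[OF r(1,2)] c(1) by (rule Ed(3))
      ultimately show "z \<in> (*) t ` E" by blast
    qed
  qed
  then show ?thesis using tE by blast
qed

text \<open>\<open>E\<close> is a principal ideal domain, so \<open>f\<close> has a pole at one of
  its discrete valuation rings; as \<open>E\<close> is a localization of \<open>T\<close>, that ring
  is also a point of the torus.\<close>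

lemma pole_outside_E:
  assumes "f \<in> K" "f \<notin> E"
  shows "\<exists>S g. S \<in> spec_points T \<and> dvr K S g \<and> f \<notin> S"
proof -
  have "f \<in> localization E {0}" using assms(1) E_fractions by simp
  then have "\<exists>q g. is_prime_ideal E q \<and> dvr K (localization E q) g \<and> f \<notin> localization E q"
    using principal_ideal_domain_valuation[OF E_subring _ _ assms(2)] E_principal unfolding E_fractions by simp
  then obtain q g where q: "is_prime_ideal E q" "dvr K (localization E q) g" "f \<notin> localization E q"
    by (elim exE conjE)
  have "localization E q \<in> spec_points T"
  proof (rule spec_points_mono_inverse[OF T_subring E_subring T_subset_E spec_pointsI[OF q(1)]])
    fix b assume "b \<in> E"
    then obtain t s where "t \<in> T" "s \<in> level 0" "s \<noteq> 0" "b = t / s" by (rule EE)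
    then show "\<exists>s\<in>T. inverse s \<in> E \<and> s \<noteq> 0 \<and> s * b \<in> T"
      using level_T[of 0] level_0_inverse by (intro bexI[of _ s]) auto
  qed
  then show ?thesis using q(2,3) by blast
qed

end

section \<open>Elimination of variables from denominators\<close>

lemma laurent_top:
  fixes l :: "int ^ 'd \<Rightarrow> int"
  assumes "s \<in> laurent M" "s \<noteq> 0"
  shows "\<exists>h. \<exists>a\<in>laurent {m \<in> M. l m = h}. \<exists>b\<in>laurent {m \<in> M. l m < h}. s = a + b \<and> a \<noteq> 0"
proof -
  obtain N and c :: "int ^ 'd \<Rightarrow> complex" where N: "finite N" "N \<subseteq> M" "\<forall>m\<in>N. c m \<noteq> 0" "s = (\<Sum>m\<in>N. toric_scalar (c m) * character m)"
    using assms(1) by (rule laurentE)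
  have ne: "N \<noteq> {}" using N(4) assms(2) by auto
  define h where "h = Max (l ` N)"
  have "h \<in> l ` N" unfolding h_def using N(1) ne by (intro Max_in) auto
  then obtain m0 where m0: "m0 \<in> N" "l m0 = h" by blast
  have le: "l m \<le> h" if "m \<in> N" for m unfolding h_def using N(1) that by (intro Max_ge) auto
  have "s \<in> laurent ({m \<in> M. l m = h} \<union> {m \<in> M. l m < h})"
    unfolding N(4) using N(2) le by (intro laurent_sum laurent_scale laurent_character) force
  from laurent_split[OF this] obtain a b where ab: "a \<in> laurent {m \<in> M. l m = h}" "b \<in> laurent {m \<in> M. l m < h}" "s = a + b"
    by (elim bexE)
  have "a \<noteq> 0"
  proof
    assume "a = 0"
    then have "(\<Sum>m\<in>N. toric_scalar (c m) * character m) \<in> laurent {m \<in> M. l m < h}" using ab(2,3) N(4) by simp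
    from laurent_support[OF N(1,3) this] show False using m0 by auto
  qed
  then show ?thesis using ab by (intro exI[of _ h] bexI[of _ a] bexI[of _ b] conjI)
qed

lemma coordinate_grading: "grading (\<lambda>m :: int ^ 'd. m $ i) (axis i 1) (laurent (UNIV :: (int ^ 'd) set))"
  by unfold_locales (auto simp: axis_def)

text \<open>
  If \<open>f\<close> has a denominator without the variables in \<open>J\<close> and one without the variable \<open>i\<close>, then it has a
  denominator without any of these variables: split off leading terms with respect to the variable \<open>i\<close>.
\<close>

lemma eliminate_variable:
  fixes i :: "'d::finite"
  assumes "t \<in> laurent {m. k \<le> m $ i \<and> m $ i < k + int n}" "r \<in> laurent {m. m $ i = 0}" "r \<noteq> 0"
    "s \<in> laurent {m. \<forall>j\<in>J. m $ j = 0}" "s \<noteq> 0" "s * (t / r) \<in> laurent (UNIV :: (int ^ 'd) set)"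
  shows "\<exists>s'\<in>laurent {m. \<forall>j\<in>insert i J. m $ j = 0}. s' \<noteq> 0 \<and> s' * (t / r) \<in> laurent (UNIV :: (int ^ 'd) set)"
  using assms
proof (induction n arbitrary: t s)
  case 0
  have *: "{m :: int ^ 'd. k \<le> m $ i \<and> m $ i < k + int 0} = {}" by auto
  have "t = 0" using 0(1) unfolding * laurent_empty by simp
  moreover have "(1 :: toric_field) \<in> laurent {m :: int ^ 'd. \<forall>j\<in>insert i J. m $ j = 0}"
    using laurent_character[of 0 "{m :: int ^ 'd. \<forall>j\<in>insert i J. m $ j = 0}"] by (simp add: character_0)
  ultimately show ?case by (intro bexI[of _ 1]) (auto simp: laurent_0)
next
  case (Suc n)
  define T where "T = laurent (UNIV :: (int ^ 'd) set)"
  interpret grading "\<lambda>m. m $ i" "axis i 1" T unfolding T_def by (rule coordinate_grading)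
  note r = Suc.prems(2,3)
  have *: "{m :: int ^ 'd. k \<le> m $ i \<and> m $ i < k + int (Suc n)} = {m. m $ i = k + int n} \<union> {m. k \<le> m $ i \<and> m $ i < k + int n}" by auto
  from laurent_split[OF Suc.prems(1)[unfolded *]]
  obtain th tr where t: "th \<in> laurent {m. m $ i = k + int n}" "tr \<in> laurent {m. k \<le> m $ i \<and> m $ i < k + int n}" "t = th + tr"
    by (elim bexE)
  from laurent_top[OF Suc.prems(4,5), of "\<lambda>m. m $ i"]
  obtain h sh sr where s: "sh \<in> laurent {m \<in> {m. \<forall>j\<in>J. m $ j = 0}. m $ i = h}"
    "sr \<in> laurent {m \<in> {m. \<forall>j\<in>J. m $ j = 0}. m $ i < h}" "s = sh + sr" "sh \<noteq> 0"
    by (elim exE bexE conjE)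
  define z where "z = s * (t / r)"
  have zT: "z \<in> laurent (UNIV :: (int ^ 'd) set)" using Suc.prems(6) by (simp add: z_def)
  have U: "(UNIV :: (int ^ 'd) set) = {m. m $ i = h + k + int n} \<union> {m. m $ i \<noteq> h + k + int n}" by auto
  from laurent_split[OF zT[unfolded U]]
  obtain zt zr where z: "zt \<in> laurent {m. m $ i = h + k + int n}" "zr \<in> laurent {m. m $ i \<noteq> h + k + int n}" "z = zt + zr"
    by (elim bexE)
  \<comment> \<open>Both sides are \<open>r * z = s * t\<close>. In degree \<open>h + k + n\<close>
    of the variable \<open>i\<close>, the highest that can occur on the right, only
    \<open>r * zt\<close> and \<open>sh * th\<close> remain.\<close>
  have eq: "r * zt + r * zr = sh * th + (sh * tr + sr * t)"
  proof -
    have "r * z = s * t" using r(2) by (simp add: z_def)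
    then show ?thesis unfolding z(3) s(3) t(3) by (simp add: algebra_simps)
  qed
  have rzr: "r * zr \<in> laurent {m. m $ i \<noteq> h + k + int n}"
    by (rule laurent_mult[OF r(1) z(2)]) auto
  have "sh * tr \<in> laurent {m. m $ i \<noteq> h + k + int n}"
    by (rule laurent_mult[OF s(1) t(2)]) auto
  moreover have "sr * t \<in> laurent {m. m $ i \<noteq> h + k + int n}"
    by (rule laurent_mult[OF s(2) Suc.prems(1)]) auto
  ultimately have "(sh * tr + sr * t) - r * zr \<in> laurent {m. m $ i \<noteq> h + k + int n}"
    using laurent_diff[OF laurent_add rzr] by blast
  moreover have "r * zt - sh * th = (sh * tr + sr * t) - r * zr"
  proof -
    have "r * zt - sh * th - ((sh * tr + sr * t) - r * zr) = (r * zt + r * zr) - (sh * th + (sh * tr + sr * t))" by simp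
    also have "\<dots> = 0" using eq by simp
    finally show ?thesis by simp
  qed
  ultimately have "r * zt - sh * th \<in> laurent {m. m $ i \<noteq> h + k + int n}" by (simp only:)
  moreover have "r * zt - sh * th \<in> laurent {m. m $ i = h + k + int n}"
    by (intro laurent_diff laurent_mult[OF r(1) z(1)] laurent_mult[OF s(1) t(1)]) auto
  ultimately have "r * zt - sh * th = 0" by (rule laurent_disjoint) auto
  then have lead: "sh * th = r * zt" by simp
  \<comment> \<open>Shifted to degree zero, the leading part of \<open>s\<close> omits all variables
    in \<open>insert i J\<close>, and it is a denominator of \<open>th / r\<close> because
    \<open>sh * th = r * zt\<close>.\<close>
  define s1 where "s1 = sh * character (axis i (- h) :: int ^ 'd)"
  have s1: "s1 \<in> laurent {m. \<forall>j\<in>insert i J. m $ j = 0}" "s1 \<noteq> 0"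
  proof -
    show "s1 \<in> laurent {m. \<forall>j\<in>insert i J. m $ j = 0}"
      unfolding s1_def by (rule laurent_mult[OF s(1) laurent_character[of _ "{axis i (- h)}"]]) (auto simp: axis_def)
    show "s1 \<noteq> 0" unfolding s1_def using s(4) character_nonzero by simp
  qed
  have s1J: "s1 \<in> laurent {m. \<forall>j\<in>J. m $ j = 0}"
  proof -
    have "laurent {m :: int ^ 'd. \<forall>j\<in>insert i J. m $ j = 0} \<subseteq> laurent {m. \<forall>j\<in>J. m $ j = 0}" by (rule laurent_mono) auto
    then show ?thesis using s1(1) by blast
  qed
  have inT: "laurent M \<subseteq> T" for M :: "(int ^ 'd) set" unfolding T_def by (rule laurent_mono) simp
  have f1: "s1 * (th / r) \<in> T"
  proof -
    have "s1 * (th / r) = zt * character (axis i (- h) :: int ^ 'd)"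
      using lead r(2) unfolding s1_def by (simp add: field_simps)
    also have "\<dots> \<in> T" unfolding T_def by (rule laurent_mult[OF z(1) laurent_character[of _ UNIV]]) auto
    finally show ?thesis .
  qed
  have sT: "s \<in> T" "s1 \<in> T" using Suc.prems(4) s1(1) inT by blast+
  \<comment> \<open>Removing the part with \<open>th\<close> shows that \<open>s * s1\<close> is a
    denominator of \<open>tr / r\<close> without the variables in \<open>J\<close>, so the induction
    hypothesis applies to the shorter \<open>tr\<close>.\<close>
  have "s1 * z - s * (s1 * (th / r)) \<in> T"
    using Td(2)[OF Td(3)[OF sT(2) zT[folded T_def]] Td(3)[OF sT(1) f1]] .
  moreover have "s1 * z - s * (s1 * (th / r)) = (s * s1) * (tr / r)"
    using r(2) unfolding z_def t(3) by (simp add: field_simps)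
  ultimately have rest: "(s * s1) * (tr / r) \<in> laurent (UNIV :: (int ^ 'd) set)" unfolding T_def by simp
  have ss1: "s * s1 \<in> laurent {m. \<forall>j\<in>J. m $ j = 0}" by (rule laurent_mult[OF Suc.prems(4) s1J]) auto
  have "s * s1 \<noteq> 0" using Suc.prems(5) s1(2) by simp
  from Suc.IH[OF t(2) r ss1 this rest]
  obtain s2 where s2: "s2 \<in> laurent {m. \<forall>j\<in>insert i J. m $ j = 0}" "s2 \<noteq> 0" "s2 * (tr / r) \<in> laurent (UNIV :: (int ^ 'd) set)"
    by (elim bexE conjE)
  have s2T: "s2 \<in> T" using s2(1) inT by blast
  have "s1 * (s2 * (tr / r)) + s2 * (s1 * (th / r)) \<in> T"
    using Td(6)[OF Td(3)[OF sT(2) s2(3)[folded T_def]] Td(3)[OF s2T f1]] .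
  moreover have "s1 * (s2 * (tr / r)) + s2 * (s1 * (th / r)) = (s1 * s2) * (t / r)"
    using r(2) unfolding t(3) by (simp add: field_simps)
  ultimately have "(s1 * s2) * (t / r) \<in> laurent (UNIV :: (int ^ 'd) set)" unfolding T_def by simp
  moreover have "s1 * s2 \<in> laurent {m. \<forall>j\<in>insert i J. m $ j = 0}" by (rule laurent_mult[OF s1(1) s2(1)]) auto
  moreover have "s1 * s2 \<noteq> 0" using s1(2) s2(2) by simp
  ultimately show ?case by (intro bexI[of _ "s1 * s2"] conjI)
qed

text \<open>Absence of poles puts \<open>f\<close> into the ring \<open>E\<close> of each
  coordinate, so for every variable there is a denominator without it. Merging these gives a
  denominator without any variables, which is a nonzero scalar.\<close>

lemma torus_regular_function:
  fixes T :: "toric_field set"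
  assumes T: "T = laurent (UNIV :: (int ^ 'd::finite) set)" and f: "f \<in> localization T {0}"
    and reg: "\<And>S g. S \<in> spec_points T \<Longrightarrow> dvr (localization T {0}) S g \<Longrightarrow> f \<in> S"
  shows "f \<in> T"
proof -
  have "\<exists>s\<in>laurent {m :: int ^ 'd. \<forall>j\<in>J. m $ j = 0}. s \<noteq> 0 \<and> s * f \<in> T" if "finite J" for J
    using that
  proof (induction J rule: finite_induct)
    case empty
    obtain a s where "a \<in> T" "s \<in> T" "s \<notin> {0}" "f = a / s" using f by (rule in_localizationE)
    then show ?case unfolding T by (intro bexI[of _ s]) auto
  next
    case (insert i J)
    from insert.IH obtain s where s: "s \<in> laurent {m :: int ^ 'd. \<forall>j\<in>J. m $ j = 0}" "s \<noteq> 0" "s * f \<in> T"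
      by (elim bexE conjE)
    interpret grading "\<lambda>m. m $ i" "axis i 1" T unfolding T by (rule coordinate_grading)
    have "f \<in> E"
    proof (rule ccontr)
      assume "f \<notin> E"
      from pole_outside_E[OF f this] obtain S g where "S \<in> spec_points T" "dvr (localization T {0}) S g" "f \<notin> S"
        by (elim exE conjE)
      then show False using reg[of S g] by simp
    qed
    then obtain t r where tr: "t \<in> T" "r \<in> level 0" "r \<noteq> 0" "f = t / r" by (rule EE)
    obtain N and c :: "int ^ 'd \<Rightarrow> complex" where N: "finite N" "t = (\<Sum>m\<in>N. toric_scalar (c m) * character m)"
      using tr(1)[unfolded T] by (rule laurentE)
    define k where "k = - (\<Sum>m\<in>N. \<bar>m $ i\<bar>)"
    have "\<bar>m $ i\<bar> \<le> - k" if "m \<in> N" for m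
      unfolding k_def using member_le_sum[OF that, of "\<lambda>m. \<bar>m $ i\<bar>"] N(1) by simp
    then have "k \<le> m $ i \<and> m $ i < k + int (nat (- 2 * k + 1))" if "m \<in> N" for m using that by fastforce
    then have t: "t \<in> laurent {m. k \<le> m $ i \<and> m $ i < k + int (nat (- 2 * k + 1))}"
      unfolding N(2) by (intro laurent_sum laurent_scale laurent_character) auto
    have "s * (t / r) \<in> laurent (UNIV :: (int ^ 'd) set)" using s(3) tr(4) T by simp
    from eliminate_variable[OF t tr(2,3) s(1,2) this] show ?case unfolding tr(4) T .
  qed
  from this[OF finite[of UNIV]]
  obtain s where s: "s \<in> laurent {m :: int ^ 'd. \<forall>j\<in>UNIV. m $ j = 0}" "s \<noteq> 0" "s * f \<in> T"
    by (elim bexE conjE)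
  have *: "{m :: int ^ 'd. \<forall>j\<in>UNIV. m $ j = 0} = {0}" by (auto simp: vec_eq_iff)
  have "s \<in> range toric_scalar" using s(1) unfolding * laurent_zero_exponent .
  then obtain c where c: "s = toric_scalar c" by blast
  then have "c \<noteq> 0" using s(2) toric.sc_0 by auto
  then have "toric_scalar (inverse c) * (s * f) = f" using s(2) by (simp add: c toric.sc_inverse)
  moreover have "toric_scalar (inverse c) * (s * f) \<in> T" using s(3) unfolding T by (rule laurent_scale)
  ultimately show ?thesis by (rule subst)
qed

lemma positive_support_constant:
  fixes N :: "(int ^ 'd) set set"
  assumes f: "f \<in> laurent (UNIV :: (int ^ 'd) set)" and N: "\<And>M. M \<in> N \<Longrightarrow> f \<in> laurent M" and int: "\<Inter>N \<subseteq> {0}"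
  shows "f \<in> range toric_scalar"
proof -
  obtain A and c :: "int ^ 'd \<Rightarrow> complex" where A: "finite A" "\<forall>m\<in>A. c m \<noteq> 0" "f = (\<Sum>m\<in>A. toric_scalar (c m) * character m)"
    using f by (rule laurentE)
  have "A \<subseteq> M" if "M \<in> N" for M using laurent_support[OF A(1,2)] N[OF that] A(3) by simp
  then have "A \<subseteq> {0}" using int by blast
  then have "f \<in> laurent {0 :: int ^ 'd}"
    unfolding A(3) by (intro laurent_sum laurent_scale laurent_character) auto
  then show ?thesis using laurent_zero_exponent by blast
qed

subsection \<open>Rays of the normal fan\<close>

text \<open>
  A rational linear system with a nonzero real solution has a nonzero rational one: apply a
  rational-linear functional on the reals to the coordinates.
\<close>

lemma rational_solution:
  fixes u :: "real ^ 'd" and A :: "(real ^ 'd) set"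
  assumes u: "u \<noteq> 0" and A: "\<And>a. a \<in> A \<Longrightarrow> a \<bullet> u = 0" "\<And>a i. a \<in> A \<Longrightarrow> a $ i \<in> \<rat>"
  shows "\<exists>r. r \<noteq> 0 \<and> (\<forall>i. r $ i \<in> \<rat>) \<and> (\<forall>a\<in>A. a \<bullet> r = 0)"
proof -
  obtain k where k: "u $ k \<noteq> 0" using u by (auto simp: vec_eq_iff)
  interpret R: vector_space "\<lambda>(q::rat) (x::real). of_rat q * x"
    by unfold_locales (auto simp: of_rat_add of_rat_mult algebra_simps)
  interpret Q: vector_space "\<lambda>(q::rat) (x::rat). q * x"
    by unfold_locales (auto simp: algebra_simps)
  interpret RQ: vector_space_pair "\<lambda>(q::rat) (x::real). of_rat q * x" "\<lambda>(q::rat) (x::rat). q * x" ..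
  \<comment> \<open>Prescribing the functional at this nonzero entry keeps the resulting vector
    nonzero.\<close>
  have "R.independent {u $ k}" using k by (simp add: R.dependent_single)
  from RQ.linear_independent_extend[OF this, of "\<lambda>_. 1"]
  obtain g where g: "Vector_Spaces.linear (\<lambda>(q::rat) (x::real). of_rat q * x) (\<lambda>(q::rat) (x::rat). q * x) g" "g (u $ k) = 1"
    by auto
  interpret g: Vector_Spaces.linear "\<lambda>(q::rat) (x::real). of_rat q * x" "\<lambda>(q::rat) (x::rat). q * x" g by (rule g(1))
  define r :: "real ^ 'd" where "r = (\<chi> i. of_rat (g (u $ i)))"
  have "r $ k = 1" using g(2) by (simp add: r_def)
  then have "r \<noteq> 0" by auto
  moreover have "r $ i \<in> \<rat>" for i by (simp add: r_def)
  moreover have "a \<bullet> r = 0" if a: "a \<in> A" for a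
  proof -
    have "\<forall>i. \<exists>q. a $ i = of_rat q" using A(2)[OF a] by (metis Rats_cases)
    then obtain q where q: "\<And>i. a $ i = of_rat (q i)" by metis
    have "a \<bullet> r = (\<Sum>i\<in>UNIV. of_rat (q i * g (u $ i)))"
      by (simp add: inner_vec_def q r_def of_rat_mult)
    also have "\<dots> = of_rat (\<Sum>i\<in>UNIV. g (of_rat (q i) * u $ i))"
      by (simp add: of_rat_sum g.scale)
    also have "(\<Sum>i\<in>UNIV. g (of_rat (q i) * u $ i)) = g (\<Sum>i\<in>UNIV. of_rat (q i) * u $ i)"
      by (rule g.sum[symmetric])
    also have "(\<Sum>i\<in>UNIV. of_rat (q i) * u $ i) = a \<bullet> u" by (simp add: inner_vec_def q)
    finally show ?thesis using A(1)[OF a] g.zero by simp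
  qed
  ultimately show ?thesis by blast
qed

text \<open>The product of the denominators makes the vector integral, and division by the greatest
  common divisor of its entries makes it primitive.\<close>

lemma primitive_multiple:
  fixes r :: "real ^ 'd"
  assumes r: "r \<noteq> 0" "\<And>i. r $ i \<in> \<rat>"
  shows "\<exists>c>0. \<exists>u. lattice_vec u = c *\<^sub>R r \<and> Gcd (range (($) u)) = 1"
proof -
  have "\<forall>i. \<exists>N::nat. N > 0 \<and> of_nat N * r $ i \<in> \<int>"
  proof
    fix i
    obtain a b where ab: "b > 0" "r $ i = real_of_int a / real_of_int b"
      using r(2)[of i] by (auto elim!: Rats_cases')
    then have "of_nat (nat b) * r $ i = real_of_int a" by simp
    then show "\<exists>N::nat. N > 0 \<and> of_nat N * r $ i \<in> \<int>" using ab(1) by (intro exI[of _ "nat b"]) auto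
  qed
  then obtain N where N: "\<And>i. N i > 0" "\<And>i. real (N i) * r $ i \<in> \<int>" by metis
  define M where "M = (\<Prod>i\<in>UNIV. N i)"
  have M0: "M > 0" unfolding M_def using N(1) by (simp add: prod_pos)
  have "real M * r $ i \<in> \<int>" for i
  proof -
    have "M = N i * (\<Prod>j\<in>UNIV-{i}. N j)" unfolding M_def by (rule prod.remove) auto
    then have "real M * r $ i = real (\<Prod>j\<in>UNIV-{i}. N j) * (real (N i) * r $ i)" by simp
    also have "\<dots> \<in> \<int>" by (rule Ints_mult[OF Ints_of_nat N(2)])
    finally show ?thesis .
  qed
  then have "\<forall>i. \<exists>z. real M * r $ i = of_int z" by (auto elim: Ints_cases)
  then obtain z where z: "\<And>i. real M * r $ i = of_int (z i)" by metis
  define g where "g = Gcd (range z)"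
  obtain k where k: "r $ k \<noteq> 0" using r(1) by (auto simp: vec_eq_iff)
  have "z k \<noteq> 0" using z[of k] k M0 by auto
  then have g0: "g \<noteq> 0" unfolding g_def by (auto simp: Gcd_0_iff)
  have gpos: "g > 0" using g0 Gcd_int_greater_eq_0[of "range z"] unfolding g_def by linarith
  have "\<forall>i. \<exists>w. z i = g * w" using Gcd_dvd[of _ "range z"] unfolding g_def dvd_def by blast
  from choice[OF this] obtain w where w: "\<And>i. z i = g * w i" by blast
  have "range z = (*) g ` range w" using w by auto
  then have "g = Gcd ((*) g ` range w)" using g_def by simp
  also have "\<dots> = g * Gcd (range w)" using gpos by (simp add: Gcd_mult normalize_mult)
  finally have "Gcd (range w) = 1" using g0 by simp
  moreover have "lattice_vec (\<chi> i. w i) = (real M / real_of_int g) *\<^sub>R r"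
  proof -
    have "real_of_int (w i) = real M / real_of_int g * r $ i" for i
      using z[of i] w[of i] g0 by (simp add: field_simps)
    then show ?thesis by (simp add: lattice_vec_def vec_eq_iff)
  qed
  moreover have "real M / real_of_int g > 0" using M0 gpos by simp
  moreover have "($) (\<chi> i. w i) = w" by auto
  ultimately show ?thesis by metis
qed

text \<open>Proportional vectors satisfy \<open>u $ k * v $ j = v $ k * u $ j\<close>. Taking
  greatest common divisors over \<open>j\<close> gives
  \<open>\<bar>u $ k\<bar> = \<bar>v $ k\<bar>\<close>, so the nonnegative factor is
  \<open>1\<close>.\<close>

lemma primitive_generator_eq:
  fixes u :: "int ^ 'd"
  assumes u: "Gcd (range (($) u)) = 1" and \<rho>: "\<rho> = {c *\<^sub>R lattice_vec u | c. c \<ge> 0}"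
  shows "primitive_generator \<rho> = u"
  unfolding primitive_generator_def
proof (rule the_equality)
  have "lattice_vec u = 1 *\<^sub>R lattice_vec u" by simp
  then show "lattice_vec u \<in> \<rho> \<and> Gcd (range (($) u)) = 1" unfolding \<rho> using u zero_le_one by blast
  fix v assume v: "lattice_vec v \<in> \<rho> \<and> Gcd (range (($) v)) = 1"
  then obtain c where c: "c \<ge> 0" "lattice_vec v = c *\<^sub>R lattice_vec u" unfolding \<rho> by blast
  have vi: "real_of_int (v $ i) = c * real_of_int (u $ i)" for i
    using arg_cong[OF c(2), of "\<lambda>x. x $ i"] by (simp add: lattice_vec_def)
  obtain k where k: "u $ k \<noteq> 0"
  proof -
    have "\<not> range (($) u) \<subseteq> {0}" using u by (metis Gcd_0_iff zero_neq_one)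
    then show ?thesis using that by blast
  qed
  have cross: "u $ k * v $ j = v $ k * u $ j" for j
  proof -
    have "real_of_int (u $ k * v $ j) = real_of_int (v $ k * u $ j)" using vi by (simp add: ac_simps)
    then show ?thesis by (simp only: of_int_eq_iff)
  qed
  have "normalize (u $ k * Gcd (range (($) v))) = normalize (v $ k * Gcd (range (($) u)))"
    unfolding Gcd_mult[symmetric] image_image cross ..
  then have "\<bar>u $ k\<bar> = \<bar>v $ k\<bar>" using u v by simp
  then have "\<bar>real_of_int (u $ k)\<bar> = c * \<bar>real_of_int (u $ k)\<bar>"
    using vi[of k] c(1) by (metis abs_mult abs_of_nonneg of_int_abs)
  then have "c = 1" using k by simp
  then show "v = u" using vi by (simp add: vec_eq_iff)
qed

text \<open>The least positive value of the pairing with \<open>u\<close> divides all entries, by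
  division with remainder. It supplies the exponent of degree \<open>1\<close> in the grading of a
  ray.\<close>

lemma bezout_vector:
  fixes u :: "int ^ 'd"
  assumes "Gcd (range (($) u)) = 1"
  shows "\<exists>m :: int ^ 'd. (\<Sum>i\<in>UNIV. m $ i * u $ i) = 1"
proof -
  define I where "I = {\<Sum>i\<in>UNIV. m $ i * u $ i | m :: int ^ 'd. True}"
  have I_diff: "a - b \<in> I" if "a \<in> I" "b \<in> I" for a b
  proof -
    from that obtain m n :: "int ^ 'd" where "a = (\<Sum>i\<in>UNIV. m $ i * u $ i)" "b = (\<Sum>i\<in>UNIV. n $ i * u $ i)"
      unfolding I_def by blast
    then have "a - b = (\<Sum>i\<in>UNIV. (m - n) $ i * u $ i)" by (simp add: sum_subtractf left_diff_distrib)
    then show ?thesis unfolding I_def by blast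
  qed
  have I_mult: "c * a \<in> I" if "a \<in> I" for a c
  proof -
    from that obtain m :: "int ^ 'd" where "a = (\<Sum>i\<in>UNIV. m $ i * u $ i)" unfolding I_def by blast
    then have "c * a = (\<Sum>i\<in>UNIV. (\<chi> i. c * m $ i) $ i * u $ i)" by (simp add: sum_distrib_left mult.assoc)
    then show ?thesis unfolding I_def by blast
  qed
  have I_u: "u $ k \<in> I" for k
  proof -
    have "(\<Sum>i\<in>UNIV. axis k (1::int) $ i * u $ i) = (\<Sum>i\<in>UNIV. if i = k then u $ i else 0)"
      by (intro sum.cong) (auto simp: axis_def)
    then have "u $ k = (\<Sum>i\<in>UNIV. axis k (1::int) $ i * u $ i)" by simp
    then show ?thesis unfolding I_def by blast
  qed
  obtain k where k: "u $ k \<noteq> 0"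
  proof -
    have "\<not> range (($) u) \<subseteq> {0}" using assms by (metis Gcd_0_iff zero_neq_one)
    then show ?thesis using that by blast
  qed
  have "\<exists>n::nat. n > 0 \<and> int n \<in> I"
    using k I_u[of k] I_mult[OF I_u[of k], of "- 1"] by (intro exI[of _ "nat \<bar>u $ k\<bar>"]) (auto simp: abs_if)
  define g where "g = (LEAST n::nat. n > 0 \<and> int n \<in> I)"
  have g: "g > 0" "int g \<in> I" using LeastI_ex[OF \<open>\<exists>n::nat. n > 0 \<and> int n \<in> I\<close>] unfolding g_def by auto
  have "int g dvd u $ j" for j
  proof (rule ccontr)
    assume nd: "\<not> int g dvd u $ j"
    define r where "r = u $ j mod int g"
    have r: "0 < r" "r < int g"
      using nd g(1) pos_mod_sign[of "int g" "u $ j"] pos_mod_bound[of "int g" "u $ j"] unfolding r_def dvd_eq_mod_eq_0 by linarith+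
    have "r = u $ j - (u $ j div int g) * int g" by (simp add: r_def minus_div_mult_eq_mod)
    then have "r \<in> I" using I_diff[OF I_u I_mult[OF g(2)]] by simp
    then have "nat r > 0 \<and> int (nat r) \<in> I" using r by simp
    then have "g \<le> nat r" unfolding g_def by (rule Least_le)
    then show False using r by simp
  qed
  then have "int g dvd Gcd (range (($) u))" by (intro Gcd_greatest) auto
  then have "g = 1" using assms by simp
  then show ?thesis using g(2) unfolding I_def by auto
qed

section \<open>Normal cones of a full-dimensional polytope\<close>

lemma full_dimensional_hull:
  fixes P :: "(real ^ 'd) set"
  assumes "aff_dim P = int CARD('d)"
  shows "affine hull P = UNIV"
proof -
  have "aff_dim P = int DIM(real ^ 'd)" using assms by simp
  then show ?thesis by (rule aff_dim_eq_full[THEN iffD1])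
qed

lemma full_dimensional_constant:
  fixes P :: "(real ^ 'd) set"
  assumes "aff_dim P = int CARD('d)" "\<And>y. y \<in> P \<Longrightarrow> y \<bullet> u = c"
  shows "u = 0"
proof -
  have "affine hull P = UNIV" using assms(1) by (rule full_dimensional_hull)
  moreover have "affine hull P \<subseteq> {y. u \<bullet> y = c}"
    by (intro hull_minimal affine_hyperplane) (auto simp: assms(2) inner_commute[of u])
  ultimately have "u \<bullet> y = c" for y by blast
  from this[of u] this[of 0] show ?thesis by simp
qed

lemma max_over_convex_hull:
  fixes V :: "(real ^ 'd) set"
  assumes "y \<in> convex hull V" "\<And>v. v \<in> V \<Longrightarrow> v \<bullet> u \<le> c"
  shows "y \<bullet> u \<le> c"
proof -
  have "convex hull V \<subseteq> {y. u \<bullet> y \<le> c}"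
    by (intro hull_minimal convex_halfspace_le) (auto simp: assms(2) inner_commute[of u])
  then show ?thesis using assms(1) by (auto simp: inner_commute)
qed

text \<open>A nonzero \<open>u\<close> on the ray is determined up to scaling by the condition to be
  constant on those points of \<open>V\<close> at which it is maximal: any other solution could be
  used to move \<open>u\<close> inside the cone. This is a rational linear system, so the line
  contains a rational vector and hence a primitive one.\<close>

lemma ray_structure:
  fixes P :: "(real ^ 'd) set"
  assumes P: "rational_polytope P" "aff_dim P = int CARD('d)" and \<rho>: "\<rho> \<in> rays P"
  shows "\<exists>u. Gcd (range (($) u)) = 1 \<and> \<rho> = {c *\<^sub>R lattice_vec u | c. c \<ge> 0}"
proof -
  obtain V where V: "finite V" "\<forall>v\<in>V. \<forall>i. v $ i \<in> \<rat>" "P = convex hull V"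
    using P(1) unfolding rational_polytope_def by blast
  obtain F where F: "F face_of P" "F \<noteq> {}" "\<rho> = normal_cone P F" and dim: "dim \<rho> = 1"
    using \<rho> unfolding rays_def normal_fan_def by blast
  have FP: "F \<subseteq> P" using F(1) by (rule face_of_imp_subset)
  have "\<not> \<rho> \<subseteq> {0}" using dim by (metis dim_eq_0 zero_neq_one)
  then obtain u where u: "u \<in> \<rho>" "u \<noteq> 0" by blast
  have line: "\<exists>c. w = c *\<^sub>R u" if w: "w \<in> \<rho>" for w
  proof (rule ccontr)
    assume no: "\<not> ?thesis"
    have "w \<notin> span {u}" using no by (auto simp: span_singleton)
    moreover have "independent {u}" using u(2) by simp
    ultimately have "independent (insert w {u})" by (simp add: independent_insert)
    moreover have "w \<noteq> u" using no by (metis scaleR_one)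
    ultimately show False using independent_card_le_dim[of "insert w {u}" \<rho>] w u(1) dim by auto
  qed
  have scale: "c *\<^sub>R w \<in> \<rho>" if "w \<in> \<rho>" "c \<ge> 0" for c w
    using that unfolding F(3) normal_cone_def by (auto simp: mult_left_mono)
  \<comment> \<open>If the cone contained both \<open>u\<close> and \<open>- u\<close>, the polytope
    would lie in a hyperplane.\<close>
  have neg: "c \<ge> 0" if c: "c *\<^sub>R u \<in> \<rho>" for c
  proof (rule ccontr)
    assume "\<not> c \<ge> 0"
    then have "(- 1 / c) *\<^sub>R (c *\<^sub>R u) \<in> \<rho>" by (intro scale[OF c]) (simp add: divide_nonpos_neg)
    moreover have "(- 1 / c) *\<^sub>R (c *\<^sub>R u) = - u" using \<open>\<not> c \<ge> 0\<close> by simp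
    ultimately have mu: "- u \<in> \<rho>" by (simp only:)
    obtain x0 where x0: "x0 \<in> F" using F(2) by blast
    have "y \<bullet> u = x0 \<bullet> u" if "y \<in> P" for y
      using u(1) mu x0 that unfolding F(3) normal_cone_def by force
    then show False using full_dimensional_constant[OF P(2)] u(2) by blast
  qed
  have Vne: "V \<noteq> {}" using FP F(2) V(3) by auto
  define M where "M = Max ((\<lambda>v. v \<bullet> u) ` V)"
  have "M \<in> (\<lambda>v. v \<bullet> u) ` V" unfolding M_def using V(1) Vne by (intro Max_in) auto
  then obtain v0 where v0: "v0 \<in> V" "v0 \<bullet> u = M" by auto
  have leM: "v \<bullet> u \<le> M" if "v \<in> V" for v unfolding M_def using V(1) that by (intro Max_ge) auto
  have PM: "y \<bullet> u \<le> M" if "y \<in> P" for y using max_over_convex_hull leM that V(3) by blast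
  have v0P: "v0 \<in> P" using v0(1) V(3) hull_inc by metis
  have FM: "x \<bullet> u = M" if "x \<in> F" for x
  proof -
    have "v0 \<bullet> u \<le> x \<bullet> u" using u(1) that v0P unfolding F(3) normal_cone_def by blast
    then show ?thesis using PM[of x] that FP v0(2) by force
  qed
  define V0 where "V0 = {v \<in> V. v \<bullet> u = M}"
  \<comment> \<open>In a convex combination on which \<open>u\<close> is maximal, only elements of
    \<open>V0\<close> have nonzero weight.\<close>
  have FV0: "x \<bullet> w = v0 \<bullet> w" if x: "x \<in> F" and w: "\<And>v. v \<in> V0 \<Longrightarrow> (v0 - v) \<bullet> w = 0" for x w
  proof -
    obtain a where a: "\<And>v. v \<in> V \<Longrightarrow> a v \<ge> 0" "sum a V = 1" "(\<Sum>v\<in>V. a v *\<^sub>R v) = x"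
      using x FP V(3) convex_hull_finite[OF V(1)] by auto
    have "(\<Sum>v\<in>V. a v * (M - v \<bullet> u)) = 0"
    proof -
      have "(\<Sum>v\<in>V. a v * (M - v \<bullet> u)) = M * sum a V - (\<Sum>v\<in>V. a v *\<^sub>R v) \<bullet> u"
        by (simp add: right_diff_distrib sum_subtractf inner_sum_left sum_distrib_left mult.commute)
      then show ?thesis using a(2,3) FM[OF x] by simp
    qed
    then have "\<forall>v\<in>V. a v * (M - v \<bullet> u) = 0"
      using a(1) leM V(1) by (subst (asm) sum_nonneg_eq_0_iff) (auto intro: mult_nonneg_nonneg)
    then have av: "a v * ((v0 - v) \<bullet> w) = 0" if "v \<in> V" for v
      using that w[of v] unfolding V0_def by auto
    have "v0 \<bullet> w - x \<bullet> w = (\<Sum>v\<in>V. a v * ((v0 - v) \<bullet> w))"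
      unfolding a(3)[symmetric] using a(2)
      by (simp add: inner_diff_left right_diff_distrib sum_subtractf inner_sum_left flip: sum_distrib_right)
    also have "\<dots> = 0" by (intro sum.neutral ballI av)
    finally show ?thesis by simp
  qed
  have kernel: "\<exists>c. w = c *\<^sub>R u" if w: "\<And>v. v \<in> V0 \<Longrightarrow> (v0 - v) \<bullet> w = 0" for w
  proof -
    \<comment> \<open>\<open>d\<close> bounds from below the loss in \<open>u\<close> at the
      elements outside \<open>V0\<close>, and \<open>b\<close> bounds the variation of
      \<open>w\<close>. Moving \<open>u\<close> by \<open>d / b\<close> times \<open>w\<close>
      therefore cannot overtake the maximum. The inserted \<open>1\<close> keeps the sets nonempty
      and \<open>b\<close> positive.\<close>
    define d where "d = Min (insert 1 ((\<lambda>v. (v0 - v) \<bullet> u) ` (V - V0)))"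
    define b where "b = Max (insert 1 ((\<lambda>v. \<bar>(v0 - v) \<bullet> w\<bar>) ` V))"
    have d: "d > 0" unfolding d_def using V(1) leM v0(2) by (subst Min_gr_iff) (auto simp: V0_def inner_diff_left less_le)
    have b: "b \<ge> 1" "\<And>v. v \<in> V \<Longrightarrow> \<bar>(v0 - v) \<bullet> w\<bar> \<le> b" unfolding b_def using V(1) by (auto intro: Max_ge)
    have dv: "d \<le> (v0 - v) \<bullet> u" if "v \<in> V - V0" for v unfolding d_def using V(1) that by (intro Min_le) auto
    have "(v0 - v) \<bullet> (u + (d / b) *\<^sub>R w) \<ge> 0" if v: "v \<in> V" for v
    proof (cases "v \<in> V0")
      case True
      then show ?thesis using w[OF True] v0(2) by (simp add: inner_add_right V0_def inner_diff_left)
    next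
      case False
      have "\<bar>(d / b) * ((v0 - v) \<bullet> w)\<bar> \<le> (d / b) * b"
        unfolding abs_mult using b(2)[OF v] d b(1) by (intro mult_mono) auto
      also have "(d / b) * b = d" using b(1) by simp
      finally have "- ((d / b) * ((v0 - v) \<bullet> w)) \<le> d" by (rule abs_le_D2)
      moreover have "d \<le> (v0 - v) \<bullet> u" using dv v False by simp
      ultimately have "- ((d / b) * ((v0 - v) \<bullet> w)) \<le> (v0 - v) \<bullet> u" by (rule order_trans)
      then show ?thesis unfolding inner_add_right inner_scaleR_right by simp
    qed
    then have "v \<bullet> (u + (d / b) *\<^sub>R w) \<le> v0 \<bullet> (u + (d / b) *\<^sub>R w)" if "v \<in> V" for v
      using that by (simp add: inner_diff_left)
    then have "y \<bullet> (u + (d / b) *\<^sub>R w) \<le> v0 \<bullet> (u + (d / b) *\<^sub>R w)" if "y \<in> P" for y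
      using max_over_convex_hull that V(3) by blast
    moreover have "x \<bullet> (u + (d / b) *\<^sub>R w) = v0 \<bullet> (u + (d / b) *\<^sub>R w)" if "x \<in> F" for x
      using FV0[OF that w] FM[OF that] v0(2) by (simp add: inner_add_right)
    ultimately have "u + (d / b) *\<^sub>R w \<in> \<rho>" unfolding F(3) normal_cone_def by simp
    then obtain c where "u + (d / b) *\<^sub>R w = c *\<^sub>R u" using line by blast
    then have "(d / b) *\<^sub>R w = (c - 1) *\<^sub>R u" by (simp add: algebra_simps)
    then have "(b / d) *\<^sub>R ((d / b) *\<^sub>R w) = (b / d) *\<^sub>R ((c - 1) *\<^sub>R u)" by simp
    then have "w = (b / d * (c - 1)) *\<^sub>R u" using d b(1) by simp
    then show ?thesis by blast
  qed
  have "\<exists>r. r \<noteq> 0 \<and> (\<forall>i. r $ i \<in> \<rat>) \<and> (\<forall>a\<in>(\<lambda>v. v0 - v) ` V0. a \<bullet> r = 0)"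
    by (rule rational_solution[OF u(2)]) (use V(2) v0 in \<open>auto simp: V0_def inner_diff_left\<close>)
  then obtain r where r: "r \<noteq> 0" "\<forall>i. r $ i \<in> \<rat>" "\<forall>a\<in>(\<lambda>v. v0 - v) ` V0. a \<bullet> r = 0" by blast
  obtain c where c: "r = c *\<^sub>R u" using kernel[of r] r(3) by auto
  have c0: "c \<noteq> 0" using c r(1) by auto
  \<comment> \<open>The sign is chosen so that the rational vector is a positive multiple of
    \<open>u\<close>.\<close>
  define r' where "r' = (if c > 0 then r else - r)"
  have r': "r' \<noteq> 0" "\<And>i. r' $ i \<in> \<rat>" "r' = \<bar>c\<bar> *\<^sub>R u" using r(1,2) c by (auto simp: r'_def)
  obtain k n where n: "k > 0" "lattice_vec n = k *\<^sub>R r'" "Gcd (range (($) n)) = 1"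
    using primitive_multiple[OF r'(1,2)] by blast
  have nu: "lattice_vec n = (k * \<bar>c\<bar>) *\<^sub>R u" using n(2) r'(3) by simp
  have pos: "k * \<bar>c\<bar> > 0" using n(1) c0 by simp
  have "\<rho> = {c *\<^sub>R lattice_vec n | c. c \<ge> 0}"
  proof
    show "{c *\<^sub>R lattice_vec n | c. c \<ge> 0} \<subseteq> \<rho>" unfolding nu using scale[OF u(1)] pos by auto
    show "\<rho> \<subseteq> {c *\<^sub>R lattice_vec n | c. c \<ge> 0}"
    proof
      fix w assume w: "w \<in> \<rho>"
      then obtain a where a: "w = a *\<^sub>R u" using line by blast
      then have "a \<ge> 0" using neg w by simp
      moreover have "w = (a / (k * \<bar>c\<bar>)) *\<^sub>R lattice_vec n" unfolding nu a using n(1) c0 by simp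
      ultimately show "w \<in> {c *\<^sub>R lattice_vec n | c. c \<ge> 0}" using pos by (intro CollectI exI[of _ "a / (k * \<bar>c\<bar>)"]) simp
    qed
  qed
  then show ?thesis using n(3) by blast
qed

lemma finite_rays:
  assumes "rational_polytope P"
  shows "finite (rays P)"
proof -
  have "polytope P" using assms unfolding rational_polytope_def polytope_def by blast
  then have "finite {F. F face_of P}" by (rule finite_polytope_faces)
  then have "finite (normal_cone P ` {F. F face_of P})" by simp
  moreover have "rays P \<subseteq> normal_cone P ` {F. F face_of P}" unfolding rays_def normal_fan_def by blast
  ultimately show ?thesis by (rule finite_subset[rotated])
qed

text \<open>The outer normals of the facets lie on rays. If \<open>m\<close> is nonnegative on all
  of them, moving from a point of the polytope in the direction \<open>- m\<close> never violates a
  facet inequality, which contradicts boundedness unless \<open>m\<close> is zero.\<close>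

lemma rays_positively_span:
  fixes P :: "(real ^ 'd) set"
  assumes P: "rational_polytope P" "aff_dim P = int CARD('d)"
    and m: "\<And>\<rho> u. \<rho> \<in> rays P \<Longrightarrow> u \<in> \<rho> \<Longrightarrow> m \<bullet> u \<ge> 0"
  shows "m = 0"
proof (rule ccontr)
  assume m0: "m \<noteq> 0"
  have poly: "polytope P" using P(1) unfolding rational_polytope_def polytope_def by blast
  have hull: "affine hull P = UNIV" using P(2) by (rule full_dimensional_hull)
  have Pne: "P \<noteq> {}" using P(2) by auto
  \<comment> \<open>Minimality of the family of half-spaces guarantees that each bounding hyperplane
    cuts out a facet.\<close>
  obtain H where H: "finite H" "P = affine hull P \<inter> \<Inter>H" "\<forall>h\<in>H. \<exists>a b. a \<noteq> 0 \<and> h = {x. a \<bullet> x \<le> b}"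
    "\<forall>H'. H' \<subset> H \<longrightarrow> P \<subset> affine hull P \<inter> \<Inter>H'"
    using polytope_imp_polyhedron[OF poly] unfolding polyhedron_Int_affine_minimal by (elim exE conjE)
  from bchoice[OF H(3)] obtain a where "\<forall>h\<in>H. \<exists>b. a h \<noteq> 0 \<and> h = {x. a h \<bullet> x \<le> b}" ..
  from bchoice[OF this] obtain b where ab: "\<forall>h\<in>H. a h \<noteq> 0 \<and> h = {x. a h \<bullet> x \<le> b h}" ..
  have memH: "x \<in> h \<longleftrightarrow> a h \<bullet> x \<le> b h" if h: "h \<in> H" for x h
  proof -
    have eq: "h = {x. a h \<bullet> x \<le> b h}" using bspec[OF ab h] by (rule conjunct2)
    have "x \<in> h \<longleftrightarrow> x \<in> {x. a h \<bullet> x \<le> b h}" by (rule arg_cong[OF eq, of "\<lambda>A. x \<in> A"])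
    then show ?thesis by (simp only: mem_Collect_eq)
  qed
  have pos: "m \<bullet> a h \<ge> 0" if h: "h \<in> H" for h
  proof -
    define F where "F = P \<inter> {x. a h \<bullet> x = b h}"
    have a0: "a h \<noteq> 0" using bspec[OF ab h] by (rule conjunct1)
    have ineq: "a h \<bullet> y \<le> b h" if "y \<in> P" for y
    proof -
      have "y \<in> h" using H(2) h that by blast
      then show ?thesis using memH[OF h] by simp
    qed
    have "F facet_of P \<longleftrightarrow> (\<exists>h. h \<in> H \<and> F = P \<inter> {x. a h \<bullet> x = b h})"
    proof (rule facet_of_polyhedron_explicit[OF H(1,2)])
      show "a h \<noteq> 0 \<and> h = {x. a h \<bullet> x \<le> b h}" if "h \<in> H" for h using ab that by (rule bspec)
      show "P \<subset> affine hull P \<inter> \<Inter>H'" if "H' \<subset> H" for H' using H(4) that by simp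
    qed
    then have "F facet_of P" using h F_def by auto
    then have F: "F face_of P" "F \<noteq> {}" "aff_dim F = int CARD('d) - 1" using P(2) unfolding facet_of_def by auto
    have "affine hull F = {x. a h \<bullet> x = b h}"
    proof (rule affine_dim_equal)
      show "affine hull F \<subseteq> {x. a h \<bullet> x = b h}"
        by (intro hull_minimal affine_hyperplane) (auto simp: F_def)
      show "aff_dim (affine hull F) = aff_dim {x. a h \<bullet> x = b h}" using F(3) a0 by simp
    qed (use F(2) affine_hyperplane in auto)
    then have hyper: "{x. a h \<bullet> x = b h} = affine hull F" by simp
    obtain x0 where x0: "x0 \<in> F" using F(2) by (meson ex_in_conv)
    have FP: "F \<subseteq> P" using F(1) by (rule face_of_imp_subset)
    have line: "w \<in> span {a h}" if w: "w \<in> normal_cone P F" for w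
    proof -
      have w': "z \<bullet> w \<le> x \<bullet> w" if "x \<in> F" "z \<in> P" for x z using w that by (simp add: normal_cone_def)
      have "y \<bullet> w = x0 \<bullet> w" if "y \<in> F" for y
        using w'[OF that subsetD[OF FP x0]] w'[OF x0 subsetD[OF FP that]] by (rule antisym[rotated])
      then have "affine hull F \<subseteq> {y. w \<bullet> y = w \<bullet> x0}"
        by (intro hull_minimal affine_hyperplane) (auto simp: inner_commute[of w])
      then have const: "w \<bullet> y = w \<bullet> x0" if "a h \<bullet> y = b h" for y using hyper that by blast
      \<comment> \<open>The component of \<open>w\<close> orthogonal to the facet normal. It is
        parallel to the hyperplane of the facet, on which \<open>w\<close> is constant, so it
        vanishes and the normal cone is one-dimensional.\<close>
      define v where "v = w - ((w \<bullet> a h) / (a h \<bullet> a h)) *\<^sub>R a h"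
      have av: "a h \<bullet> v = 0" using a0 by (simp add: v_def inner_diff_right inner_commute)
      have "a h \<bullet> x0 = b h" using x0 by (simp add: F_def)
      then have "w \<bullet> (x0 + v) = w \<bullet> x0" using av by (intro const) (simp add: inner_add_right)
      then have "w \<bullet> v = 0" by (simp add: inner_add_right)
      then have "v \<bullet> v = 0" using av by (simp add: v_def inner_diff_left inner_diff_right inner_commute)
      then have "w = ((w \<bullet> a h) / (a h \<bullet> a h)) *\<^sub>R a h" by (simp add: v_def)
      then show ?thesis by (metis span_base span_mul singletonI)
    qed
    have ain: "a h \<in> normal_cone P F"
      unfolding normal_cone_def F_def using ineq by (auto simp: inner_commute)
    have "dim (normal_cone P F) \<le> dim {a h}"
      using dim_subset[of "normal_cone P F" "span {a h}"] subsetI[OF line] by (simp only: dim_span)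
    moreover have "dim {a h} = 1" using a0 by (subst dim_eq_card_independent) auto
    moreover have "dim {a h} \<le> dim (normal_cone P F)" using ain by (intro dim_subset) auto
    ultimately have "normal_cone P F \<in> rays P" unfolding rays_def normal_fan_def using F(1,2) by auto
    then show ?thesis using m ain by blast
  qed
  obtain y where y: "y \<in> P" using Pne by blast
  have ray: "y - c *\<^sub>R m \<in> P" if c: "c \<ge> 0" for c
  proof -
    have "y - c *\<^sub>R m \<in> h" if h: "h \<in> H" for h
    proof -
      have "y \<in> h" using H(2) y h by blast
      then have "a h \<bullet> y \<le> b h" using memH[OF h] by simp
      moreover have "c * (a h \<bullet> m) \<ge> 0" using c pos[OF h] by (simp add: inner_commute)
      ultimately have "a h \<bullet> (y - c *\<^sub>R m) \<le> b h" by (simp add: inner_diff_right)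
      then show ?thesis using memH[OF h] by simp
    qed
    then show ?thesis using H(2) hull by blast
  qed
  obtain B where B: "\<And>z. z \<in> P \<Longrightarrow> norm z \<le> B" using polytope_imp_bounded[OF poly] by (auto simp: bounded_iff)
  define c where "c = (B + norm y + 1) / norm m"
  have "B \<ge> 0" using B[OF y] norm_ge_zero order_trans by blast
  then have c: "c \<ge> 0" using m0 by (simp add: c_def)
  have "norm (c *\<^sub>R m) = B + norm y + 1" using m0 c \<open>B \<ge> 0\<close> by (simp add: c_def)
  moreover have "norm (c *\<^sub>R m) \<le> norm y + norm (y - c *\<^sub>R m)" using norm_triangle_ineq4[of y "y - c *\<^sub>R m"] by simp
  ultimately show False using B[OF ray[OF c]] by linarith
qed

subsection \<open>Divisors on the toric variety\<close>

lemma lattice_vec_inner: "lattice_vec m \<bullet> lattice_vec u = real_of_int (\<Sum>i\<in>UNIV. m $ i * u $ i)"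
  by (simp add: lattice_vec_def inner_vec_def)

lemma toric_algebra_laurent: "toric_algebra \<sigma> = laurent (dual_lattice_points \<sigma>)"
  unfolding toric_algebra_def
proof (rule generated_characters)
  show "0 \<in> dual_lattice_points \<sigma>" by (simp add: dual_lattice_points_def lattice_vec_def inner_vec_def)
  show "m + n \<in> dual_lattice_points \<sigma>" if "m \<in> dual_lattice_points \<sigma>" "n \<in> dual_lattice_points \<sigma>" for m n
  proof -
    have "lattice_vec (m + n) = lattice_vec m + lattice_vec n" by (simp add: lattice_vec_def vec_eq_iff)
    then show ?thesis using that by (auto simp: dual_lattice_points_def inner_add_left)
  qed
qed

locale full_dimensional_polytope =
  fixes P :: "(real ^ 'd) set" and T K :: "toric_field set"
  assumes rational: "rational_polytope P" and full: "aff_dim P = int CARD('d)"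
    and T_eq: "T = laurent (UNIV :: (int ^ 'd) set)" and K_eq: "K = localization T {0}"
begin

abbreviation "W \<equiv> toric_variety P"

lemma T_subring: "is_subring T"
  unfolding T_eq by (rule is_subring_torus)

lemma laurent_subset_T: "laurent M \<subseteq> T" for M :: "(int ^ 'd) set"
  unfolding T_eq by (rule laurent_mono) simp

lemma trivial_cone: "{0} \<in> normal_fan P"
proof -
  have "convex P" using rational unfolding rational_polytope_def by auto
  then have "P face_of P" by (rule face_of_refl)
  moreover have "P \<noteq> {}" using full by auto
  moreover have "normal_cone P P = {0}"
  proof
    show "normal_cone P P \<subseteq> {0}"
    proof
      fix u assume u: "u \<in> normal_cone P P"
      obtain x where x: "x \<in> P" using \<open>P \<noteq> {}\<close> by (meson ex_in_conv)
      have le: "z \<bullet> u \<le> y \<bullet> u" if "y \<in> P" "z \<in> P" for y z using u that by (simp add: normal_cone_def)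
      have "y \<bullet> u = x \<bullet> u" if "y \<in> P" for y using le[OF that x] le[OF x that] by (rule antisym[rotated])
      then show "u \<in> {0}" using full_dimensional_constant[OF full] by simp
    qed
  qed (simp add: normal_cone_def)
  ultimately show ?thesis unfolding normal_fan_def by (intro CollectI exI[of _ P]) simp
qed

lemma torus_algebra: "toric_algebra ({0} :: (real ^ 'd) set) = T"
  unfolding toric_algebra_laurent T_eq by (simp add: dual_lattice_points_def)

lemma points_W: "points W = (\<Union>\<sigma>\<in>normal_fan P. spec_points (toric_algebra \<sigma>))"
  by (simp add: toric_variety_def)

lemma torus_points: "spec_points T \<subseteq> points W"
  using trivial_cone torus_algebra unfolding points_W by blast

lemma point_W:
  assumes "R \<in> points W"
  shows "is_subring R" "R \<subseteq> K"
proof -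
  obtain \<sigma> :: "(real ^ 'd) set" where "R \<in> spec_points (toric_algebra \<sigma>)" using assms points_W by auto
  then have R: "R \<in> spec_points (laurent (dual_lattice_points \<sigma>))" by (simp add: toric_algebra_laurent)
  have ring: "is_subring (laurent (dual_lattice_points \<sigma>))"
    using toric.is_subring_generated unfolding toric_algebra_laurent[symmetric] toric_algebra_def .
  obtain q where q: "prime_localization (laurent (dual_lattice_points \<sigma>)) q" "R = localization (laurent (dual_lattice_points \<sigma>)) q"
    using R ring by (elim spec_pointsE[rotated]) 
  interpret prime_localization "laurent (dual_lattice_points \<sigma>)" q by (rule q(1))
  show "is_subring R" unfolding q(2) by (rule subring)
  show "R \<subseteq> K"
    unfolding q(2) K_eq localization_def using laurent_subset_T[of "dual_lattice_points \<sigma>"] P(4) by blast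
qed

lemma function_field_W: "function_field W = K"
proof
  show "function_field W \<subseteq> K" unfolding function_field_def using point_W(2) by blast
  have "K \<in> spec_points T" unfolding K_eq by (rule spec_pointsI[OF is_prime_ideal_zero[OF T_subring]])
  then show "K \<subseteq> function_field W" unfolding function_field_def using torus_points by blast
qed

lemma K_inverse: "x \<in> K \<Longrightarrow> inverse x \<in> K"
  using grading.K_inverse[OF coordinate_grading] unfolding K_eq T_eq .

lemma weil_sheaf_generic: "weil_sheaf W E (function_field W) = function_field W"
proof -
  have "\<not> function_field W \<subseteq> S" if "S \<in> prime_divisors W" for S
  proof
    assume "function_field W \<subseteq> S"
    moreover have "S \<subseteq> function_field W" "S \<noteq> function_field W"
      using that unfolding prime_divisors_def function_field_def by auto
    ultimately show False by simp
  qed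
  then show ?thesis unfolding weil_sheaf_def by auto
qed

lemma dvr_divisor: "dvr K S u \<Longrightarrow> S \<in> points W \<Longrightarrow> S \<in> prime_divisors W"
  using dvr_prime_divisor[of W S u] point_W(1) unfolding function_field_W by blast

text \<open>The degree is the pairing with the primitive generator; thereby the chart and the
  divisor of the ray become those of a grading. The last clause translates nonnegative degree back
  into nonnegativity on the ray.\<close>

lemma ray_grading:
  assumes \<rho>: "\<rho> \<in> rays P"
  shows "\<exists>l e. grading l e T \<and> toric_algebra \<rho> = laurent {m. l m \<ge> 0} \<and>
    ray_divisor \<rho> = localization (laurent {m. l m \<ge> 0}) (laurent {m. l m \<ge> 1}) \<and>
    (\<forall>m. l m \<ge> 0 \<longrightarrow> (\<forall>w\<in>\<rho>. lattice_vec m \<bullet> w \<ge> 0))"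
proof -
  obtain u where u: "Gcd (range (($) u)) = 1" "\<rho> = {c *\<^sub>R lattice_vec u | c. c \<ge> 0}"
    using ray_structure[OF rational full \<rho>] by (elim exE conjE)
  have gen: "primitive_generator \<rho> = u" using primitive_generator_eq[OF u] .
  define l where "l m = (\<Sum>i\<in>UNIV. m $ i * u $ i)" for m :: "int ^ 'd"
  obtain e where e: "l e = 1" using bezout_vector[OF u(1)] unfolding l_def by blast
  have inner: "lattice_vec m \<bullet> lattice_vec u = real_of_int (l m)" for m
    unfolding l_def by (rule lattice_vec_inner)
  have gr: "grading l e T"
    by unfold_locales (auto simp: e T_eq, simp add: l_def distrib_right sum.distrib)
  interpret g: grading l e T by (rule gr)
  have pos: "lattice_vec m \<bullet> w \<ge> 0" if "l m \<ge> 0" "w \<in> \<rho>" for m w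
    using that inner[of m] unfolding u(2) by auto
  have "lattice_vec u = 1 *\<^sub>R lattice_vec u" by simp
  then have u_in: "lattice_vec u \<in> \<rho>" unfolding u(2) using zero_le_one by blast
  have dual: "dual_lattice_points \<rho> = {m. l m \<ge> 0}"
    unfolding dual_lattice_points_def using pos u_in inner by (metis (no_types, lifting) Collect_cong of_int_0_le_iff)
  have ta: "toric_algebra \<rho> = laurent {m. l m \<ge> 0}" by (simp add: toric_algebra_laurent dual)
  have "ray_divisor \<rho> = localization (laurent {m. l m \<ge> 0}) (laurent {m. l m \<ge> 1})"
    unfolding ray_divisor_def ta gen inner using g.mod_span_ge by simp
  then show ?thesis using gr ta pos by blast
qed

lemma polytope_divisor_zero: "S \<notin> ray_divisor ` rays P \<Longrightarrow> polytope_divisor P S = 0"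
  unfolding polytope_divisor_def by (intro sum.neutral) auto

lemma ray_divisor_dvr:
  assumes \<rho>: "\<rho> \<in> rays P"
  shows "\<exists>u. dvr K (ray_divisor \<rho>) u" "ray_divisor \<rho> \<in> points W" "ray_divisor \<rho> \<notin> spec_points T"
proof -
  obtain l e where gr: "grading (l :: int ^ 'd \<Rightarrow> int) e T" and ta: "toric_algebra \<rho> = laurent {m. l m \<ge> 0}"
    and rd: "ray_divisor \<rho> = localization (laurent {m. l m \<ge> 0}) (laurent {m. l m \<ge> 1})"
    using ray_grading[OF \<rho>] by (elim exE conjE)
  interpret g: grading l e T by (rule gr)
  have dvr: "dvr K (ray_divisor \<rho>) (character e)" unfolding rd K_eq by (rule g.grading_dvr)
  then show "\<exists>u. dvr K (ray_divisor \<rho>) u" ..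
  have "\<rho> \<in> normal_fan P" using \<rho> by (simp add: rays_def)
  moreover have "ray_divisor \<rho> \<in> spec_points (toric_algebra \<rho>)"
    unfolding rd ta by (rule spec_pointsI[OF g.ge_1_prime])
  ultimately show "ray_divisor \<rho> \<in> points W" unfolding points_W by blast
  show "ray_divisor \<rho> \<notin> spec_points T"
  proof
    assume "ray_divisor \<rho> \<in> spec_points T"
    then have "T \<subseteq> ray_divisor \<rho>" using spec_points_properties(2)[OF T_subring] by blast
    moreover have "character (- e) \<in> T" using laurent_character[of "- e" UNIV] T_eq by simp
    ultimately have "character e powi (- 1) \<in> ray_divisor \<rho>"
      by (auto simp: character_uminus power_int_minus)
    then show False using dvr.u_power_not_in[OF dvr, of "- 1"] by simp
  qed
qed

text \<open>Such a function is a Laurent polynomial, and regularity along the divisor of each ray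
  makes its exponents nonnegative on that ray. Only the exponent zero is nonnegative on all
  rays.\<close>

lemma regular_function_constant:
  assumes f: "f \<in> K" and torus: "\<And>S u. S \<in> spec_points T \<Longrightarrow> dvr K S u \<Longrightarrow> f \<in> S"
    and rays: "\<And>\<rho>. \<rho> \<in> rays P \<Longrightarrow> f \<in> ray_divisor \<rho>"
  shows "f \<in> range toric_scalar"
proof -
  have fT: "f \<in> T"
    by (rule torus_regular_function[OF T_eq f[unfolded K_eq]]) (rule torus[unfolded K_eq])
  \<comment> \<open>Each ray contributes the half-space of exponents that it allows; the support of
    \<open>f\<close> lies in all of them.\<close>
  define N where "N = {M :: (int ^ 'd) set. f \<in> laurent M \<and> (\<exists>\<rho>\<in>rays P. \<forall>m\<in>M. \<forall>w\<in>\<rho>. lattice_vec m \<bullet> w \<ge> 0)}"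
  have ray: "\<exists>M\<in>N. \<forall>m\<in>M. \<forall>w\<in>\<rho>. lattice_vec m \<bullet> w \<ge> 0" if \<rho>: "\<rho> \<in> rays P" for \<rho>
  proof -
    obtain l e where gr: "grading (l :: int ^ 'd \<Rightarrow> int) e T"
      and rd: "ray_divisor \<rho> = localization (laurent {m. l m \<ge> 0}) (laurent {m. l m \<ge> 1})"
      and pos: "\<forall>m. l m \<ge> 0 \<longrightarrow> (\<forall>w\<in>\<rho>. lattice_vec m \<bullet> w \<ge> 0)"
      using ray_grading[OF \<rho>] by (elim exE conjE)
    interpret g: grading l e T by (rule gr)
    have "f \<in> laurent {m. l m \<ge> 0}" using g.regular_along_divisor[OF fT] rays[OF \<rho>] rd by simp
    then have "{m. l m \<ge> 0} \<in> N" unfolding N_def using pos \<rho> by (intro CollectI conjI bexI[of _ \<rho>]) auto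
    then show ?thesis using pos by (intro bexI[of _ "{m. l m \<ge> 0}"]) auto
  qed
  show ?thesis
  proof (rule positive_support_constant)
    show "f \<in> laurent (UNIV :: (int ^ 'd) set)" using fT T_eq by simp
    show "f \<in> laurent M" if "M \<in> N" for M using that by (simp add: N_def)
    show "\<Inter>N \<subseteq> {0}"
    proof
      fix m assume m: "m \<in> \<Inter>N"
      have "lattice_vec m \<bullet> w \<ge> 0" if \<rho>: "\<rho> \<in> rays P" and w: "w \<in> \<rho>" for \<rho> w
      proof -
        obtain M where "M \<in> N" "\<forall>m\<in>M. \<forall>w\<in>\<rho>. lattice_vec m \<bullet> w \<ge> 0" using ray[OF \<rho>] by (rule bexE)
        then show ?thesis using m w by (simp add: Inter_iff)
      qed
      then have "lattice_vec m = 0" by (rule rays_positively_span[OF rational full])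
      then show "m \<in> {0}" by (simp add: lattice_vec_def vec_eq_iff)
    qed
  qed
qed

end

text \<open>A positive fractional part exceeds \<open>1\<close> after multiplication by a suitable
  \<open>n\<close>, and then the floor of the multiple is too large.\<close>

lemma integer_if_floor_multiples:
  fixes b :: real
  assumes "\<And>n::nat. n \<ge> 1 \<Longrightarrow> \<lfloor>real n * b\<rfloor> = int n * \<lfloor>b\<rfloor>"
  shows "b \<in> \<int>"
proof (rule ccontr)
  assume "b \<notin> \<int>"
  then have "frac b > 0" by (simp add: frac_gt_0_iff)
  then obtain n :: nat where n: "1 < real n * frac b" using reals_Archimedean3 by blast
  then have "n \<ge> 1" by (cases n) auto
  have "real n * b = real n * of_int \<lfloor>b\<rfloor> + real n * frac b" by (simp add: frac_def algebra_simps)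
  then have "of_int (int n * \<lfloor>b\<rfloor> + 1) \<le> real n * b" using n by simp
  then have "int n * \<lfloor>b\<rfloor> + 1 \<le> \<lfloor>real n * b\<rfloor>" by (simp only: le_floor_iff)
  then show False using assms[OF \<open>n \<ge> 1\<close>] by simp
qed

subsection \<open>Integrality\<close>

text \<open>The function \<open>\<theta>\<close> has order \<open>- a S\<close> at each discrete
  valuation ring \<open>S\<close> of the toric variety. Once it is known to be constant, all these
  orders are zero.\<close>

lemma degeneration_floor_multiples:
  fixes X :: "'k::field model" and D :: "'k set \<Rightarrow> 'k" and P :: "(real ^ 'd) set" and Y :: "'b::field model"
  assumes X: "projective_variety X" "cartier_divisor X D"
    and P: "rational_polytope P" "aff_dim P = int CARD('d)"
    and deg: "toric_degeneration Y p X D P"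
    and n: "n \<ge> 1" and \<rho>: "\<rho> \<in> rays P"
  shows "\<lfloor>real n * polytope_divisor P (ray_divisor \<rho>)\<rfloor> = int n * \<lfloor>polytope_divisor P (ray_divisor \<rho>)\<rfloor>"
proof -
  define T where "T = laurent (UNIV :: (int ^ 'd) set)"
  define K where "K = localization T {0}"
  interpret full_dimensional_polytope P T K
    using P T_def K_def by unfold_locales
  have Y: "variety Y" "regular_function Y p" using deg by (simp_all add: toric_degeneration_def)
  obtain \<Phi> \<phi> where iso: "\<forall>t. t \<noteq> 0 \<longrightarrow> fiber_iso Y p t X (\<Phi> t)" "fiber_iso Y p 0 W \<phi>"
    and sheaves: "\<forall>n\<ge>1. \<exists>F. divisorial_sheaf Y F \<and>
      (\<forall>t. t \<noteq> 0 \<longrightarrow> restricts_to Y p t (\<Phi> t) F (cartier_multiple_sheaf D n)) \<and>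
      restricts_to Y p 0 \<phi> F (weil_sheaf W (floor_multiple n (polytope_divisor P)))"
    using deg unfolding toric_degeneration_def by (elim conjE exE)
  obtain F where F: "divisorial_sheaf Y F"
    "\<forall>t. t \<noteq> 0 \<longrightarrow> restricts_to Y p t (\<Phi> t) F (cartier_multiple_sheaf D 1)"
    "restricts_to Y p 0 \<phi> F (weil_sheaf W (floor_multiple 1 (polytope_divisor P)))"
    using sheaves[rule_format, OF order_refl] by (elim exE conjE)
  obtain F' where F': "divisorial_sheaf Y F'"
    "\<forall>t. t \<noteq> 0 \<longrightarrow> restricts_to Y p t (\<Phi> t) F' (cartier_multiple_sheaf D n)"
    "restricts_to Y p 0 \<phi> F' (weil_sheaf W (floor_multiple n (polytope_divisor P)))"
    using sheaves[rule_format, OF n] by (elim exE conjE)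
  have varX: "variety X" using X(1) by (simp add: projective_variety_def)
  obtain \<B> where "charted X \<B>" using variety_charted[OF varX] ..
  interpret X: charted X \<B> by fact
  \<comment> \<open>The sheaf of a multiple of a Cartier divisor is generated by the corresponding
    power of the inverse local equation.\<close>
  have principal: "\<exists>y\<in>function_field X. y \<noteq> 0 \<and> cartier_multiple_sheaf D 1 S = (*) y ` S \<and>
      cartier_multiple_sheaf D n S = (*) (y ^ n) ` S" if S: "S \<in> points X" for S
  proof -
    have D: "D S \<in> function_field X" "D S \<noteq> 0" using X(2) S unfolding cartier_divisor_def by auto
    have "cartier_multiple_sheaf D k S = (*) (inverse (D S) ^ k) ` S" for k
      unfolding cartier_multiple_sheaf_def image_def by (auto simp: field_simps)
    then show ?thesis using D X.function_field_inverse
      by (intro bexI[of _ "inverse (D S)"]) auto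
  qed
  have W1: "scalar W 1 = 1" by (simp add: toric_variety_def toric.sc_1)
  have "\<exists>\<theta>\<in>function_field W. \<theta> \<noteq> 0 \<and> (\<forall>S\<in>points W. \<forall>y y'. y \<noteq> 0 \<longrightarrow> y' \<noteq> 0 \<longrightarrow>
    weil_sheaf W (floor_multiple 1 (polytope_divisor P)) S = (*) y ` S \<longrightarrow>
    weil_sheaf W (floor_multiple n (polytope_divisor P)) S = (*) y' ` S \<longrightarrow> \<theta> * y ^ n / y' \<in> ring_units S)"
    by (rule degeneration_ratio[OF Y X(1) iso(1)[rule_format] iso(2) W1 _ F(1) F(2)[rule_format] F(3)
          F'(1) F'(2)[rule_format] F'(3) principal weil_sheaf_generic weil_sheaf_generic])
       (simp_all add: function_field_W K_inverse)
  then obtain \<theta> where \<theta>: "\<theta> \<in> K" "\<theta> \<noteq> 0"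
    and unit: "\<forall>S\<in>points W. \<forall>y y'. y \<noteq> 0 \<longrightarrow> y' \<noteq> 0 \<longrightarrow>
    weil_sheaf W (floor_multiple 1 (polytope_divisor P)) S = (*) y ` S \<longrightarrow>
    weil_sheaf W (floor_multiple n (polytope_divisor P)) S = (*) y' ` S \<longrightarrow> \<theta> * y ^ n / y' \<in> ring_units S"
    unfolding function_field_W by (elim bexE conjE)
  define a where "a S = \<lfloor>real n * polytope_divisor P S\<rfloor> - int n * \<lfloor>polytope_divisor P S\<rfloor>" for S
  have order: "\<theta> * u powi (a S) \<in> ring_units S" if S: "S \<in> points W" "dvr K S u" for S u
  proof -
    interpret dvr K S u by (rule S(2))
    \<comment> \<open>At a discrete valuation ring both sheaves are principal, so the comparison of
      generators applies with powers of the uniformizer.\<close>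
    have sheaf: "weil_sheaf W E S = (*) (u powi (- E S)) ` S" for E
      using weil_sheaf_dvr[of W S u E] S dvr_divisor unfolding function_field_W by blast
    have nz: "u powi k \<noteq> 0" for k using u_nonzero by simp
    have "\<theta> * (u powi (- \<lfloor>polytope_divisor P S\<rfloor>)) ^ n / u powi (- \<lfloor>real n * polytope_divisor P S\<rfloor>) \<in> ring_units S"
      using unit[rule_format, OF S(1) nz nz sheaf sheaf] by (simp add: floor_multiple_def)
    moreover have "(u powi (- \<lfloor>polytope_divisor P S\<rfloor>)) ^ n / u powi (- \<lfloor>real n * polytope_divisor P S\<rfloor>) = u powi (a S)"
      using u_nonzero
      by (simp add: a_def power_int_power' power_int_minus power_int_diff field_simps flip: power_int_mult)
    ultimately show ?thesis by (metis times_divide_eq_right)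
  qed
  have inv: "inverse \<theta> = u powi (a S) * inverse (\<theta> * u powi (a S))" if "dvr K S u" for S u
    using dvr.u_nonzero[OF that] \<theta>(2) by simp
  have regular: "inverse \<theta> \<in> S" if S: "S \<in> points W" "dvr K S u" and a: "a S \<ge> 0" for S u
    using inv[OF S(2)] in_ring_unitsD(2)[OF order[OF S]] dvr.u_power_in[OF S(2) a]
      is_subringD(3)[OF point_W(1)[OF S(1)]] by metis
  \<comment> \<open>Rounding down after multiplication loses at most as much as rounding down
    before; this inequality holds at every \<open>S\<close> and excludes poles of the inverse of
    \<open>\<theta>\<close>.\<close>
  have a_nonneg: "a S \<ge> 0" for S
    unfolding a_def by (simp add: le_floor_iff mult_left_mono)
  have "inverse \<theta> \<in> range toric_scalar"
  proof (rule regular_function_constant)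
    show "inverse \<theta> \<in> K" using \<theta>(1) by (rule K_inverse)
    show "inverse \<theta> \<in> S" if "S \<in> spec_points T" "dvr K S u" for S u
      using regular[OF _ that(2) a_nonneg] torus_points that(1) by blast
    show "inverse \<theta> \<in> ray_divisor \<rho>" if "\<rho> \<in> rays P" for \<rho>
      using regular[OF ray_divisor_dvr(2)[OF that] _ a_nonneg] ray_divisor_dvr(1)[OF that] by blast
  qed
  then obtain c where c: "inverse \<theta> = toric_scalar c" by blast
  have "c \<noteq> 0" using c \<theta>(2) toric.sc_0 by auto
  obtain u where dvr: "dvr K (ray_divisor \<rho>) u" using ray_divisor_dvr(1)[OF \<rho>] ..
  note pt = ray_divisor_dvr(2)[OF \<rho>]
  have scalars: "toric_scalar k \<in> ray_divisor \<rho>" for k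
  proof -
    have "ray_divisor \<rho> \<in> (\<Union>\<sigma>\<in>normal_fan P. spec_points (toric_algebra \<sigma>))" using pt points_W by simp
    then obtain \<sigma> :: "(real ^ 'd) set" where "ray_divisor \<rho> \<in> spec_points (toric_algebra \<sigma>)" by blast
    then have "toric_algebra \<sigma> \<subseteq> ray_divisor \<rho>"
      using spec_points_properties(2) toric.is_subring_generated unfolding toric_algebra_def by blast
    then show ?thesis using toric.scalar_in_generated unfolding toric_algebra_def by blast
  qed
  have "toric_scalar c \<in> ring_units (ray_divisor \<rho>)"
    unfolding ring_units_def using scalars \<open>c \<noteq> 0\<close> by (simp add: toric.sc_eq_0_iff flip: toric.sc_inverse)
  \<comment> \<open>The product of \<open>\<theta>\<close> and the scalar is \<open>1\<close>, so a
    bare power of the uniformizer is left as a unit, and its exponent must vanish.\<close>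
  then have "toric_scalar c * (\<theta> * u powi (a (ray_divisor \<rho>))) \<in> ring_units (ray_divisor \<rho>)"
    using ring_units_mult[OF point_W(1)[OF pt]] order[OF pt dvr] by blast
  moreover have "toric_scalar c * (\<theta> * u powi (a (ray_divisor \<rho>))) = u powi (a (ray_divisor \<rho>))"
    unfolding c[symmetric] using \<theta>(2) by simp
  ultimately have "a (ray_divisor \<rho>) = 0" using dvr.unit_u_power[OF dvr] by simp
  then show ?thesis by (simp add: a_def)
qed

theorem theorem7:
  fixes X :: "'k::field model" and D :: "'k set \<Rightarrow> 'k" and P :: "(real^'d) set"
  assumes "normal_variety X" and "projective_variety X" and "variety_dimension X = enat CARD('d)"
    and "cartier_divisor X D" and "ample X D"
    and "rational_polytope P" and "aff_dim P = int CARD('d)"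
    and "\<exists>(Y :: 'b::field model) p. toric_degeneration Y p X D P"
  shows "weil_divisor (toric_variety P) (polytope_divisor P)"
proof -
  obtain Y :: "'b model" and p where deg: "toric_degeneration Y p X D P" using assms(8) by (elim exE)
  interpret full_dimensional_polytope P "laurent (UNIV :: (int ^ 'd) set)" "localization (laurent (UNIV :: (int ^ 'd) set)) {0}"
    using assms(6,7) by unfold_locales simp_all
  have support: "{S. polytope_divisor P S \<noteq> 0} \<subseteq> ray_divisor ` rays P"
    using polytope_divisor_zero by blast
  have "finite (ray_divisor ` rays P)" using finite_rays[OF assms(6)] by simp
  then have "finite {S. polytope_divisor P S \<noteq> 0}" by (rule finite_subset[OF support])
  moreover have "ray_divisor \<rho> \<in> prime_divisors (toric_variety P)" if "\<rho> \<in> rays P" for \<rho>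
    using ray_divisor_dvr(1)[OF that] dvr_divisor[OF _ ray_divisor_dvr(2)[OF that]] by blast
  moreover have "polytope_divisor P S \<in> \<int>" for S
  proof (cases "S \<in> ray_divisor ` rays P")
    case True
    then obtain \<rho> where "\<rho> \<in> rays P" "S = ray_divisor \<rho>" by blast
    then show ?thesis
      using integer_if_floor_multiples degeneration_floor_multiples[OF assms(2,4,6,7) deg] by blast
  next
    case False
    then show ?thesis by (simp add: polytope_divisor_zero)
  qed
  ultimately show ?thesis unfolding weil_divisor_def using support by blast
qed

end
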